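(* There exists a family of graphs with tropical crossing number growing quadratically in the genus. That is, there exist constants $0<c\leq C$ and a sequence $(G_n)_{n\geq 1}$ of connected trivalent finite graphs, with $g_n$ denoting the genus of $G_n$, such that $g_n\to\infty$ and $c\,g_n^2\leq \mathrm{TCN}(G_n)\leq C\,g_n^2$ for all $n$.
   Context: Graphs are finite; multiple edges and loops are allowed. The degree of a vertex is the number of edges incident to it, loops counted twice; a graph is trivalent if every vertex has degree $3$. The genus of a connected graph is $|E|-|V|+1$. A lattice polygon is a (two-dimensional) convex polygon in $\mathbb{R}^2$ with vertices in $\mathbb{Z}^2$. A subdivision of a lattice polygon is a partition into lattice polygons such that any two meet in a common face (edge, vertex, or empty). It is regular if it is induced by a height function: for some real-valued function $h$ on the set $S$ of lattice points of the polygon, its cells are the projections of the upper faces of the convex hull of $\{(p,h(p)):p\in S\}$. A nodal subdivision is a regular subdivision all of whose cells are triangles of area $1/2$ or parallelograms of area $1$. A tropical plane curve is the set of points of $\mathbb{R}^2$ where the maximum in a tropical (max-plus) polynomial $p(x,y)$ is attained at least twice. Its Newton polygon is the convex hull of the exponent vectors of the terms with coefficient $\neq-\infty$. The curve is dual to the regular subdivision of its Newton polygon induced by the coefficients: one vertex for each cell, an edge between two vertices (perpendicular to the dual edge) when the cells share an edge, and a ray for each boundary edge of the subdivision. A nodal tropical curve is a tropical plane curve whose dual subdivision is a nodal subdivision. Each parallelogram gives a $4$-valent point of the curve, called a node. A node is interpreted as a crossing of two edges of an immersed abstract curve, not as a vertex: the abstract curve (a metric graph with rays) is obtained by separating, at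 each node, the two straight strands that cross there. The skeleton of a nodal tropical curve is a minimal subset onto which its abstract curve deformation retracts. When the abstract curve is connected of first Betti number at least $2$, the skeleton is obtained by deleting all rays, iteratively deleting $1$-valent vertices together with their incident edge, and smoothing all $2$-valent vertices; it is regarded as a combinatorial graph by forgetting lengths. Only nodal tropical curves with connected skeleton are considered. For a connected trivalent graph $G$, the tropical crossing number $\mathrm{TCN}(G)$ is the minimum number of nodes of a nodal tropical curve whose skeleton is (isomorphic as a combinatorial graph to) $G$, with no condition on edge lengths. It is known that every connected trivalent graph is the skeleton of some nodal tropical curve, so this is a well-defined nonnegative integer. *)

theory Defs
  imports "HOL-Analysis.Analysis" "HOL-Library.Multiset"
begin

section \<open>Multigraphs\<close>

text \<open>The end points of an edge form a multiset of size two; a loop at \<open>v\<close> has ends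
  \<open>{#v, v#}\<close>, so that it contributes two to the degree of \<open>v\<close>.\<close>

record ('v, 'e) mgraph =
  verts :: "'v set"
  edges :: "'e set"
  ends :: "'e \<Rightarrow> 'v multiset"

definition finite_mgraph :: "('v, 'e) mgraph \<Rightarrow> bool" where
  "finite_mgraph G \<longleftrightarrow> finite (verts G) \<and> finite (edges G) \<and>
     (\<forall>e\<in>edges G. size (ends G e) = 2 \<and> set_mset (ends G e) \<subseteq> verts G)"

definition mg_degree :: "('v, 'e) mgraph \<Rightarrow> 'v \<Rightarrow> nat" where
  "mg_degree G v = (\<Sum>e\<in>edges G. count (ends G e) v)"

definition trivalent :: "('v, 'e) mgraph \<Rightarrow> bool" where
  "trivalent G \<longleftrightarrow> (\<forall>v\<in>verts G. mg_degree G v = 3)"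

definition mg_connected :: "('v, 'e) mgraph \<Rightarrow> bool" where
  "mg_connected G \<longleftrightarrow> verts G \<noteq> {} \<and>
     (\<forall>u\<in>verts G. \<forall>v\<in>verts G. (u, v) \<in> {(a, b). \<exists>e\<in>edges G. ends G e = {#a, b#}}\<^sup>*)"

definition genus :: "('v, 'e) mgraph \<Rightarrow> int" where
  "genus G = int (card (edges G)) - int (card (verts G)) + 1"

definition mg_iso :: "('v, 'e) mgraph \<Rightarrow> ('w, 'd) mgraph \<Rightarrow> bool" where
  "mg_iso G H \<longleftrightarrow> (\<exists>\<phi> \<psi>. bij_betw \<phi> (verts G) (verts H) \<and> bij_betw \<psi> (edges G) (edges H) \<and>
     (\<forall>e\<in>edges G. ends H (\<psi> e) = image_mset \<phi> (ends G e)))"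

definition prune :: "('v, 'e) mgraph \<Rightarrow> ('v, 'e) mgraph \<Rightarrow> bool" where
  "prune G H \<longleftrightarrow> (\<exists>v\<in>verts G. mg_degree G v = 1 \<and>
     H = G\<lparr>verts := verts G - {v}, edges := {e \<in> edges G. v \<notin># ends G e}\<rparr>)"

text \<open>Smoothing a 2-valent vertex merges its two edges; the merged edge inherits the name of one
  of them. (A vertex whose only edge is a loop cannot be smoothed.)\<close>

definition smooth :: "('v, 'e) mgraph \<Rightarrow> ('v, 'e) mgraph \<Rightarrow> bool" where
  "smooth G H \<longleftrightarrow> (\<exists>v\<in>verts G. \<exists>e1\<in>edges G. \<exists>e2\<in>edges G. \<exists>a b.
     mg_degree G v = 2 \<and> e1 \<noteq> e2 \<and> ends G e1 = {#v, a#} \<and> ends G e2 = {#v, b#} \<and>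
     H = G\<lparr>verts := verts G - {v}, edges := edges G - {e2}, ends := (ends G)(e1 := {#a, b#})\<rparr>)"

definition reduces_to :: "('v, 'e) mgraph \<Rightarrow> ('v, 'e) mgraph \<Rightarrow> bool" where
  "reduces_to G S \<longleftrightarrow> (\<exists>H. prune\<^sup>*\<^sup>* G H \<and> (\<forall>v\<in>verts H. mg_degree H v \<noteq> 1) \<and>
     smooth\<^sup>*\<^sup>* H S \<and> (\<forall>v\<in>verts S. mg_degree S v \<noteq> 2))"


section \<open>Subdivisions of lattice polygons\<close>

definition lattice_polygon :: "(real \<times> real) set \<Rightarrow> bool" where
  "lattice_polygon P \<longleftrightarrow> polytope P \<and> aff_dim P = 2 \<and> {v. v extreme_point_of P} \<subseteq> \<int> \<times> \<int>"

definition lattice_subdivision :: "(real \<times> real) set \<Rightarrow> (real \<times> real) set set \<Rightarrow> bool" where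
  "lattice_subdivision P D \<longleftrightarrow> lattice_polygon P \<and> finite D \<and> (\<forall>\<sigma>\<in>D. lattice_polygon \<sigma>) \<and>
     \<Union>D = P \<and> (\<forall>\<sigma>\<in>D. \<forall>\<tau>\<in>D. (\<sigma> \<inter> \<tau>) face_of \<sigma> \<and> (\<sigma> \<inter> \<tau>) face_of \<tau>)"

definition upper_face_of :: "((real \<times> real) \<times> real) set \<Rightarrow> ((real \<times> real) \<times> real) set \<Rightarrow> bool"
    (infixr \<open>(upper'_face'_of)\<close> 50) where
  "F upper_face_of Q \<longleftrightarrow> F \<noteq> {} \<and>
     (\<exists>a b. snd a > 0 \<and> Q \<subseteq> {z. a \<bullet> z \<le> b} \<and> F = Q \<inter> {z. a \<bullet> z = b})"

text \<open>Only the maximal (two-dimensional) cells are recorded.\<close>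

definition induced_cells ::
    "(real \<times> real) set \<Rightarrow> (real \<times> real \<Rightarrow> real) \<Rightarrow> (real \<times> real) set set" where
  "induced_cells S h =
     {fst ` F | F. F upper_face_of (convex hull ((\<lambda>p. (p, h p)) ` S)) \<and> aff_dim F = 2}"

definition regular_subdivision :: "(real \<times> real) set \<Rightarrow> (real \<times> real) set set \<Rightarrow> bool" where
  "regular_subdivision P D \<longleftrightarrow>
     lattice_subdivision P D \<and> (\<exists>h. D = induced_cells (P \<inter> \<int> \<times> \<int>) h)"

definition triangle :: "(real \<times> real) set \<Rightarrow> bool" where
  "triangle \<sigma> \<longleftrightarrow> (\<exists>a b c. \<not> collinear {a, b, c} \<and> \<sigma> = convex hull {a, b, c})"

definition parallelogram :: "(real \<times> real) set \<Rightarrow> bool" where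
  "parallelogram \<sigma> \<longleftrightarrow>
     (\<exists>a u v. \<not> collinear {0, u, v} \<and> \<sigma> = convex hull {a, a + u, a + v, a + u + v})"

definition nodal_subdivision :: "(real \<times> real) set \<Rightarrow> (real \<times> real) set set \<Rightarrow> bool" where
  "nodal_subdivision P D \<longleftrightarrow> regular_subdivision P D \<and>
     (\<forall>\<sigma>\<in>D. triangle \<sigma> \<and> measure lebesgue \<sigma> = 1/2 \<or>
            parallelogram \<sigma> \<and> measure lebesgue \<sigma> = 1)"


section \<open>Tropical plane curves\<close>

text \<open>The support is the set of exponent vectors of the terms with coefficient different from
  \<open>-\<infinity>\<close>; \<^const>\<open>inner\<close> pairs an exponent vector with a point of the plane.\<close>

record trop_poly =
  supp :: "(real \<times> real) set"
  coef :: "real \<times> real \<Rightarrow> real"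

definition is_trop_poly :: "trop_poly \<Rightarrow> bool" where
  "is_trop_poly f \<longleftrightarrow> finite (supp f) \<and> supp f \<noteq> {} \<and> supp f \<subseteq> \<nat> \<times> \<nat>"

definition trop_eval :: "trop_poly \<Rightarrow> real \<times> real \<Rightarrow> real" where
  "trop_eval f x = Max ((\<lambda>p. coef f p + p \<bullet> x) ` supp f)"

definition max_terms :: "trop_poly \<Rightarrow> real \<times> real \<Rightarrow> (real \<times> real) set" where
  "max_terms f x = {p \<in> supp f. coef f p + p \<bullet> x = trop_eval f x}"

definition tropical_curve :: "trop_poly \<Rightarrow> (real \<times> real) set" where
  "tropical_curve f = {x. 2 \<le> card (max_terms f x)}"

definition newton_polygon :: "trop_poly \<Rightarrow> (real \<times> real) set" where
  "newton_polygon f = convex hull (supp f)"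

definition dual_subdivision :: "trop_poly \<Rightarrow> (real \<times> real) set set" where
  "dual_subdivision f = induced_cells (supp f) (coef f)"

definition nodal_tropical_curve :: "trop_poly \<Rightarrow> bool" where
  "nodal_tropical_curve f \<longleftrightarrow>
     is_trop_poly f \<and> nodal_subdivision (newton_polygon f) (dual_subdivision f)"

text \<open>Duality: the face of the subdivision dual to a point \<open>x\<close> of the curve is spanned by the
  exponents of the terms that are maximal at \<open>x\<close>. It is a two-dimensional cell exactly if \<open>x\<close> is a
  vertex of the curve: a node for a parallelogram, a vertex of the abstract curve for a triangle.\<close>

definition dual_face :: "trop_poly \<Rightarrow> real \<times> real \<Rightarrow> (real \<times> real) set" where
  "dual_face f x = convex hull (max_terms f x)"

definition nodes :: "trop_poly \<Rightarrow> (real \<times> real) set" where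
  "nodes f = {x \<in> tropical_curve f. dual_face f x \<in> dual_subdivision f \<and> parallelogram (dual_face f x)}"

definition curve_vertices :: "trop_poly \<Rightarrow> (real \<times> real) set" where
  "curve_vertices f =
     {x \<in> tropical_curve f. dual_face f x \<in> dual_subdivision f \<and> triangle (dual_face f x)}"

text \<open>Strands pass straight through nodes. Hence, once the strands are separated at the nodes, a
  bounded edge of the abstract curve is a straight segment contained in the curve that joins two
  vertices and has no vertex in its interior, but possibly nodes. Two vertices are joined by at
  most one such segment, so the edge is represented by its pair of end points. The bounded part is
  what remains of the abstract curve after deleting all rays.\<close>

definition bounded_part :: "trop_poly \<Rightarrow> (real \<times> real, (real \<times> real) set) mgraph" where
  "bounded_part f =
     \<lparr>verts = curve_vertices f,
      edges = {{v, w} | v w. v \<in> curve_vertices f \<and> w \<in> curve_vertices f \<and> v \<noteq> w \<and>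
                 open_segment v w \<subseteq> tropical_curve f - curve_vertices f},
      ends = mset_set\<rparr>"

text \<open>A strand without vertices is a complete straight line, possibly crossing other strands in
  nodes, and is a connected component of the abstract curve by itself. Deleting rays does not
  affect connectedness. (If a nodal curve has no vertices, its subdivision contains only
  parallelograms, and the abstract curve consists of at least two lines.)\<close>

definition abstract_curve_connected :: "trop_poly \<Rightarrow> bool" where
  "abstract_curve_connected f \<longleftrightarrow> mg_connected (bounded_part f) \<and>
     \<not> (\<exists>a d. d \<noteq> 0 \<and> range (\<lambda>t. a + t *\<^sub>R d) \<subseteq> tropical_curve f - curve_vertices f)"

definition has_skeleton :: "trop_poly \<Rightarrow> ('v, 'e) mgraph \<Rightarrow> bool" where
  "has_skeleton f G \<longleftrightarrow> abstract_curve_connected f \<and>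
     (\<exists>S. reduces_to (bounded_part f) S \<and> mg_iso S G)"

text \<open>\<open>Inf\<close> of a nonempty set of natural numbers is its minimum.\<close>

definition TCN :: "('v, 'e) mgraph \<Rightarrow> nat" where
  "TCN G = Inf {card (nodes f) | f. nodal_tropical_curve f \<and> has_skeleton f G}"

end

theory Submission
  imports Defs
begin

text \<open>Lower bound. Call a set of vertices with at most one outgoing edge a pendant piece. A linear
  functional on a pendant piece of a nodal curve attains its maximum and its minimum at vertices
  where a strand leaves the piece, and only one of these two strands can be the outgoing edge. So
  every piece has a ray that is not perpendicular to a given direction, and \<open>m\<close> disjoint pieces force
  the Newton polygon to have lattice width at least \<open>m / 2\<close> in every direction. A polygon of minimal
  width \<open>w\<close> has area of order at least \<open>w\<^sup>2\<close>, whereas the triangles of the subdivision only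
  account for an area linear in the genus and the number of rays; the rest of the area is filled by
  parallelograms. Pendant pieces survive the inverse operations of pruning and smoothing, so the
  bound depends only on the skeleton.

  Upper bound. Resolving an arbitrary set of crossings in a grid of horizontal and vertical lines
  gives a nodal curve, and one can resolve \<open>5 m\<close> crossings of a grid with about \<open>2 m\<close> lines in either
  direction so that the skeleton is trivalent, has genus linear in \<open>m\<close> and has \<open>m\<close> pendant cycles.\<close>

section \<open>Pendant pieces of a multigraph\<close>

text \<open>A width bound in a single direction would give no area bound, because a polygon can be
  long and thin. Hence every lattice direction is bounded, and the area is estimated with a lattice
  basis \<open>w\<close>, \<open>w'\<close> adapted to the polygon, in which \<open>w\<close> has
  least width. Write W and W' for the two widths, T for the number of trivalent vertices, R for the
  number of rays and g for the genus. Counting strands gives T <= 2 g - 2 + R. Distinct rays use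
  distinct primitive boundary segments, so R <= 2 W + 2 W'. The area is at least W W' / 16 and at
  most T / 2 plus the number of nodes. At least W W' / 16 - W - W' - g + 1 nodes remain, with W' >=
  W >= m / 2 and g linear in m.

  Families of pieces travel along a reduction in both directions. For the lower bound, a family of
  the skeleton is lifted to an arbitrary curve with that skeleton, and the bound on exits suffices.
  For the upper bound, a family of the constructed curve has to survive into its skeleton; there
  each piece must also contain a cycle.\<close>

definition exit_edges :: "('v, 'e) mgraph \<Rightarrow> 'v set \<Rightarrow> 'e set" where
  "exit_edges G W = {e \<in> edges G. (\<exists>x\<in>W. x \<in># ends G e) \<and> (\<exists>y. y \<notin> W \<and> y \<in># ends G e)}"

definition inner_edges :: "('v, 'e) mgraph \<Rightarrow> 'v set \<Rightarrow> 'e set" where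
  "inner_edges G W = {e \<in> edges G. set_mset (ends G e) \<subseteq> W}"

definition one_exit_family :: "('v, 'e) mgraph \<Rightarrow> nat \<Rightarrow> (nat \<Rightarrow> 'v set) \<Rightarrow> bool" where
  "one_exit_family G m W \<longleftrightarrow>
     (\<forall>i<m. W i \<noteq> {} \<and> W i \<subseteq> verts G \<and> card (exit_edges G (W i)) \<le> 1) \<and>
     (\<forall>i<m. \<forall>j<m. i \<noteq> j \<longrightarrow> W i \<inter> W j = {})"

text \<open>With at least as many inner edges as vertices a piece is not a forest. The count is a
  convenient form of containing a cycle: a reduction step that takes a vertex from the piece costs
  it at most one inner edge, and other steps cost it none.\<close>

definition cyclic_family :: "('v, 'e) mgraph \<Rightarrow> nat \<Rightarrow> (nat \<Rightarrow> 'v set) \<Rightarrow> bool" where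
  "cyclic_family G m W \<longleftrightarrow> one_exit_family G m W \<and> (\<forall>i<m. card (W i) \<le> card (inner_edges G (W i)))"

definition adj :: "('v, 'e) mgraph \<Rightarrow> ('v \<times> 'v) set" where
  "adj G = {(a, b). \<exists>e\<in>edges G. ends G e = {#a, b#}}"

section \<open>Adjacency, ends of edges, and the two reduction steps\<close>

lemma mg_connected_adj:
  "mg_connected G \<longleftrightarrow> verts G \<noteq> {} \<and> (\<forall>u\<in>verts G. \<forall>v\<in>verts G. (u, v) \<in> (adj G)\<^sup>*)"
  unfolding mg_connected_def adj_def ..

lemma adj_sym: "(a, b) \<in> adj G \<Longrightarrow> (b, a) \<in> adj G"
  unfolding adj_def by (auto simp: add_mset_commute)

lemma adj_rtrancl_sym: "(a, b) \<in> (adj G)\<^sup>* \<Longrightarrow> (b, a) \<in> (adj G)\<^sup>*"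
  by (metis adj_sym symI sym_rtrancl symD)

lemma ends_pair:
  assumes "finite_mgraph G" "e \<in> edges G"
  obtains a b where "ends G e = {#a, b#}" "a \<in> verts G" "b \<in> verts G"
proof -
  have s: "size (ends G e) = 2" "set_mset (ends G e) \<subseteq> verts G"
    using assms unfolding finite_mgraph_def by auto
  then obtain a M where M: "ends G e = add_mset a M" by (metis multiset_cases size_empty zero_neq_numeral)
  then have "size M = 1" using s by simp
  then obtain b where "M = {#b#}" using size_1_singleton_mset by blast
  then show ?thesis using that M s by auto
qed

lemma ends_with:
  assumes "finite_mgraph G" "e \<in> edges G" "v \<in># ends G e"
  obtains a where "ends G e = {#v, a#}" "a \<in> verts G"
proof -
  obtain a b where "ends G e = {#a, b#}" "a \<in> verts G" "b \<in> verts G"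
    using ends_pair[OF assms(1,2)] .
  then show ?thesis using that assms(3) by (auto simp: add_mset_commute)
qed

text \<open>A loop would contribute 2 to the degree, so degree 1 means a single edge whose other end
  \<open>a\<close> differs from \<open>v\<close>.\<close>

lemma pruneE:
  assumes "finite_mgraph G" "prune G H"
  obtains v e a where "v \<in> verts G" "e \<in> edges G" "ends G e = {#v, a#}" "a \<noteq> v" "a \<in> verts G"
    "verts H = verts G - {v}" "edges H = edges G - {e}" "ends H = ends G"
    "\<And>e'. e' \<in> edges G \<Longrightarrow> e' \<noteq> e \<Longrightarrow> v \<notin># ends G e'"
proof -
  from assms(2) obtain v where v: "v \<in> verts G" "mg_degree G v = 1"
    and H: "H = G\<lparr>verts := verts G - {v}, edges := {e \<in> edges G. v \<notin># ends G e}\<rparr>"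
    unfolding prune_def by auto
  have fin: "finite (edges G)" using assms(1) unfolding finite_mgraph_def by auto
  from v(2) obtain e where e: "e \<in> edges G" "count (ends G e) v = 1"
    and r: "\<forall>e'\<in>edges G. e \<noteq> e' \<longrightarrow> count (ends G e') v = 0"
    unfolding mg_degree_def using sum_eq_1_iff[OF fin] by force
  from e have "v \<in># ends G e" by (simp add: not_in_iff[symmetric] flip: count_greater_zero_iff)
  then obtain a where a: "ends G e = {#v, a#}" "a \<in> verts G"
    using ends_with[OF assms(1) e(1)] by blast
  have "a \<noteq> v" using a e(2) by auto
  moreover have "edges H = edges G - {e}" using H a r by (auto simp: not_in_iff)
  moreover have "\<And>e'. e' \<in> edges G \<Longrightarrow> e' \<noteq> e \<Longrightarrow> v \<notin># ends G e'"
    using r by (auto simp: not_in_iff)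
  ultimately show ?thesis using that v(1) e(1) a H by simp
qed

text \<open>The two given edges already account for degree 2, one unit each. Hence neither is a loop
  and no further edge touches \<open>v\<close>; the two neighbours may coincide.\<close>

lemma smoothE:
  assumes "finite_mgraph G" "smooth G H"
  obtains v e1 e2 a b where "v \<in> verts G" "e1 \<in> edges G" "e2 \<in> edges G" "e1 \<noteq> e2"
    "ends G e1 = {#v, a#}" "ends G e2 = {#v, b#}" "a \<noteq> v" "b \<noteq> v" "a \<in> verts G" "b \<in> verts G"
    "verts H = verts G - {v}" "edges H = edges G - {e2}" "ends H = (ends G)(e1 := {#a, b#})"
    "\<And>e'. e' \<in> edges G \<Longrightarrow> e' \<noteq> e1 \<Longrightarrow> e' \<noteq> e2 \<Longrightarrow> v \<notin># ends G e'"
proof -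
  from assms(2) obtain v e1 e2 a b where *: "v \<in> verts G" "e1 \<in> edges G" "e2 \<in> edges G" "e1 \<noteq> e2"
    "ends G e1 = {#v, a#}" "ends G e2 = {#v, b#}" and deg: "mg_degree G v = 2"
    and H: "H = G\<lparr>verts := verts G - {v}, edges := edges G - {e2}, ends := (ends G)(e1 := {#a, b#})\<rparr>"
    unfolding smooth_def by (elim bexE exE conjE) (rule that; assumption)
  have fin: "finite (edges G)" using assms(1) unfolding finite_mgraph_def by auto
  define R where "R = edges G - {e1, e2}"
  have "edges G = insert e1 (insert e2 R)" "e1 \<notin> insert e2 R" "e2 \<notin> R" "finite R"
    using * fin unfolding R_def by auto
  then have "mg_degree G v = count (ends G e1) v + (count (ends G e2) v + (\<Sum>e\<in>R. count (ends G e) v))"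
    unfolding mg_degree_def by simp
  with deg * have s: "a \<noteq> v" "b \<noteq> v" "(\<Sum>e\<in>R. count (ends G e) v) = 0"
    by (auto split: if_splits)
  have "v \<notin># ends G e'" if "e' \<in> edges G" "e' \<noteq> e1" "e' \<noteq> e2" for e'
  proof -
    have "e' \<in> R" using that R_def by auto
    with s(3) \<open>finite R\<close> have "count (ends G e') v = 0"
      by (subst (asm) sum_eq_0_iff) blast+
    then show ?thesis by (simp add: not_in_iff)
  qed
  moreover have "a \<in> verts G" "b \<in> verts G" using assms(1) * unfolding finite_mgraph_def by force+
  ultimately show ?thesis using that * s H by simp
qed

lemma finite_mgraph_prune:
  assumes "finite_mgraph G" "prune G H" shows "finite_mgraph H"
  using assms
proof (rule pruneE)
  fix v e a
  assume *: "verts H = verts G - {v}" "edges H = edges G - {e}" "ends H = ends G"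
    "\<And>e'. e' \<in> edges G \<Longrightarrow> e' \<noteq> e \<Longrightarrow> v \<notin># ends G e'"
  show "finite_mgraph H" using assms(1) *(4) unfolding finite_mgraph_def *(1-3) by blast
qed

lemma finite_mgraph_smooth:
  assumes "finite_mgraph G" "smooth G H" shows "finite_mgraph H"
  using assms
proof (rule smoothE)
  fix v e1 e2 a b
  assume *: "a \<noteq> v" "b \<noteq> v" "a \<in> verts G" "b \<in> verts G"
    "verts H = verts G - {v}" "edges H = edges G - {e2}" "ends H = (ends G)(e1 := {#a, b#})"
    "\<And>e'. e' \<in> edges G \<Longrightarrow> e' \<noteq> e1 \<Longrightarrow> e' \<noteq> e2 \<Longrightarrow> v \<notin># ends G e'"
  have "size (ends H e) = 2 \<and> set_mset (ends H e) \<subseteq> verts H" if "e \<in> edges H" for e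
  proof (cases "e = e1")
    case True then show ?thesis using * by simp
  next
    case False
    then have "ends H e = ends G e" "e \<in> edges G" "v \<notin># ends G e" using * that by auto
    then show ?thesis using assms(1) *(5) unfolding finite_mgraph_def by auto
  qed
  then show "finite_mgraph H" using assms(1) *(5,6) unfolding finite_mgraph_def by auto
qed

lemma genus_remove:
  assumes "finite_mgraph G" "v \<in> verts G" "e \<in> edges G"
    "verts H = verts G - {v}" "edges H = edges G - {e}"
  shows "genus H = genus G"
proof -
  have "card (verts G) > 0" "card (edges G) > 0"
    using assms(1,2,3) unfolding finite_mgraph_def by (auto simp: card_gt_0_iff)
  then show ?thesis using assms by (simp add: genus_def of_nat_diff)
qed

lemma genus_prune:
  assumes "finite_mgraph G" "prune G H" shows "genus H = genus G"
  using assms by (rule pruneE) (rule genus_remove[OF assms(1)])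

lemma genus_smooth:
  assumes "finite_mgraph G" "smooth G H" shows "genus H = genus G"
  using assms
proof (rule smoothE)
  fix v e2 assume "v \<in> verts G" "e2 \<in> edges G" "verts H = verts G - {v}" "edges H = edges G - {e2}"
  then show "genus H = genus G" by (rule genus_remove[OF assms(1)])
qed

lemma rtrancl_map:
  assumes "\<And>x y. (x, y) \<in> R \<Longrightarrow> (f x, f y) \<in> R'\<^sup>*" "(x, y) \<in> R\<^sup>*"
  shows "(f x, f y) \<in> R'\<^sup>*"
  using assms(2) by induction (auto dest: assms(1))

text \<open>Collapsing \<open>v\<close> onto \<open>a\<close> is the identity on the remaining
  vertices. If it turns edges into paths of \<open>H\<close>, it turns paths of \<open>G\<close>
  into paths of \<open>H\<close> with the same surviving end points.\<close>

lemma mg_connected_retract: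
  assumes "mg_connected G" "a \<in> verts H" "verts H = verts G - {v}"
    "\<And>x y. (x, y) \<in> adj G \<Longrightarrow> ((if x = v then a else x), (if y = v then a else y)) \<in> (adj H)\<^sup>*"
  shows "mg_connected H"
  unfolding mg_connected_adj
proof (intro conjI ballI)
  show "verts H \<noteq> {}" using assms(2) by auto
  fix x y assume "x \<in> verts H" "y \<in> verts H"
  then have xy: "(x, y) \<in> (adj G)\<^sup>*" "x \<noteq> v" "y \<noteq> v"
    using assms(1,3) unfolding mg_connected_adj by auto
  show "(x, y) \<in> (adj H)\<^sup>*"
    using rtrancl_map[where f = "\<lambda>x. if x = v then a else x", OF assms(4) xy(1)] xy(2,3) by simp
qed

lemma pair_mset_eq: "{#a, b#} = {#c, d#} \<longleftrightarrow> a = c \<and> b = d \<or> a = d \<and> b = c"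
  by (auto simp: add_eq_conv_ex)

lemma mg_connected_prune: "finite_mgraph G \<Longrightarrow> prune G H \<Longrightarrow> mg_connected G \<Longrightarrow> mg_connected H"
proof (erule (1) pruneE)
  fix v e a
  assume conn: "mg_connected G" and *: "v \<in> verts G" "e \<in> edges G" "ends G e = {#v, a#}" "a \<noteq> v" "a \<in> verts G"
    "verts H = verts G - {v}" "edges H = edges G - {e}" "ends H = ends G"
    "\<And>e'. e' \<in> edges G \<Longrightarrow> e' \<noteq> e \<Longrightarrow> v \<notin># ends G e'"
  show "mg_connected H"
  proof (rule mg_connected_retract[OF conn, of a])
    fix x y assume "(x, y) \<in> adj G"
    then obtain e' where e': "e' \<in> edges G" "ends G e' = {#x, y#}" unfolding adj_def by auto
    show "(if x = v then a else x, if y = v then a else y) \<in> (adj H)\<^sup>*"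
    proof (cases "e' = e")
      case True
      then show ?thesis using e' * by (auto simp: pair_mset_eq)
    next
      case False
      have "v \<notin># {#x, y#}" using *(9)[OF e'(1) False] unfolding e'(2) .
      then have "x \<noteq> v" "y \<noteq> v" by auto
      moreover have "(x, y) \<in> adj H" using False e' * unfolding adj_def by auto
      ultimately show ?thesis by auto
    qed
  qed (use *(4,5,6) in simp_all)
qed

lemma mg_connected_smooth: "finite_mgraph G \<Longrightarrow> smooth G H \<Longrightarrow> mg_connected G \<Longrightarrow> mg_connected H"
proof (erule (1) smoothE)
  fix v e1 e2 a b
  assume conn: "mg_connected G" and *: "v \<in> verts G" "e1 \<in> edges G" "e2 \<in> edges G" "e1 \<noteq> e2"
    "ends G e1 = {#v, a#}" "ends G e2 = {#v, b#}" "a \<noteq> v" "b \<noteq> v" "a \<in> verts G" "b \<in> verts G"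
    "verts H = verts G - {v}" "edges H = edges G - {e2}" "ends H = (ends G)(e1 := {#a, b#})"
    "\<And>e'. e' \<in> edges G \<Longrightarrow> e' \<noteq> e1 \<Longrightarrow> e' \<noteq> e2 \<Longrightarrow> v \<notin># ends G e'"
  \<comment> \<open>Under the collapse of \<open>v\<close> onto \<open>a\<close>, the edge
    \<open>e1\<close> becomes trivial and \<open>e2\<close> becomes the pair \<open>a\<close>,
    \<open>b\<close>, which the merged edge joins.\<close>
  have ab: "(a, b) \<in> adj H" unfolding adj_def using * by auto
  show "mg_connected H"
  proof (rule mg_connected_retract[OF conn, of a])
    fix x y assume "(x, y) \<in> adj G"
    then obtain e' where e': "e' \<in> edges G" "ends G e' = {#x, y#}" unfolding adj_def by auto
    consider "e' = e1" | "e' = e2" | "e' \<noteq> e1" "e' \<noteq> e2" by auto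
    then show "(if x = v then a else x, if y = v then a else y) \<in> (adj H)\<^sup>*"
    proof cases
      case 1
      then show ?thesis using e' * by (auto simp: pair_mset_eq)
    next
      case 2
      then show ?thesis using e' * ab adj_sym[OF ab] by (auto simp: pair_mset_eq)
    next
      case 3
      have "v \<notin># {#x, y#}" using *(14)[OF e'(1) 3] unfolding e'(2) .
      then have "x \<noteq> v" "y \<noteq> v" by auto
      moreover have "(x, y) \<in> adj H" using 3 e' * unfolding adj_def by auto
      ultimately show ?thesis by auto
    qed
  qed (use *(7,9,11) in simp_all)
qed

lemma mg_degree_prune:
  assumes "finite_mgraph G" "prune G H" shows "mg_degree H x \<le> mg_degree G x"
  using assms
proof (rule pruneE)
  fix e assume *: "edges H = edges G - {e}" "ends H = ends G"
  have "finite (edges G)" using assms(1) unfolding finite_mgraph_def by blast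
  then show "mg_degree H x \<le> mg_degree G x"
    unfolding mg_degree_def * by (rule sum_mono2) auto
qed

lemma mg_degree_smooth:
  assumes "finite_mgraph G" "smooth G H" "x \<in> verts H"
  shows "mg_degree H x = mg_degree G x"
  using assms(1,2)
proof (rule smoothE)
  fix v e1 e2 a b
  assume *: "v \<in> verts G" "e1 \<in> edges G" "e2 \<in> edges G" "e1 \<noteq> e2"
    "ends G e1 = {#v, a#}" "ends G e2 = {#v, b#}" "a \<noteq> v" "b \<noteq> v" "a \<in> verts G" "b \<in> verts G"
    "verts H = verts G - {v}" "edges H = edges G - {e2}" "ends H = (ends G)(e1 := {#a, b#})"
    "\<And>e'. e' \<in> edges G \<Longrightarrow> e' \<noteq> e1 \<Longrightarrow> e' \<noteq> e2 \<Longrightarrow> v \<notin># ends G e'"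
  define R where "R = edges G - {e1, e2}"
  have fin: "finite R" using assms(1) unfolding finite_mgraph_def R_def by auto
  have xv: "x \<noteq> v" using assms(3) * by auto
  have "edges G = insert e1 (insert e2 R)" "e1 \<notin> insert e2 R" "e2 \<notin> R" using * R_def by auto
  then have G: "mg_degree G x = count (ends G e1) x + (count (ends G e2) x + (\<Sum>e\<in>R. count (ends G e) x))"
    unfolding mg_degree_def using fin by simp
  have "edges H = insert e1 R" "e1 \<notin> R" using * R_def by auto
  then have H: "mg_degree H x = count (ends H e1) x + (\<Sum>e\<in>R. count (ends H e) x)"
    unfolding mg_degree_def using fin by simp
  have "(\<Sum>e\<in>R. count (ends H e) x) = (\<Sum>e\<in>R. count (ends G e) x)"
    by (rule sum.cong) (auto simp: * R_def)
  with G H show ?thesis using xv * by auto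
qed

section \<open>Pendant pieces under pruning and smoothing\<close>

lemma exit_edges_pair:
  "e \<in> edges G \<Longrightarrow> ends G e = {#x, y#} \<Longrightarrow> e \<in> exit_edges G W \<longleftrightarrow> (x \<in> W) \<noteq> (y \<in> W)"
  unfolding exit_edges_def by auto

lemma inner_edges_pair:
  "e \<in> edges G \<Longrightarrow> ends G e = {#x, y#} \<Longrightarrow> e \<in> inner_edges G W \<longleftrightarrow> x \<in> W \<and> y \<in> W"
  unfolding inner_edges_def by auto

text \<open>An edge that avoids \<open>v\<close> cannot tell whether \<open>v\<close> belongs to the
  piece. This handles all edges untouched by a reduction at \<open>v\<close> at once, so that only
  the one or two edges at \<open>v\<close> need attention.\<close>

lemma exit_edges_avoid:
  assumes "v \<notin># ends G e" "ends H e = ends G e" "e \<in> edges H \<longleftrightarrow> e \<in> edges G" "W - {v} = W' - {v}"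
  shows "e \<in> exit_edges G W \<longleftrightarrow> e \<in> exit_edges H W'"
proof -
  have "x \<in> W \<longleftrightarrow> x \<in> W'" if "x \<in># ends G e" for x
    using that assms(1,4) by (metis Diff_iff singletonD)
  then have "(\<exists>x\<in>W. x \<in># ends G e) \<longleftrightarrow> (\<exists>x\<in>W'. x \<in># ends G e)"
    "(\<exists>y. y \<notin> W \<and> y \<in># ends G e) \<longleftrightarrow> (\<exists>y. y \<notin> W' \<and> y \<in># ends G e)" by metis+
  then show ?thesis unfolding exit_edges_def mem_Collect_eq assms(2,3) by simp
qed

lemma inner_edges_avoid:
  assumes "v \<notin># ends G e" "ends H e = ends G e" "e \<in> edges H \<longleftrightarrow> e \<in> edges G" "W - {v} = W' - {v}"
  shows "e \<in> inner_edges G W \<longleftrightarrow> e \<in> inner_edges H W'"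
proof -
  have "x \<in> W \<longleftrightarrow> x \<in> W'" if "x \<in># ends G e" for x
    using that assms(1,4) by (metis Diff_iff singletonD)
  then have "set_mset (ends G e) \<subseteq> W \<longleftrightarrow> set_mset (ends G e) \<subseteq> W'" by (metis subset_iff)
  then show ?thesis unfolding inner_edges_def mem_Collect_eq assms(2,3) by simp
qed

lemma not_exit_edges: "e \<notin> edges G \<Longrightarrow> e \<notin> exit_edges G W" and not_inner_edges: "e \<notin> edges G \<Longrightarrow> e \<notin> inner_edges G W"
  unfolding exit_edges_def inner_edges_def by auto

text \<open>The restored leaf joins the piece of its neighbour, if there is one. Its edge then has
  both ends inside or both outside, so no exit is created.\<close>

lemma one_exit_family_prune_lift:
  assumes "finite_mgraph G" "prune G H" "one_exit_family H m W"
  shows "\<exists>W'. one_exit_family G m W'"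
  using assms(1,2)
proof (rule pruneE)
  fix v e a
  assume *: "v \<in> verts G" "e \<in> edges G" "ends G e = {#v, a#}" "a \<noteq> v" "a \<in> verts G"
    "verts H = verts G - {v}" "edges H = edges G - {e}" "ends H = ends G"
    "\<And>e'. e' \<in> edges G \<Longrightarrow> e' \<noteq> e \<Longrightarrow> v \<notin># ends G e'"
  define W' where "W' i = (if a \<in> W i then insert v (W i) else W i)" for i
  have sub: "W i \<subseteq> verts G - {v}" if "i < m" for i
    using assms(3) that unfolding one_exit_family_def *(6) by blast
  have ex: "exit_edges G (W' i) = exit_edges H (W i)" if "i < m" for i
  proof (rule set_eqI)
    fix e'
    show "e' \<in> exit_edges G (W' i) \<longleftrightarrow> e' \<in> exit_edges H (W i)"
    proof (cases "e' \<in> edges G \<and> e' \<noteq> e")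
      case True
      then have "v \<notin># ends G e'" using *(9) by blast
      then show ?thesis using True by (intro exit_edges_avoid) (auto simp: *(7,8) W'_def)
    next
      case False
      have "e \<notin> exit_edges G (W' i)"
        unfolding exit_edges_pair[OF *(2,3)] using sub[OF that] *(4) by (auto simp: W'_def)
      then show ?thesis using False not_exit_edges[of e' G] not_exit_edges[of e' H] *(7) by auto
    qed
  qed
  have "W' i \<noteq> {} \<and> W' i \<subseteq> verts G \<and> card (exit_edges G (W' i)) \<le> 1" if "i < m" for i
    using sub[OF that] *(1) ex[OF that] assms(3) that unfolding one_exit_family_def W'_def by auto
  moreover have "W' i \<inter> W' j = {}" if "i < m" "j < m" "i \<noteq> j" for i j
  proof -
    have "W i \<inter> W j = {}" using assms(3) that unfolding one_exit_family_def by auto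
    then show ?thesis using sub[OF that(1)] sub[OF that(2)] unfolding W'_def by auto
  qed
  ultimately have "one_exit_family G m W'"
    unfolding one_exit_family_def by blast
  then show ?thesis by auto
qed

text \<open>The restored vertex joins a piece only if both its neighbours are in it. If just one
  neighbour is in the piece, the merged edge was an exit, and exactly one of its two halves is an
  exit now.\<close>

lemma one_exit_family_smooth_lift:
  assumes "finite_mgraph G" "smooth G H" "one_exit_family H m W"
  shows "\<exists>W'. one_exit_family G m W'"
  using assms(1,2)
proof (rule smoothE)
  fix v e1 e2 a b
  assume *: "v \<in> verts G" "e1 \<in> edges G" "e2 \<in> edges G" "e1 \<noteq> e2"
    "ends G e1 = {#v, a#}" "ends G e2 = {#v, b#}" "a \<noteq> v" "b \<noteq> v" "a \<in> verts G" "b \<in> verts G"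
    "verts H = verts G - {v}" "edges H = edges G - {e2}" "ends H = (ends G)(e1 := {#a, b#})"
    "\<And>e'. e' \<in> edges G \<Longrightarrow> e' \<noteq> e1 \<Longrightarrow> e' \<noteq> e2 \<Longrightarrow> v \<notin># ends G e'"
  define W' where "W' i = (if a \<in> W i \<and> b \<in> W i then insert v (W i) else W i)" for i
  have finH: "finite (edges H)" using finite_mgraph_smooth[OF assms(1,2)] unfolding finite_mgraph_def by auto
  have sub: "W i \<subseteq> verts G - {v}" if "i < m" for i
    using assms(3) that unfolding one_exit_family_def *(11) by blast
  have le: "card (exit_edges G (W' i)) \<le> 1" if i: "i < m" for i
  proof -
    have 1: "card (exit_edges H (W i)) \<le> 1" using assms(3) i unfolding one_exit_family_def by auto
    have fin: "finite (exit_edges H (W i))" using finH unfolding exit_edges_def by auto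
    have others: "e' \<in> exit_edges G (W' i) \<longleftrightarrow> e' \<in> exit_edges H (W i)" if "e' \<noteq> e1" "e' \<noteq> e2" for e'
    proof (cases "e' \<in> edges G")
      case True
      have "v \<notin># ends G e'" using *(14) that True by blast
      then show ?thesis by (rule exit_edges_avoid) (auto simp: *(12,13) W'_def that)
    next
      case False
      then show ?thesis using not_exit_edges[of e' G] not_exit_edges[of e' H] *(12) by auto
    qed
    have vW: "v \<notin> W i" using sub[OF i] by auto
    have "e1 \<in> edges H" "ends H e1 = {#a, b#}" using *(2,4,12,13) by auto
    note X = exit_edges_pair[OF this, of "W i"]
      exit_edges_pair[OF *(2,5), of "W' i"] exit_edges_pair[OF *(3,6), of "W' i"]
    consider "a \<in> W i \<and> b \<in> W i \<or> a \<notin> W i \<and> b \<notin> W i" | "a \<in> W i" "b \<notin> W i" | "a \<notin> W i" "b \<in> W i" by auto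
    then show ?thesis
    proof cases
      case 1
      then have "e1 \<notin> exit_edges G (W' i)" "e2 \<notin> exit_edges G (W' i)"
        using *(7,8) vW unfolding X by (auto simp: W'_def)
      then have "exit_edges G (W' i) \<subseteq> exit_edges H (W i)" using others by (metis subsetI)
      then show ?thesis using card_mono[OF fin] \<open>card (exit_edges H (W i)) \<le> 1\<close> order_trans by blast
    next
      case 2
      then have "e1 \<in> exit_edges H (W i)" "e2 \<notin> exit_edges G (W' i)"
        using *(7,8) vW unfolding X by (auto simp: W'_def)
      then have "exit_edges G (W' i) \<subseteq> exit_edges H (W i)" using others by (metis subsetI)
      then show ?thesis using card_mono[OF fin] \<open>card (exit_edges H (W i)) \<le> 1\<close> order_trans by blast
    next
      \<comment> \<open>The merged edge carries the name \<open>e1\<close>, but the half that leaves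
        the piece is \<open>e2\<close>: one exit is exchanged for another.\<close>
      case 3
      then have "e1 \<in> exit_edges H (W i)" "e1 \<notin> exit_edges G (W' i)"
        using *(7,8) vW unfolding X by (auto simp: W'_def)
      then have "exit_edges G (W' i) \<subseteq> insert e2 (exit_edges H (W i) - {e1})" using others by (auto, metis)
      then have "card (exit_edges G (W' i)) \<le> card (insert e2 (exit_edges H (W i) - {e1}))"
        by (intro card_mono) (auto simp: fin)
      also have "\<dots> \<le> Suc (card (exit_edges H (W i) - {e1}))" by (simp add: card_insert_le_m1 fin card_insert_if)
      also have "\<dots> = card (exit_edges H (W i))" using \<open>e1 \<in> exit_edges H (W i)\<close> fin by (metis card.remove)
      finally show ?thesis using \<open>card (exit_edges H (W i)) \<le> 1\<close> by simp
    qed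
  qed
  then have "W' i \<noteq> {} \<and> W' i \<subseteq> verts G \<and> card (exit_edges G (W' i)) \<le> 1" if "i < m" for i
    using sub[OF that] *(1) assms(3) that unfolding one_exit_family_def W'_def by auto
  moreover have "W' i \<inter> W' j = {}" if "i < m" "j < m" "i \<noteq> j" for i j
  proof -
    have "W i \<inter> W j = {}" using assms(3) that unfolding one_exit_family_def by auto
    then show ?thesis using sub[OF that(1)] sub[OF that(2)] unfolding W'_def by auto
  qed
  ultimately have "one_exit_family G m W'"
    unfolding one_exit_family_def by blast
  then show ?thesis by auto
qed

text \<open>A leaf takes at most its own edge along, so the count of inner edges against vertices is
  preserved. It also prevents a piece from vanishing: \<open>{v}\<close> alone has no inner edge,
  because the edge at a leaf is not a loop.\<close>

lemma cyclic_family_prune: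
  assumes "finite_mgraph G" "prune G H" "cyclic_family G m W"
  shows "\<exists>W'. cyclic_family H m W'"
  using assms(1,2)
proof (rule pruneE)
  fix v e a
  assume *: "v \<in> verts G" "e \<in> edges G" "ends G e = {#v, a#}" "a \<noteq> v" "a \<in> verts G"
    "verts H = verts G - {v}" "edges H = edges G - {e}" "ends H = ends G"
    "\<And>e'. e' \<in> edges G \<Longrightarrow> e' \<noteq> e \<Longrightarrow> v \<notin># ends G e'"
  define W' where "W' i = W i - {v}" for i
  have fin: "finite (edges G)" "finite (verts G)" using assms(1) unfolding finite_mgraph_def by auto
  have W: "W i \<noteq> {}" "W i \<subseteq> verts G" "card (exit_edges G (W i)) \<le> 1" "card (W i) \<le> card (inner_edges G (W i))"
    if "i < m" for i
    using assms(3) that unfolding cyclic_family_def one_exit_family_def by auto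
  have ins: "inner_edges H (W' i) = inner_edges G (W i) - {e}" for i
    unfolding inner_edges_def W'_def *(7,8) using *(9) by blast
  have lea: "exit_edges H (W' i) \<subseteq> exit_edges G (W i)" for i
    unfolding exit_edges_def W'_def *(7,8) using *(9) by blast
  have "card (exit_edges H (W' i)) \<le> 1" if "i < m" for i
    using W(3)[OF that] card_mono[OF _ lea[of i]] fin(1) unfolding exit_edges_def by fastforce
  moreover have "W' i \<noteq> {}" if i: "i < m" for i
  proof
    assume "W' i = {}"
    then have "W i = {v}" using W(1)[OF i] unfolding W'_def by auto
    moreover have "inner_edges G {v} = {}"
    proof -
      have False if ed: "e' \<in> edges G" "set_mset (ends G e') \<subseteq> {v}" for e'
      proof (cases "e' = e")
        case True then show ?thesis using ed *(3,4) by simp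
      next
        case False
        obtain x y where xy: "ends G e' = {#x, y#}" using ends_pair[OF assms(1) ed(1)] by blast
        have "x = v" using that(2) xy by auto
        then show ?thesis using *(9)[OF that(1) False] xy by auto
      qed
      then show ?thesis unfolding inner_edges_def by auto
    qed
    ultimately show False using W(4)[OF i] by simp
  qed
  moreover have "card (W' i) \<le> card (inner_edges H (W' i))" if i: "i < m" for i
  proof (cases "v \<in> W i")
    case True
    then have "card (W' i) = card (W i) - 1" unfolding W'_def by simp
    moreover have "card (inner_edges G (W i) - {e}) \<ge> card (inner_edges G (W i)) - 1"
      by (metis card_Diff1_le card_Diff_singleton_if diff_le_self order_refl)
    ultimately show ?thesis using W(4)[OF i] ins by simp
  next
    case False
    then have "e \<notin> inner_edges G (W i)" unfolding inner_edges_pair[OF *(2,3)] by simp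
    moreover have "W' i = W i" using False by (simp add: W'_def)
    ultimately show ?thesis using W(4)[OF i] ins[of i] by simp
  qed
  moreover have "W' i \<inter> W' j = {}" if "i < m" "j < m" "i \<noteq> j" for i j
    using assms(3) that unfolding cyclic_family_def one_exit_family_def W'_def by blast
  moreover have "W' i \<subseteq> verts H" if "i < m" for i using W(2)[OF that] *(6) by (auto simp: W'_def)
  ultimately have "cyclic_family H m W'"
    unfolding cyclic_family_def one_exit_family_def by blast
  then show ?thesis by auto
qed

text \<open>The key fact is \<open>not2\<close>: the two edges at \<open>v\<close> cannot both leave
  the same piece. It excludes the piece \<open>{v}\<close>, and it excludes a piece that contains
  both neighbours but not \<open>v\<close>.\<close>

lemma cyclic_family_smooth:
  assumes "finite_mgraph G" "smooth G H" "cyclic_family G m W"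
  shows "\<exists>W'. cyclic_family H m W'"
  using assms(1,2)
proof (rule smoothE)
  fix v e1 e2 a b
  assume *: "v \<in> verts G" "e1 \<in> edges G" "e2 \<in> edges G" "e1 \<noteq> e2"
    "ends G e1 = {#v, a#}" "ends G e2 = {#v, b#}" "a \<noteq> v" "b \<noteq> v" "a \<in> verts G" "b \<in> verts G"
    "verts H = verts G - {v}" "edges H = edges G - {e2}" "ends H = (ends G)(e1 := {#a, b#})"
    "\<And>e'. e' \<in> edges G \<Longrightarrow> e' \<noteq> e1 \<Longrightarrow> e' \<noteq> e2 \<Longrightarrow> v \<notin># ends G e'"
  define W' where "W' i = W i - {v}" for i
  have fin: "finite (edges G)" "finite (verts G)" using assms(1) unfolding finite_mgraph_def by auto
  have W: "W i \<noteq> {}" "W i \<subseteq> verts G" "card (exit_edges G (W i)) \<le> 1" "card (W i) \<le> card (inner_edges G (W i))"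
    if "i < m" for i
    using assms(3) that unfolding cyclic_family_def one_exit_family_def by auto
  have finl: "finite (exit_edges G X)" "finite (inner_edges G X)" for X
    using fin unfolding exit_edges_def inner_edges_def by auto
  have not2: "\<not> (e1 \<in> exit_edges G (W i) \<and> e2 \<in> exit_edges G (W i))" if "i < m" for i
  proof
    assume "e1 \<in> exit_edges G (W i) \<and> e2 \<in> exit_edges G (W i)"
    then have "{e1, e2} \<subseteq> exit_edges G (W i)" by auto
    from card_mono[OF finl(1) this] W(3)[OF that] *(4) show False by simp
  qed
  have C: "W i \<noteq> {v} \<and> card (exit_edges H (W' i)) \<le> 1 \<and> card (W' i) \<le> card (inner_edges H (W' i))"
    if i: "i < m" for i
  proof -
    have oth: "(e' \<in> exit_edges H (W' i) \<longleftrightarrow> e' \<in> exit_edges G (W i)) \<and> (e' \<in> inner_edges H (W' i) \<longleftrightarrow> e' \<in> inner_edges G (W i))"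
      if "e' \<noteq> e1" "e' \<noteq> e2" for e'
    proof (cases "e' \<in> edges G")
      case True
      have v: "v \<notin># ends G e'" using *(14) that True by blast
      have eq: "ends H e' = ends G e'" "e' \<in> edges H \<longleftrightarrow> e' \<in> edges G" "W i - {v} = W' i - {v}"
        using that by (auto simp: *(12,13) W'_def)
      show ?thesis using exit_edges_avoid[OF v eq] inner_edges_avoid[OF v eq] by simp
    next
      case False
      then have "e' \<notin> edges H" using *(12) by simp
      with False show ?thesis using not_exit_edges not_inner_edges by metis
    qed
    have "e2 \<notin> edges H" using *(12) by simp
    then have e2: "e2 \<notin> exit_edges H (W' i)" "e2 \<notin> inner_edges H (W' i)"
      by (simp_all add: not_exit_edges not_inner_edges)
    have "e1 \<in> edges H" "ends H e1 = {#a, b#}" using *(2,4,12,13) by auto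
    then have e1: "e1 \<in> exit_edges H (W' i) \<longleftrightarrow> (a \<in> W i \<and> b \<notin> W i) \<or> (a \<notin> W i \<and> b \<in> W i)"
      "e1 \<in> inner_edges H (W' i) \<longleftrightarrow> a \<in> W i \<and> b \<in> W i"
      using *(7,8) by (auto simp: W'_def exit_edges_pair inner_edges_pair)
    have G: "e1 \<in> exit_edges G (W i) \<longleftrightarrow> (v \<in> W i) \<noteq> (a \<in> W i)" "e2 \<in> exit_edges G (W i) \<longleftrightarrow> (v \<in> W i) \<noteq> (b \<in> W i)"
      "e1 \<in> inner_edges G (W i) \<longleftrightarrow> v \<in> W i \<and> a \<in> W i" "e2 \<in> inner_edges G (W i) \<longleftrightarrow> v \<in> W i \<and> b \<in> W i"
      by (simp_all only: exit_edges_pair[OF *(2,5)] exit_edges_pair[OF *(3,6)] inner_edges_pair[OF *(2,5)] inner_edges_pair[OF *(3,6)])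
    have 1: "W i \<noteq> {v}" using G not2[OF i] *(7,8) by auto
    have 2: "card (exit_edges H (W' i)) \<le> 1"
    proof -
      \<comment> \<open>The merged edge may inherit its role from \<open>e2\<close> while bearing
        the name \<open>e1\<close>, so the exits of the new piece are compared with the old ones up
        to a renaming.\<close>
      have "\<exists>f. exit_edges H (W' i) \<subseteq> f ` exit_edges G (W i)"
      proof (cases "e1 \<in> exit_edges G (W i)")
        case True
        then have "exit_edges H (W' i) \<subseteq> id ` exit_edges G (W i)" using oth e2 by fastforce
        then show ?thesis by blast
      next
        case False
        then have "exit_edges H (W' i) \<subseteq> (\<lambda>e. if e = e2 then e1 else e) ` exit_edges G (W i)"
          using oth e2 e1 G by (smt (verit, best) image_iff subsetI)
        then show ?thesis by blast
      qed
      then obtain f where f: "exit_edges H (W' i) \<subseteq> f ` exit_edges G (W i)" by blast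
      have "card (exit_edges H (W' i)) \<le> card (f ` exit_edges G (W i))"
        by (rule card_mono[OF finite_imageI[OF finl(1)] f])
      also have "\<dots> \<le> 1" using card_image_le[OF finl(1)] W(3)[OF i] order_trans by blast
      finally show ?thesis .
    qed
    have 3: "card (W' i) \<le> card (inner_edges H (W' i))"
    proof (cases "v \<in> W i")
      case True
      then have c: "card (W' i) = card (W i) - 1" unfolding W'_def by simp
      \<comment> \<open>\<open>x\<close> is the half that is lost: \<open>e2\<close> if both
        neighbours are in the piece, otherwise the half leading to the neighbour inside. If no
        neighbour is inside, removing \<open>x\<close> changes nothing.\<close>
      have "\<exists>x. inner_edges H (W' i) = inner_edges G (W i) - {x}"
      proof (cases "a \<in> W i \<and> b \<in> W i")
        case True
        then have "inner_edges H (W' i) = inner_edges G (W i) - {e2}"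
            using oth e2 e1 G \<open>v \<in> W i\<close> *(4) by (intro set_eqI) (metis Diff_iff singletonD singletonI)
        then show ?thesis by blast
      next
        case False
        show ?thesis
        proof (cases "a \<in> W i")
          case True
          then have "inner_edges H (W' i) = inner_edges G (W i) - {e1}"
            using False oth e2 e1 G \<open>v \<in> W i\<close> *(4) by (intro set_eqI) (metis Diff_iff singletonD singletonI)
          then show ?thesis by blast
        next
          case False
          then have "inner_edges H (W' i) = inner_edges G (W i) - {e2}"
            using oth e2 e1 G \<open>v \<in> W i\<close> *(4) by (intro set_eqI) (metis Diff_iff singletonD singletonI)
          then show ?thesis by blast
        qed
      qed
      then obtain x where "inner_edges H (W' i) = inner_edges G (W i) - {x}" by blast
      moreover have "card (inner_edges G (W i) - {x}) \<ge> card (inner_edges G (W i)) - 1"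
        by (metis card_Diff1_le card_Diff_singleton_if diff_le_self order_refl)
      ultimately show ?thesis using c W(4)[OF i] by simp
    next
      case False
      then have "inner_edges H (W' i) = inner_edges G (W i)" using oth e2 e1 G not2[OF i] by (intro set_eqI) metis
      then show ?thesis using W(4)[OF i] False by (simp add: W'_def)
    qed
    show ?thesis using 1 2 3 by blast
  qed
  have "W' i \<inter> W' j = {}" if "i < m" "j < m" "i \<noteq> j" for i j
    using assms(3) that unfolding cyclic_family_def one_exit_family_def W'_def by blast
  moreover have "card (exit_edges H (W' i)) \<le> 1" "card (W' i) \<le> card (inner_edges H (W' i))" if "i < m" for i
    using C[OF that] by blast+
  moreover have "W' i \<noteq> {}" if "i < m" for i using W(1)[OF that] C[OF that] by (auto simp: W'_def)
  moreover have "W' i \<subseteq> verts H" if "i < m" for i using W(2)[OF that] *(11) by (auto simp: W'_def)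
  ultimately have "cyclic_family H m W'"
    unfolding cyclic_family_def one_exit_family_def by blast
  then show ?thesis by auto
qed

section \<open>Degree counts and exhaustive reduction\<close>

lemma handshake:
  assumes "finite_mgraph G"
  shows "(\<Sum>v\<in>verts G. mg_degree G v) = 2 * card (edges G)"
proof -
  have "(\<Sum>v\<in>verts G. mg_degree G v) = (\<Sum>e\<in>edges G. \<Sum>v\<in>verts G. count (ends G e) v)"
    unfolding mg_degree_def by (rule sum.swap)
  also have "\<dots> = (\<Sum>e\<in>edges G. 2)"
  proof (rule sum.cong)
    fix e assume "e \<in> edges G"
    then have "size (ends G e) = 2" "set_mset (ends G e) \<subseteq> verts G" "finite (verts G)"
      using assms unfolding finite_mgraph_def by auto
    then show "(\<Sum>v\<in>verts G. count (ends G e) v) = 2"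
      unfolding size_multiset_overloaded_eq
      by (metis sum.mono_neutral_left not_in_iff DiffE)
  qed simp
  finally show ?thesis by simp
qed

lemma genus_trivalent:
  assumes "finite_mgraph G" "trivalent G"
  shows "2 * genus G = int (card (verts G)) + 2"
  using handshake[OF assms(1)] assms(2) unfolding trivalent_def genus_def by simp

lemma card_one_exit_family:
  assumes "finite_mgraph G" "one_exit_family G m W"
  shows "m \<le> card (verts G)"
proof -
  have "\<forall>i<m. \<exists>x. x \<in> W i" using assms(2) unfolding one_exit_family_def by blast
  then obtain x where x: "\<And>i. i < m \<Longrightarrow> x i \<in> W i" by metis
  have W: "W i \<subseteq> verts G" "j < m \<Longrightarrow> i \<noteq> j \<Longrightarrow> W i \<inter> W j = {}" if "i < m" for i j
    using assms(2) that unfolding one_exit_family_def by simp_all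
  have "inj_on x {..<m}"
  proof (rule inj_onI)
    fix i j assume ij: "i \<in> {..<m}" "j \<in> {..<m}" "x i = x j"
    then have "x i \<in> W i \<inter> W j" using x[of i] x[of j] by simp
    then show "i = j" using W(2)[of i j] ij(1,2) by fastforce
  qed
  moreover have "x ` {..<m} \<subseteq> verts G" using x W(1) by blast
  ultimately show ?thesis using assms(1) card_inj_on_le[of x "{..<m}" "verts G"]
    unfolding finite_mgraph_def by simp
qed

text \<open>A pendant cycle cannot be pruned away, and with two disjoint ones the graph cannot shrink to
  a circle, on which smoothing would get stuck.\<close>

definition reducible :: "nat \<Rightarrow> ('v, 'e) mgraph \<Rightarrow> bool" where
  "reducible m G \<longleftrightarrow> finite_mgraph G \<and> mg_connected G \<and> (\<forall>v\<in>verts G. mg_degree G v \<le> 3) \<and>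
     (\<exists>W. cyclic_family G m W)"

lemma reducible_prune:
  assumes "reducible m G" "prune G H"
  shows "reducible m H"
proof -
  have G: "finite_mgraph G" "mg_connected G" "\<And>v. v \<in> verts G \<Longrightarrow> mg_degree G v \<le> 3" "\<exists>W. cyclic_family G m W"
    using assms(1) unfolding reducible_def by blast+
  have "verts H \<subseteq> verts G" using G(1) assms(2) by (rule pruneE) blast
  then have "mg_degree H v \<le> 3" if "v \<in> verts H" for v
    using G(3)[of v] mg_degree_prune[OF G(1) assms(2), of v] that by fastforce
  then show ?thesis
    using finite_mgraph_prune[OF G(1) assms(2)] mg_connected_prune[OF G(1) assms(2) G(2)]
      cyclic_family_prune[OF G(1) assms(2)] G(4) unfolding reducible_def by blast
qed

lemma reducible_smooth:
  assumes "reducible m G" "smooth G H"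
  shows "reducible m H"
proof -
  have G: "finite_mgraph G" "mg_connected G" "\<And>v. v \<in> verts G \<Longrightarrow> mg_degree G v \<le> 3" "\<exists>W. cyclic_family G m W"
    using assms(1) unfolding reducible_def by blast+
  have "verts H \<subseteq> verts G" using G(1) assms(2) by (rule smoothE) blast
  then have "mg_degree H v \<le> 3" if "v \<in> verts H" for v
    using G(3)[of v] mg_degree_smooth[OF G(1) assms(2) that] that by fastforce
  then show ?thesis
    using finite_mgraph_smooth[OF G(1) assms(2)] mg_connected_smooth[OF G(1) assms(2) G(2)]
      cyclic_family_smooth[OF G(1) assms(2)] G(4) unfolding reducible_def by blast
qed

lemma card_verts_less:
  assumes "finite_mgraph G" "v \<in> verts G" "verts H = verts G - {v}"
  shows "card (verts H) < card (verts G)"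
  using assms card_Diff1_less[of "verts G" v] unfolding finite_mgraph_def by simp

text \<open>Two disjoint nonempty pieces supply a second vertex, so connectedness gives
  \<open>v\<close> an edge that is not a loop. At degree 2 the remaining unit then belongs to a
  different edge, which is the configuration that can be smoothed.\<close>

lemma reducible_degree:
  assumes "reducible m G" "2 \<le> m" "v \<in> verts G"
  shows "mg_degree G v \<noteq> 0" "mg_degree G v = 2 \<Longrightarrow> \<exists>H. smooth G H"
proof -
  have fin: "finite_mgraph G" "finite (edges G)" and conn: "mg_connected G"
    using assms(1) unfolding reducible_def finite_mgraph_def by auto
  obtain W where W: "one_exit_family G m W" using assms(1) unfolding reducible_def cyclic_family_def by auto
  have "2 \<le> card (verts G)" using card_one_exit_family[OF fin(1) W] assms(2) by simp
  then have "verts G \<noteq> {v}" by auto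
  then obtain u where "u \<in> verts G" "u \<noteq> v" using assms(3) by blast
  then have "(v, u) \<in> (adj G)\<^sup>*" using conn assms(3) unfolding mg_connected_adj by blast
  then have "v = u \<or> (\<exists>w. (v, w) \<in> adj G \<and> w \<noteq> v)"
    by (induction rule: converse_rtrancl_induct) auto
  then obtain w where "(v, w) \<in> adj G" "w \<noteq> v" using \<open>u \<noteq> v\<close> by blast
  then obtain e where e: "e \<in> edges G" "ends G e = {#v, w#}" unfolding adj_def by auto
  have ce: "count (ends G e) v = 1" using e \<open>w \<noteq> v\<close> by simp
  have d: "mg_degree G v = 1 + (\<Sum>e'\<in>edges G - {e}. count (ends G e') v)"
    unfolding mg_degree_def using e ce fin(2) by (simp add: sum.remove)
  then show "mg_degree G v \<noteq> 0" by simp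
  assume "mg_degree G v = 2"
  with d have "(\<Sum>e'\<in>edges G - {e}. count (ends G e') v) = 1" by simp
  then obtain e' where e': "e' \<in> edges G" "e' \<noteq> e" "count (ends G e') v = 1"
    using sum_eq_1_iff[of "edges G - {e}"] fin(2) by auto
  then have "v \<in># ends G e'" by (metis count_eq_zero_iff zero_neq_one)
  then obtain b where "ends G e' = {#v, b#}" using ends_with[OF fin(1) e'(1)] by metis
  then show "\<exists>H. smooth G H"
    unfolding smooth_def using e e' assms(3) \<open>mg_degree G v = 2\<close> by metis
qed

lemma prune_exhaust:
  assumes "reducible m G"
  shows "\<exists>H. prune\<^sup>*\<^sup>* G H \<and> reducible m H \<and> genus H = genus G \<and> (\<forall>v\<in>verts H. mg_degree H v \<noteq> 1)"
  using assms
proof (induction "card (verts G)" arbitrary: G rule: less_induct)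
  case less
  show ?case
  proof (cases "\<forall>v\<in>verts G. mg_degree G v \<noteq> 1")
    case True
    then show ?thesis using less.prems by blast
  next
    case False
    have fin: "finite_mgraph G" using less.prems unfolding reducible_def by blast
    from False obtain H where H: "prune G H" unfolding prune_def by blast
    have "card (verts H) < card (verts G)" using fin H by (rule pruneE) (rule card_verts_less[OF fin])
    from less.hyps[OF this reducible_prune[OF less.prems H]]
    obtain K where "prune\<^sup>*\<^sup>* H K" "reducible m K" "genus K = genus H" "\<forall>v\<in>verts K. mg_degree K v \<noteq> 1" by blast
    then show ?thesis using H genus_prune[OF fin H] converse_rtranclp_into_rtranclp[of prune] by metis
  qed
qed

text \<open>Smoothing does not change the degree of any surviving vertex, so no leaf reappears. Once
  degree 2 is gone as well, a degree at most 3 that is neither 0, 1 nor 2 must be 3.\<close>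

lemma smooth_exhaust:
  assumes "reducible m G" "\<forall>v\<in>verts G. mg_degree G v \<noteq> 1" "2 \<le> m"
  shows "\<exists>H. smooth\<^sup>*\<^sup>* G H \<and> reducible m H \<and> genus H = genus G \<and> trivalent H"
  using assms
proof (induction "card (verts G)" arbitrary: G rule: less_induct)
  case less
  have fin: "finite_mgraph G" using less.prems unfolding reducible_def by blast
  show ?case
  proof (cases "\<forall>v\<in>verts G. mg_degree G v \<noteq> 2")
    case True
    have "mg_degree G v = 3" if v: "v \<in> verts G" for v
    proof -
      have "mg_degree G v \<le> 3" using less.prems(1) v unfolding reducible_def by blast
      moreover have "mg_degree G v \<noteq> 0" using reducible_degree(1)[OF less.prems(1,3) v] .
      moreover have "mg_degree G v \<noteq> 1" "mg_degree G v \<noteq> 2" using True less.prems(2) v by blast+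
      ultimately show ?thesis by linarith
    qed
    then show ?thesis using less.prems(1) unfolding trivalent_def by blast
  next
    case False
    then obtain H where H: "smooth G H" using reducible_degree(2)[OF less.prems(1,3)] by blast
    obtain v where v: "v \<in> verts G" "verts H = verts G - {v}" using fin H by (rule smoothE)
    have "\<forall>v\<in>verts H. mg_degree H v \<noteq> 1"
      using less.prems(2) mg_degree_smooth[OF fin H] v(2) by (metis DiffD1)
    from less.hyps[OF card_verts_less[OF fin v] reducible_smooth[OF less.prems(1) H] this less.prems(3)]
    obtain K where "smooth\<^sup>*\<^sup>* H K" "reducible m K" "genus K = genus H" "trivalent K" by blast
    then show ?thesis using H genus_smooth[OF fin H] converse_rtranclp_into_rtranclp[of smooth] by metis
  qed
qed

lemma reducible_reduces:
  assumes "reducible m G" "2 \<le> m"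
  shows "\<exists>S. reduces_to G S \<and> reducible m S \<and> genus S = genus G \<and> trivalent S"
proof -
  obtain H where H: "prune\<^sup>*\<^sup>* G H" "reducible m H" "genus H = genus G" "\<forall>v\<in>verts H. mg_degree H v \<noteq> 1"
    using prune_exhaust[OF assms(1)] by blast
  obtain S where S: "smooth\<^sup>*\<^sup>* H S" "reducible m S" "genus S = genus H" "trivalent S"
    using smooth_exhaust[OF H(2,4) assms(2)] by blast
  have "reduces_to G S" unfolding reduces_to_def using H S by (force simp: trivalent_def)
  then show ?thesis using H S by auto
qed

text \<open>This serves for a curve about which nothing is known except that some chain of
  reductions leads to the given skeleton, so it is stated for every chain.\<close>

lemma reduces_to_lift:
  assumes "finite_mgraph G" "reduces_to G S"
  shows "finite_mgraph S" "genus S = genus G"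
    "one_exit_family S m W \<Longrightarrow> \<exists>W'. one_exit_family G m W'"
proof -
  obtain H where H: "prune\<^sup>*\<^sup>* G H" "smooth\<^sup>*\<^sup>* H S" using assms(2) unfolding reduces_to_def by blast
  have 1: "finite_mgraph H \<and> genus H = genus G \<and> ((\<exists>W. one_exit_family H m W) \<longrightarrow> (\<exists>W. one_exit_family G m W))"
    using H(1)
  proof (induction rule: rtranclp_induct)
    case base then show ?case using assms(1) by blast
  next
    case (step y z)
    then show ?case using finite_mgraph_prune genus_prune one_exit_family_prune_lift by metis
  qed
  have "finite_mgraph S \<and> genus S = genus H \<and> ((\<exists>W. one_exit_family S m W) \<longrightarrow> (\<exists>W. one_exit_family H m W))"
    using H(2)
  proof (induction rule: rtranclp_induct)
    case base then show ?case using 1 by blast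
  next
    case (step y z)
    then show ?case using finite_mgraph_smooth genus_smooth one_exit_family_smooth_lift by metis
  qed
  with 1 show "finite_mgraph S" "genus S = genus G"
    "one_exit_family S m W \<Longrightarrow> \<exists>W'. one_exit_family G m W'" by auto
qed

section \<open>Transport along isomorphisms\<close>

lemma mg_iso_sym:
  assumes "finite_mgraph G" "mg_iso G H"
  shows "mg_iso H G"
proof -
  obtain \<phi> \<psi> where iso: "bij_betw \<phi> (verts G) (verts H)" "bij_betw \<psi> (edges G) (edges H)"
    "\<And>e. e \<in> edges G \<Longrightarrow> ends H (\<psi> e) = image_mset \<phi> (ends G e)"
    using assms(2) unfolding mg_iso_def by blast
  let ?p = "inv_into (verts G) \<phi>" and ?q = "inv_into (edges G) \<psi>"
  have "ends G (?q d) = image_mset ?p (ends H d)" if d: "d \<in> edges H" for d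
  proof -
    define e where "e = ?q d"
    have e: "e \<in> edges G" "\<psi> e = d" using iso(2) d unfolding e_def
      by (metis bij_betw_imp_surj_on inv_into_into, metis bij_betw_inv_into_right)
    have sub: "set_mset (ends G e) \<subseteq> verts G" using assms(1) e(1) unfolding finite_mgraph_def by blast
    have "image_mset ?p (ends H d) = image_mset (?p \<circ> \<phi>) (ends G e)" using iso(3)[OF e(1)] e(2) by (simp add: multiset.map_comp)
    also have "\<dots> = image_mset id (ends G e)"
      by (rule image_mset_cong) (use sub iso(1) in \<open>auto simp: bij_betw_def\<close>)
    finally show ?thesis by (simp add: e_def)
  qed
  then show ?thesis unfolding mg_iso_def using bij_betw_inv_into[OF iso(1)] bij_betw_inv_into[OF iso(2)] by blast
qed

lemma mg_iso_transport:
  assumes "finite_mgraph G" "mg_iso G H"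
  shows "finite_mgraph H" "genus H = genus G" "trivalent G \<Longrightarrow> trivalent H"
    "mg_connected G \<Longrightarrow> mg_connected H"
    "one_exit_family G m W \<Longrightarrow> \<exists>W'. one_exit_family H m W'"
proof -
  obtain \<phi> \<psi> where iso: "bij_betw \<phi> (verts G) (verts H)" "bij_betw \<psi> (edges G) (edges H)"
    "\<And>e. e \<in> edges G \<Longrightarrow> ends H (\<psi> e) = image_mset \<phi> (ends G e)"
    using assms(2) unfolding mg_iso_def by blast
  have im: "verts H = \<phi> ` verts G" "edges H = \<psi> ` edges G" "inj_on \<phi> (verts G)" "inj_on \<psi> (edges G)"
    using iso(1,2) unfolding bij_betw_def by auto
  have G: "finite (verts G)" "finite (edges G)"
    "\<And>e. e \<in> edges G \<Longrightarrow> size (ends G e) = 2" "\<And>e. e \<in> edges G \<Longrightarrow> set_mset (ends G e) \<subseteq> verts G"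
    using assms(1) unfolding finite_mgraph_def by blast+
  show "finite_mgraph H" unfolding finite_mgraph_def im(1,2)
    using G iso(3) by (auto simp: subset_iff)
  show "genus H = genus G" unfolding genus_def im(1,2) using im(3,4) by (simp add: card_image)
  have deg: "mg_degree H (\<phi> v) = mg_degree G v" if v: "v \<in> verts G" for v
  proof -
    have "count (image_mset \<phi> (ends G e)) (\<phi> v) = count (ends G e) v" if e: "e \<in> edges G" for e
    proof -
      have "count (image_mset \<phi> M) (\<phi> v) = count M v" if "set_mset M \<subseteq> verts G" for M
        using that by (induction M) (use im(3) v in \<open>auto simp: inj_on_def\<close>)
      then show ?thesis using G(4)[OF e] .
    qed
    then show ?thesis unfolding mg_degree_def im(2) using im(4) iso(3) by (simp add: sum.reindex)
  qed
  then show "trivalent G \<Longrightarrow> trivalent H" unfolding trivalent_def im(1) by simp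
  show "mg_connected H" if conn: "mg_connected G"
  proof -
    have "(\<phi> x, \<phi> y) \<in> (adj H)\<^sup>*" if xy: "(x, y) \<in> (adj G)\<^sup>*" for x y
    proof (rule rtrancl_map[OF _ xy])
      fix a b assume "(a, b) \<in> adj G"
      then obtain e where "e \<in> edges G" "ends G e = {#a, b#}" unfolding adj_def by blast
      then have "\<psi> e \<in> edges H" "ends H (\<psi> e) = {#\<phi> a, \<phi> b#}" using iso(3) im(2) by auto
      then show "(\<phi> a, \<phi> b) \<in> (adj H)\<^sup>*" unfolding adj_def by blast
    qed
    then show ?thesis using conn unfolding mg_connected_adj im(1) by blast
  qed
  show "\<exists>W'. one_exit_family H m W'" if W: "one_exit_family G m W"
  proof -
    have "exit_edges H (\<phi> ` W i) \<subseteq> \<psi> ` exit_edges G (W i)" if i: "i < m" for i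
    proof
      have sub: "W i \<subseteq> verts G" using W i unfolding one_exit_family_def by blast
      fix d assume dH: "d \<in> exit_edges H (\<phi> ` W i)"
      then obtain e where d: "d = \<psi> e" "e \<in> edges G" unfolding exit_edges_def im(2) by blast
      with dH obtain x y where x: "x \<in> \<phi> ` W i" "x \<in># image_mset \<phi> (ends G e)"
        and y: "y \<notin> \<phi> ` W i" "y \<in># image_mset \<phi> (ends G e)"
        unfolding exit_edges_def using iso(3)[OF d(2)] by (auto simp del: set_image_mset)
      from x(1) obtain x1 where x1: "x = \<phi> x1" "x1 \<in> W i" by blast
      from x(2) obtain x2 where x2: "x = \<phi> x2" "x2 \<in># ends G e" by auto
      have "x1 = x2" using sub G(4)[OF d(2)] im(3) x1 x2 by (metis inj_onD subsetD)
      moreover obtain y1 where "y1 \<in># ends G e" "y1 \<notin> W i" using y by auto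
      ultimately have "e \<in> exit_edges G (W i)" unfolding exit_edges_def using d(2) x1 x2 by blast
      then show "d \<in> \<psi> ` exit_edges G (W i)" using d(1) by blast
    qed
    moreover have "finite (exit_edges G (W i))" for i using G(2) unfolding exit_edges_def by auto
    ultimately have "card (exit_edges H (\<phi> ` W i)) \<le> 1" if "i < m" for i
      using W that surj_card_le[of "exit_edges G (W i)" "exit_edges H (\<phi> ` W i)" \<psi>]
      unfolding one_exit_family_def by fastforce
    moreover have "\<phi> ` W i \<inter> \<phi> ` W j = {}" if "i < m" "j < m" "i \<noteq> j" for i j
    proof -
      have "W i \<subseteq> verts G" "W j \<subseteq> verts G" "W i \<inter> W j = {}" using W that unfolding one_exit_family_def by blast+
      then show ?thesis using im(3) by (metis image_empty inj_on_image_Int)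
    qed
    ultimately have "one_exit_family H m (\<lambda>i. \<phi> ` W i)"
      using W im(1) unfolding one_exit_family_def by blast
    then show ?thesis by blast
  qed
qed

text \<open>The constructed skeleton has points of the plane as vertices, whereas the sequence of
  graphs is to live on natural numbers.\<close>

lemma nat_mgraph_copy:
  assumes "finite_mgraph G"
  shows "\<exists>H :: (nat, nat) mgraph. mg_iso G H"
proof -
  obtain \<phi> :: "_ \<Rightarrow> nat" where phi: "inj_on \<phi> (verts G)" using assms finite_imp_inj_to_nat_seg
    unfolding finite_mgraph_def by metis
  obtain \<psi> :: "_ \<Rightarrow> nat" where psi: "inj_on \<psi> (edges G)" using assms finite_imp_inj_to_nat_seg
    unfolding finite_mgraph_def by metis
  have "mg_iso G \<lparr>verts = \<phi> ` verts G, edges = \<psi> ` edges G,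
      ends = \<lambda>d. image_mset \<phi> (ends G (inv_into (edges G) \<psi> d))\<rparr>"
    unfolding mg_iso_def
    by (rule exI[of _ \<phi>], rule exI[of _ \<psi>]) (use phi psi in \<open>auto simp: inj_on_imp_bij_betw\<close>)
  then show ?thesis by blast
qed

section \<open>Lattice triangles and parallelograms\<close>

definition det2 :: "real \<times> real \<Rightarrow> real \<times> real \<Rightarrow> real" where
  "det2 u v = fst u * snd v - snd u * fst v"

text \<open>The quarter turn. It passes from an edge of the subdivision to the direction of the dual
  strand, and \<open>inner_rot\<close> turns scalar products with strands into determinants of
  edges.\<close>

definition rot :: "real \<times> real \<Rightarrow> real \<times> real" where
  "rot u = (- snd u, fst u)"

lemma det2_simps [simp]:
  "det2 (u + u') v = det2 u v + det2 u' v" "det2 u (v + v') = det2 u v + det2 u v'"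
  "det2 (u - u') v = det2 u v - det2 u' v" "det2 u (v - v') = det2 u v - det2 u v'"
  "det2 (- u) v = - det2 u v" "det2 u (- v) = - det2 u v"
  "det2 (c *\<^sub>R u) v = c * det2 u v" "det2 u (c *\<^sub>R v) = c * det2 u v" "det2 u u = 0"
  "det2 0 v = 0" "det2 u 0 = 0"
  by (simp_all add: det2_def algebra_simps)

lemma det2_swap: "det2 v u = - det2 u v"
  by (simp add: det2_def)

lemma inner_pair: "u \<bullet> v = fst u * fst v + snd u * snd v" for u v :: "real \<times> real"
  by (simp add: inner_prod_def)

lemma inner_rot: "rot u \<bullet> v = det2 u v"
  by (simp add: inner_pair rot_def det2_def algebra_simps)

lemma rot_eq_0 [simp]: "rot u = 0 \<longleftrightarrow> u = 0"
  by (auto simp: rot_def prod_eq_iff)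

lemma det2_0_imp_scaleR:
  assumes "det2 u v = 0" "u \<noteq> 0"
  shows "\<exists>c. v = c *\<^sub>R u"
proof (cases "fst u = 0")
  case True
  then have "snd u \<noteq> 0" using assms(2) by (simp add: prod_eq_iff)
  then show ?thesis using assms(1) True
    by (intro exI[of _ "snd v / snd u"]) (auto simp: det2_def prod_eq_iff)
next
  case False
  then show ?thesis using assms(1)
    by (intro exI[of _ "fst v / fst u"]) (auto simp: det2_def prod_eq_iff field_simps)
qed

lemma inner_0_imp_scaleR_rot:
  assumes "u \<bullet> v = 0" "u \<noteq> 0"
  shows "\<exists>c. v = c *\<^sub>R rot u"
proof -
  have "det2 (rot u) v = 0" using assms(1) by (simp add: inner_pair rot_def det2_def algebra_simps)
  then show ?thesis using det2_0_imp_scaleR[of "rot u" v] assms(2) by simp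
qed

text \<open>Cramer's rule, written without division.\<close>

lemma det2_expand: "det2 u v *\<^sub>R w = det2 w v *\<^sub>R u + det2 u w *\<^sub>R v"
  by (simp add: prod_eq_iff det2_def algebra_simps)

lemma collinear_det2:
  "collinear S \<longleftrightarrow> (\<forall>a\<in>S. \<forall>b\<in>S. \<forall>c\<in>S. det2 (b - a) (c - a) = 0)"
proof
  assume "collinear S"
  then obtain u where u: "\<And>x y. x \<in> S \<Longrightarrow> y \<in> S \<Longrightarrow> \<exists>c. x - y = c *\<^sub>R u" unfolding collinear_def by blast
  show "\<forall>a\<in>S. \<forall>b\<in>S. \<forall>c\<in>S. det2 (b - a) (c - a) = 0"
  proof (intro ballI)
    fix a b c assume "a \<in> S" "b \<in> S" "c \<in> S"
    then obtain r s where "b - a = r *\<^sub>R u" "c - a = s *\<^sub>R u" using u by metis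
    then show "det2 (b - a) (c - a) = 0" by (simp only: det2_simps mult_zero_right)
  qed
next
  assume *: "\<forall>a\<in>S. \<forall>b\<in>S. \<forall>c\<in>S. det2 (b - a) (c - a) = 0"
  show "collinear S"
  proof (cases "\<exists>a\<in>S. \<exists>b\<in>S. b \<noteq> a")
    case True
    then obtain a b where ab: "a \<in> S" "b \<in> S" "b - a \<noteq> 0" by auto
    then have "\<exists>c. x - a = c *\<^sub>R (b - a)" if "x \<in> S" for x
      using * that det2_0_imp_scaleR[of "b - a" "x - a"] by blast
    then obtain f where f: "\<And>x. x \<in> S \<Longrightarrow> x - a = f x *\<^sub>R (b - a)" by metis
    have "x - y = (f x - f y) *\<^sub>R (b - a)" if "x \<in> S" "y \<in> S" for x y
    proof -
      have "x - y = (x - a) - (y - a)" by simp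
      also have "\<dots> = (f x - f y) *\<^sub>R (b - a)"
        unfolding f[OF that(1)] f[OF that(2)] by (simp add: scaleR_left_diff_distrib)
      finally show ?thesis .
    qed
    then show ?thesis unfolding collinear_def by blast
  next
    case False
    then show ?thesis unfolding collinear_def by (metis diff_self scaleR_zero_left)
  qed
qed

lemma collinear_0_det2: "collinear {0, u, v} \<longleftrightarrow> det2 u v = 0"
  unfolding collinear_det2 by (auto simp: det2_swap[of v u])

section \<open>Areas of triangles and parallelograms\<close>

lemma aff_dim_2_iff: "aff_dim (S :: (real \<times> real) set) = 2 \<longleftrightarrow> \<not> collinear S"
  using collinear_aff_dim[of S] aff_dim_le_DIM[of S] by auto

text \<open>A bridge between pairs and vectors of length two, over which the area formula for
  triangles in \<open>real^2\<close> is carried to \<open>real \<times> real\<close>.\<close>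

lemma lborel_real2: "(lborel :: (real \<times> real) measure) = distr lborel borel (\<lambda>x::real^2. (x $ 1, x $ 2))"
proof (rule lborel_eqI)
  fix l u :: "real \<times> real"
  assume le: "\<And>b. b \<in> Basis \<Longrightarrow> l \<bullet> b \<le> u \<bullet> b"
  have m: "(\<lambda>x::real^2. (x $ 1, x $ 2)) \<in> borel_measurable borel" by simp
  have B: "Basis = {(1::real, 0::real), (0, 1)}" by (auto simp: Basis_prod_def)
  have vim: "(\<lambda>x::real^2. (x $ 1, x $ 2)) -` box l u = box (vector [fst l, snd l]) (vector [fst u, snd u])"
    by (auto simp: box_def B Basis_vec_def inner_axis forall_2 inner_prod_def)
  have Bv: "Basis = {axis 1 1, axis 2 1 :: real^2}" by (auto simp: Basis_vec_def UNIV_2)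
  have ne: "axis 1 1 \<noteq> (axis 2 1 :: real^2)" by (simp add: axis_eq_axis)
  have "emeasure (distr lborel borel (\<lambda>x::real^2. (x $ 1, x $ 2))) (box l u) =
      emeasure lborel (box (vector [fst l, snd l]) (vector [fst u, snd u]) :: (real^2) set)"
    using vim m by (simp add: emeasure_distr)
  also have "\<dots> = (\<Prod>b\<in>Basis. (u - l) \<bullet> b)"
    using le[of "(1, 0)"] le[of "(0, 1)"] by (simp add: emeasure_lborel_box_eq Bv ne B inner_axis inner_prod_def)
  finally show "emeasure (distr lborel borel (\<lambda>x::real^2. (x $ 1, x $ 2))) (box l u) = (\<Prod>b\<in>Basis. (u - l) \<bullet> b)" .
qed simp

lemma measure_triangle: "measure lebesgue (convex hull {a, b, c}) = \<bar>det2 (b - a) (c - a)\<bar> / 2"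
proof -
  define h where "h = (\<lambda>x::real^2. (x $ 1, x $ 2))"
  define g where "g = (\<lambda>p::real\<times>real. (vector [fst p, snd p] :: real^2))"
  have gh: "g (h x) = x" for x by (simp add: g_def h_def vec_eq_iff forall_2)
  have hg: "h (g p) = p" for p by (simp add: g_def h_def)
  have lin: "linear g" by (rule linearI) (simp_all add: g_def vec_eq_iff forall_2)
  have meas: "h \<in> borel_measurable borel" unfolding h_def by simp
  let ?K = "convex hull {a, b, c}"
  have "h -` ?K = g ` ?K"
  proof (intro set_eqI iffI)
    fix x assume "x \<in> h -` ?K"
    then show "x \<in> g ` ?K" using gh[of x] by (metis imageI vimageE)
  qed (auto simp: hg)
  also have "\<dots> = convex hull {g a, g b, g c}" using lin by (simp add: convex_hull_linear_image)
  finally have v: "h -` ?K = convex hull {g a, g b, g c}" .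
  have K: "?K \<in> sets borel" "convex hull {g a, g b, g c} \<in> sets borel"
    by (intro borel_compact finite_imp_compact_convex_hull; simp)+
  have "measure lebesgue ?K = measure lborel ?K" using K by (simp add: measure_completion)
  also have "\<dots> = measure (distr lborel borel h) ?K" using lborel_real2 unfolding h_def by metis
  also have "\<dots> = measure lborel (convex hull {g a, g b, g c})"
    using meas K v by (simp add: measure_distr)
  also have "\<dots> = \<bar>det2 (b - a) (c - a)\<bar> / 2"
    using content_triangle[of "g a" "g b" "g c"] by (simp add: g_def det2_def abs_minus_commute algebra_simps)
  finally show ?thesis .
qed

lemma convex_hull_parallelogram:
  fixes z a u v :: "real \<times> real"
  assumes "z \<in> convex hull {a, a + u, a + v, a + u + v}"
  shows "\<exists>s t. z = a + s *\<^sub>R u + t *\<^sub>R v \<and> 0 \<le> s \<and> s \<le> 1 \<and> 0 \<le> t \<and> t \<le> 1"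
proof -
  let ?f = "\<lambda>p. fst p *\<^sub>R u + snd p *\<^sub>R v"
  let ?Q = "(+) a ` ?f ` cbox (0, 0) (1, 1)"
  have "linear ?f" by (rule linearI) (auto simp: algebra_simps)
  then have "convex ?Q" by (intro convex_translation convex_linear_image convex_box)
  moreover have "{a, a + u, a + v, a + u + v} \<subseteq> ?Q"
  proof -
    have "?f (0, 0) \<in> ?f ` cbox (0, 0) (1, 1)" "?f (1, 0) \<in> ?f ` cbox (0, 0) (1, 1)"
      "?f (0, 1) \<in> ?f ` cbox (0, 0) (1, 1)" "?f (1, 1) \<in> ?f ` cbox (0, 0) (1, 1)"
      by (intro imageI; simp add: cbox_Pair_eq)+
    then have "{0, u, v, u + v} \<subseteq> ?f ` cbox (0, 0) (1, 1)" by simp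
    then have "(+) a ` {0, u, v, u + v} \<subseteq> ?Q" by (rule image_mono)
    then show ?thesis by (simp add: add.assoc)
  qed
  ultimately have "convex hull {a, a + u, a + v, a + u + v} \<subseteq> ?Q" by (intro hull_minimal)
  then have "z \<in> ?Q" using assms by blast
  then obtain p where p: "z = a + ?f p" "p \<in> cbox (0, 0) (1, 1)" by blast
  then have "0 \<le> fst p" "fst p \<le> 1" "0 \<le> snd p" "snd p \<le> 1" by (auto simp: cbox_Pair_eq)
  then show ?thesis using p(1) by (metis add.assoc)
qed

text \<open>The diagonal from \<open>a + u\<close> to \<open>a + v\<close> cuts the parallelogram
  into two triangles that meet only inside a line.\<close>

lemma measure_parallelogram:
  assumes "det2 u v \<noteq> 0"
  shows "measure lebesgue (convex hull {a, a + u, a + v, a + u + v}) = \<bar>det2 u v\<bar>"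
proof -
  let ?K = "convex hull {a, a + u, a + v, a + u + v}"
  let ?T1 = "convex hull {a, a + u, a + v}" and ?T2 = "convex hull {a + u + v, a + u, a + v}"
  have sub: "?T1 \<subseteq> ?K" "?T2 \<subseteq> ?K" by (rule hull_mono, blast)+
  have "?K \<subseteq> ?T1 \<union> ?T2"
  proof
    fix z assume "z \<in> ?K"
    then obtain s t where z: "z = a + s *\<^sub>R u + t *\<^sub>R v" and st: "0 \<le> s" "s \<le> 1" "0 \<le> t" "t \<le> 1"
      using convex_hull_parallelogram by blast
    show "z \<in> ?T1 \<union> ?T2"
    proof (cases "s + t \<le> 1")
      case True
      have "z = (1 - s - t) *\<^sub>R a + s *\<^sub>R (a + u) + t *\<^sub>R (a + v)" by (simp add: z algebra_simps)
      moreover have "0 \<le> 1 - s - t" "(1 - s - t) + s + t = 1" using True by auto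
      ultimately have "z \<in> ?T1" unfolding convex_hull_3 using st by blast
      then show ?thesis by blast
    next
      case False
      have "z = (s + t - 1) *\<^sub>R (a + u + v) + (1 - t) *\<^sub>R (a + u) + (1 - s) *\<^sub>R (a + v)" by (simp add: z algebra_simps)
      moreover have "0 \<le> s + t - 1" "0 \<le> 1 - t" "0 \<le> 1 - s" "(s + t - 1) + (1 - t) + (1 - s) = 1" using False st by auto
      ultimately have "z \<in> ?T2" unfolding convex_hull_3 by blast
      then show ?thesis by blast
    qed
  qed
  then have K: "?K = \<Union>{?T1, ?T2}" using sub by (intro subset_antisym) simp_all
  \<comment> \<open>A normal of the diagonal. The factor \<open>- det2 u v\<close> fixes its
    orientation: \<open>u\<close> and \<open>v\<close> both get the same positive value, so the two
    triangles lie on opposite sides of the diagonal.\<close>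
  define w where "w = (- det2 u v) *\<^sub>R rot (v - u)"
  have w: "w \<bullet> u = (det2 u v)\<^sup>2" "w \<bullet> v = (det2 u v)\<^sup>2"
    unfolding w_def by (simp_all add: inner_rot det2_swap[of v u] power2_eq_square)
  have 1: "?T1 \<subseteq> {z. w \<bullet> z \<le> w \<bullet> (a + u)}"
    by (rule hull_minimal) (simp_all add: convex_halfspace_le inner_add_right w)
  have 2: "?T2 \<subseteq> {z. w \<bullet> z \<ge> w \<bullet> (a + u)}"
    by (rule hull_minimal) (simp_all add: convex_halfspace_ge inner_add_right w)
  have "w \<noteq> 0" using assms w(1) by auto
  then have "negligible {z. w \<bullet> z = w \<bullet> (a + u)}" by (intro negligible_hyperplane) simp
  moreover have "?T1 \<inter> ?T2 \<subseteq> {z. w \<bullet> z = w \<bullet> (a + u)}"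
  proof
    fix z assume "z \<in> ?T1 \<inter> ?T2"
    then have "w \<bullet> z \<le> w \<bullet> (a + u)" "w \<bullet> z \<ge> w \<bullet> (a + u)"
      using subsetD[OF 1, of z] subsetD[OF 2, of z] by (simp_all del: insert_iff)
    then show "z \<in> {z. w \<bullet> z = w \<bullet> (a + u)}" by simp
  qed
  ultimately have neg: "negligible (?T1 \<inter> ?T2)" by (rule negligible_subset)
  have lm: "?T1 \<in> lmeasurable" "?T2 \<in> lmeasurable"
    by (intro lmeasurable_compact finite_imp_compact_convex_hull; simp)+
  show ?thesis
  proof (cases "?T1 = ?T2")
    case True
    then have "negligible ?T1" using neg by simp
    then have "measure lebesgue ?T1 = 0" by (rule negligible_imp_measure0)
    then show ?thesis using assms by (simp add: measure_triangle)
  next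
    case ne: False
    have "measure lebesgue ?K = (\<Sum>S\<in>{?T1, ?T2}. measure lebesgue S)"
      unfolding K by (rule measure_negligible_finite_Union) (use lm neg in \<open>auto simp only: pairwise_insert Int_commute finite.intros singletonD insert_iff pairwise_empty empty_iff\<close>)
    also have "\<dots> = measure lebesgue ?T1 + measure lebesgue ?T2" using ne by simp
    also have "\<dots> = \<bar>det2 u v\<bar>" unfolding measure_triangle by (simp add: det2_swap[of v u])
    finally show ?thesis .
  qed
qed

section \<open>Maximal terms and dual cells\<close>

lemma convex_hull_Int_supporting_hyperplane:
  fixes A :: "'a::euclidean_space set"
  assumes "finite A" "\<And>p. p \<in> A \<Longrightarrow> w \<bullet> p \<le> b"
  shows "convex hull A \<inter> {z. w \<bullet> z = b} = convex hull (A \<inter> {z. w \<bullet> z = b})"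
proof
  have "convex hull A \<subseteq> {z. w \<bullet> z \<le> b}"
    by (rule hull_minimal) (use assms(2) in \<open>auto simp: convex_halfspace_le\<close>)
  then have "(convex hull A \<inter> {z. w \<bullet> z = b}) face_of convex hull A"
    by (intro face_of_Int_supporting_hyperplane_le) auto
  then obtain A' where A': "A' \<subseteq> A" "convex hull A \<inter> {z. w \<bullet> z = b} = convex hull A'"
    using face_of_convex_hull_subset[OF finite_imp_compact[OF assms(1)]] by metis
  then have "A' \<subseteq> A \<inter> {z. w \<bullet> z = b}" using hull_subset[of A' convex] by blast
  then show "convex hull A \<inter> {z. w \<bullet> z = b} \<subseteq> convex hull (A \<inter> {z. w \<bullet> z = b})"
    unfolding A'(2) by (rule hull_mono)
  show "convex hull (A \<inter> {z. w \<bullet> z = b}) \<subseteq> convex hull A \<inter> {z. w \<bullet> z = b}"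
    by (intro hull_minimal convex_Int convex_convex_hull convex_hyperplane)
      (use hull_subset[of A convex] in blast)
qed

text \<open>A unique maximiser of a linear functional is an extreme point of the hull, and extreme
  points lie in every generating set. In this way exponents are recovered from a cell that is known
  only as a convex set.\<close>

lemma exposed_vertex_mem:
  fixes A B :: "'a::euclidean_space set"
  assumes "finite A" "convex hull A = convex hull B" "a \<in> A" "\<And>p. p \<in> A \<Longrightarrow> p \<noteq> a \<Longrightarrow> w \<bullet> p < w \<bullet> a"
  shows "a \<in> B"
proof -
  have "A \<inter> {z. w \<bullet> z = w \<bullet> a} = {a}" using assms(3,4) by fastforce
  moreover have le: "w \<bullet> p \<le> w \<bullet> a" if "p \<in> A" for p using assms(4)[OF that] by (cases "p = a") auto
  ultimately have eq: "convex hull A \<inter> {z. w \<bullet> z = w \<bullet> a} = {a}"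
    using convex_hull_Int_supporting_hyperplane[OF assms(1), of w "w \<bullet> a"] by simp
  have "convex hull A \<subseteq> {z. w \<bullet> z \<le> w \<bullet> a}"
    by (rule hull_minimal) (use le in \<open>auto simp: convex_halfspace_le\<close>)
  then have "{a} face_of convex hull A"
    using face_of_Int_supporting_hyperplane_le[of "convex hull A" w "w \<bullet> a"] unfolding eq by auto
  then have "a extreme_point_of convex hull B" unfolding assms(2) face_of_singleton .
  then show ?thesis by (rule extreme_point_of_convex_hull)
qed

section \<open>Tropical polynomials and their maximal terms\<close>

lemma finite_supp: "is_trop_poly f \<Longrightarrow> finite (supp f)" and supp_nonempty: "is_trop_poly f \<Longrightarrow> supp f \<noteq> {}"
  by (auto simp: is_trop_poly_def)

lemma supp_int: "is_trop_poly f \<Longrightarrow> p \<in> supp f \<Longrightarrow> fst p \<in> \<int> \<and> snd p \<in> \<int>"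
  using Nats_subset_Ints unfolding is_trop_poly_def by (metis mem_Times_iff subsetD)

lemma max_terms_iff:
  assumes "is_trop_poly f"
  shows "p \<in> max_terms f x \<longleftrightarrow> p \<in> supp f \<and> (\<forall>q\<in>supp f. coef f q + q \<bullet> x \<le> coef f p + p \<bullet> x)"
proof -
  let ?V = "(\<lambda>p. coef f p + p \<bullet> x) ` supp f"
  have V: "finite ?V" "?V \<noteq> {}" using finite_supp[OF assms] supp_nonempty[OF assms] by auto
  show ?thesis
  proof (cases "p \<in> supp f")
    case True
    then have "coef f p + p \<bullet> x = Max ?V \<longleftrightarrow> (\<forall>y\<in>?V. y \<le> coef f p + p \<bullet> x)"
      using Max_eq_iff[OF V, of "coef f p + p \<bullet> x"] by auto
    then show ?thesis using True by (simp add: max_terms_def trop_eval_def)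
  qed (simp add: max_terms_def)
qed

lemma max_terms_subset: "max_terms f x \<subseteq> supp f"
  by (auto simp: max_terms_def)

lemma finite_max_terms: "is_trop_poly f \<Longrightarrow> finite (max_terms f x)"
  using finite_subset[OF max_terms_subset finite_supp] .

lemma max_terms_nonempty:
  assumes "is_trop_poly f"
  shows "max_terms f x \<noteq> {}"
proof -
  let ?V = "(\<lambda>p. coef f p + p \<bullet> x) ` supp f"
  have "Max ?V \<in> ?V" using finite_supp[OF assms] supp_nonempty[OF assms] by (intro Max_in) auto
  then obtain p where "p \<in> supp f" "Max ?V = coef f p + p \<bullet> x" by blast
  then have "p \<in> max_terms f x" by (simp add: max_terms_def trop_eval_def)
  then show ?thesis by blast
qed

lemma max_terms_eqI:
  "p \<in> max_terms f x \<Longrightarrow> q \<in> max_terms f x \<Longrightarrow> coef f p + p \<bullet> x = coef f q + q \<bullet> x"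
  by (simp add: max_terms_def)

lemma max_terms_common:
  assumes "p \<in> max_terms f x" "q \<in> max_terms f x" "p \<in> max_terms f y" "q \<in> max_terms f y"
  shows "(q - p) \<bullet> (y - x) = 0"
  using max_terms_eqI[OF assms(1,2)] max_terms_eqI[OF assms(3,4)] by (simp add: inner_diff_left inner_diff_right)

definition argmax :: "real \<times> real \<Rightarrow> (real \<times> real) set \<Rightarrow> (real \<times> real) set" where
  "argmax d A = {p \<in> A. \<forall>q\<in>A. q \<bullet> d \<le> p \<bullet> d}"

text \<open>For small positive \<open>t\<close> the sign is decided lexicographically by
  \<open>(a, b)\<close>; in \<open>affine_le_far\<close>, for large \<open>t\<close>, by
  \<open>(b, a)\<close>.\<close>

lemma affine_le_near:
  fixes a b :: real
  shows "eventually (\<lambda>t. a + t * b \<le> 0 \<longleftrightarrow> a < 0 \<or> a = 0 \<and> b \<le> 0) (at_right 0)"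
proof -
  consider "a < 0" | "a = 0" | "a > 0" by linarith
  then show ?thesis
  proof cases
    case 1
    have "((\<lambda>t. a + t * b) \<longlongrightarrow> a + 0 * b) (at_right 0)" by (intro tendsto_intros)
    then have "eventually (\<lambda>t. a + t * b < 0) (at_right 0)" using 1 order_tendstoD(2) by force
    then show ?thesis by eventually_elim (use 1 in auto)
  next
    case 2
    have "eventually (\<lambda>t::real. 0 < t) (at_right 0)" by (rule eventually_at_right_less)
    then show ?thesis by eventually_elim (use 2 in \<open>auto simp: mult_le_0_iff\<close>)
  next
    case 3
    have "((\<lambda>t. a + t * b) \<longlongrightarrow> a + 0 * b) (at_right 0)" by (intro tendsto_intros)
    then have "eventually (\<lambda>t. a + t * b > 0) (at_right 0)" using 3 order_tendstoD(1) by force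
    then show ?thesis by eventually_elim (use 3 in auto)
  qed
qed

lemma affine_le_far:
  fixes a b :: real
  shows "eventually (\<lambda>t. a + t * b \<le> 0 \<longleftrightarrow> b < 0 \<or> b = 0 \<and> a \<le> 0) at_top"
proof -
  consider "b < 0" | "b = 0" | "b > 0" by linarith
  then show ?thesis
  proof cases
    case 1
    have "eventually (\<lambda>t. t \<ge> - a / b) at_top" by (rule eventually_ge_at_top)
    then show ?thesis by eventually_elim (use 1 in \<open>auto simp: field_simps\<close>)
  next
    case 2
    then show ?thesis by simp
  next
    case 3
    have "eventually (\<lambda>t. t > - a / b) at_top" by (rule eventually_gt_at_top)
    then show ?thesis by eventually_elim (use 3 in \<open>auto simp: field_simps\<close>)
  qed
qed

text \<open>Terms that are not maximal at \<open>x\<close> cannot catch up within a short time, and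
  ties at \<open>x\<close> are broken by the slope along \<open>d\<close>. The cell dual to a nearby
  point is thus a face of the cell at \<open>x\<close>.\<close>

lemma max_terms_near:
  assumes tp: "is_trop_poly f"
  shows "eventually (\<lambda>t. max_terms f (x + t *\<^sub>R d) = argmax d (max_terms f x)) (at_right 0)"
proof -
  let ?a = "\<lambda>p q. (coef f q + q \<bullet> x) - (coef f p + p \<bullet> x)" and ?b = "\<lambda>p q. q \<bullet> d - p \<bullet> d"
  have "eventually (\<lambda>t. \<forall>p\<in>supp f. \<forall>q\<in>supp f.
      (?a p q + t * ?b p q \<le> 0 \<longleftrightarrow> ?a p q < 0 \<or> ?a p q = 0 \<and> ?b p q \<le> 0)) (at_right 0)"
    by (intro eventually_ball_finite finite_supp[OF tp] ballI affine_le_near)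
  then show ?thesis
  proof eventually_elim
    case (elim t)
    have 1: "p \<in> max_terms f (x + t *\<^sub>R d) \<longleftrightarrow> p \<in> supp f \<and> (\<forall>q\<in>supp f. ?a p q < 0 \<or> ?a p q = 0 \<and> ?b p q \<le> 0)" for p
    proof -
      have "coef f q + q \<bullet> (x + t *\<^sub>R d) \<le> coef f p + p \<bullet> (x + t *\<^sub>R d) \<longleftrightarrow> ?a p q + t * ?b p q \<le> 0" for q
        by (simp add: inner_add_right algebra_simps)
      then show ?thesis unfolding max_terms_iff[OF tp] using elim by auto
    qed
    have ne: "max_terms f x \<noteq> {}" using max_terms_nonempty[OF tp] .
    show ?case
    proof (intro set_eqI iffI)
      fix p assume "p \<in> max_terms f (x + t *\<^sub>R d)"
      then have p: "p \<in> supp f" "\<And>q. q \<in> supp f \<Longrightarrow> ?a p q < 0 \<or> ?a p q = 0 \<and> ?b p q \<le> 0" using 1 by auto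
      then have "p \<in> max_terms f x" unfolding max_terms_iff[OF tp] by force
      moreover have "q \<bullet> d \<le> p \<bullet> d" if "q \<in> max_terms f x" for q
        using p(2)[of q] max_terms_eqI[OF that \<open>p \<in> max_terms f x\<close>] that max_terms_subset by fastforce
      ultimately show "p \<in> argmax d (max_terms f x)" unfolding argmax_def by blast
    next
      fix p assume p: "p \<in> argmax d (max_terms f x)"
      then have pm: "p \<in> max_terms f x" unfolding argmax_def by blast
      have "?a p q < 0 \<or> ?a p q = 0 \<and> ?b p q \<le> 0" if q: "q \<in> supp f" for q
      proof (cases "?a p q < 0")
        case False
        then have "q \<in> max_terms f x" using q pm unfolding max_terms_iff[OF tp] by force
        then have "q \<bullet> d \<le> p \<bullet> d" "coef f p + p \<bullet> x = coef f q + q \<bullet> x"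
          using p max_terms_eqI[OF pm] unfolding argmax_def by blast+
        then show ?thesis by linarith
      qed simp
      then show "p \<in> max_terms f (x + t *\<^sub>R d)" using 1 pm max_terms_subset by blast
    qed
  qed
qed

text \<open>Far out the slope along \<open>d\<close> decides and the values at \<open>x\<close> only
  break ties. The resulting set is independent of \<open>t\<close>, so the end of a ray has
  well-defined maximal terms.\<close>

lemma max_terms_far:
  assumes tp: "is_trop_poly f"
  shows "eventually (\<lambda>t. max_terms f (x + t *\<^sub>R d) =
    {p \<in> argmax d (supp f). \<forall>q\<in>argmax d (supp f). coef f q + q \<bullet> x \<le> coef f p + p \<bullet> x}) at_top"
proof -
  let ?a = "\<lambda>p q. (coef f q + q \<bullet> x) - (coef f p + p \<bullet> x)" and ?b = "\<lambda>p q. q \<bullet> d - p \<bullet> d"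
  have "eventually (\<lambda>t. \<forall>p\<in>supp f. \<forall>q\<in>supp f.
      (?a p q + t * ?b p q \<le> 0 \<longleftrightarrow> ?b p q < 0 \<or> ?b p q = 0 \<and> ?a p q \<le> 0)) at_top"
    by (intro eventually_ball_finite finite_supp[OF tp] ballI affine_le_far)
  then show ?thesis
  proof eventually_elim
    case (elim t)
    have 1: "p \<in> max_terms f (x + t *\<^sub>R d) \<longleftrightarrow> p \<in> supp f \<and> (\<forall>q\<in>supp f. ?b p q < 0 \<or> ?b p q = 0 \<and> ?a p q \<le> 0)" for p
    proof -
      have "coef f q + q \<bullet> (x + t *\<^sub>R d) \<le> coef f p + p \<bullet> (x + t *\<^sub>R d) \<longleftrightarrow> ?a p q + t * ?b p q \<le> 0" for q
        by (simp add: inner_add_right algebra_simps)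
      then show ?thesis unfolding max_terms_iff[OF tp] using elim by auto
    qed
    show ?case
    proof (intro set_eqI iffI)
      fix p assume "p \<in> max_terms f (x + t *\<^sub>R d)"
      then have p: "p \<in> supp f" "\<And>q. q \<in> supp f \<Longrightarrow> ?b p q < 0 \<or> ?b p q = 0 \<and> ?a p q \<le> 0" using 1 by blast+
      have "q \<bullet> d \<le> p \<bullet> d" if "q \<in> supp f" for q using p(2)[OF that] by linarith
      then have pa: "p \<in> argmax d (supp f)" using p(1) unfolding argmax_def by blast
      have "coef f q + q \<bullet> x \<le> coef f p + p \<bullet> x" if "q \<in> argmax d (supp f)" for q
      proof -
        have "q \<in> supp f" "p \<bullet> d \<le> q \<bullet> d" using that p(1) unfolding argmax_def by blast+
        then show ?thesis using p(2)[of q] by linarith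
      qed
      then show "p \<in> {p \<in> argmax d (supp f). \<forall>q\<in>argmax d (supp f). coef f q + q \<bullet> x \<le> coef f p + p \<bullet> x}"
        using pa by blast
    next
      fix p assume p: "p \<in> {p \<in> argmax d (supp f). \<forall>q\<in>argmax d (supp f). coef f q + q \<bullet> x \<le> coef f p + p \<bullet> x}"
      have "?b p q < 0 \<or> ?b p q = 0 \<and> ?a p q \<le> 0" if q: "q \<in> supp f" for q
      proof (cases "q \<bullet> d = p \<bullet> d")
        case True
        then have "q \<in> argmax d (supp f)" using p q unfolding argmax_def by simp
        then show ?thesis using p True by auto
      next
        case False
        moreover have "q \<bullet> d \<le> p \<bullet> d" using p q unfolding argmax_def by blast
        ultimately show ?thesis by linarith
      qed
      moreover have "p \<in> supp f" using p unfolding argmax_def by blast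
      ultimately show "p \<in> max_terms f (x + t *\<^sub>R d)" using 1 by blast
    qed
  qed
qed

text \<open>An upper face has a normal with positive last coordinate. Scaled to last coordinate 1,
  the normal becomes \<open>(x, 1)\<close>, and its scalar product with a lifted exponent is the
  value of that term at \<open>x\<close>. The lifted exponents on the face are therefore the terms
  maximal at \<open>x\<close>.\<close>

lemma dual_subdivision_iff:
  assumes tp: "is_trop_poly f"
  shows "\<sigma> \<in> dual_subdivision f \<longleftrightarrow> (\<exists>x. \<sigma> = convex hull (max_terms f x) \<and> \<not> collinear (max_terms f x))"
proof -
  define g where "g = (\<lambda>p. (p, coef f p))"
  let ?Q = "convex hull (g ` supp f)"
  have fing: "finite (g ` supp f)" using finite_supp[OF tp] by simp
  have ag: "a \<bullet> g p = snd a * (coef f p + p \<bullet> (fst a /\<^sub>R snd a))" if "snd a > 0" for a :: "(real \<times> real) \<times> real" and p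
  proof -
    have "a \<bullet> g p = fst a \<bullet> p + snd a * coef f p" by (simp add: g_def inner_prod_def)
    moreover have "snd a * (p \<bullet> (fst a /\<^sub>R snd a)) = fst a \<bullet> p" using that by (simp add: inner_commute)
    ultimately show ?thesis by (simp add: distrib_left)
  qed
  have fstg: "fst ` (convex hull (g ` A)) = convex hull A" for A
    using convex_hull_linear_image[OF linear_fst, of "g ` A"] by (simp add: g_def image_image)
  \<comment> \<open>On the terms maximal at \<open>x\<close> the height is the affine function
    \<open>trop_eval f x - p \<bullet> x\<close>, so lifting does not change the dimension.\<close>
  have dimg: "aff_dim (g ` max_terms f x) = aff_dim (max_terms f x)" for x
  proof -
    let ?L = "\<lambda>p::real\<times>real. (p, - (p \<bullet> x))"
    have "g ` max_terms f x = (+) (0, trop_eval f x) ` ?L ` max_terms f x"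
      unfolding image_image by (rule image_cong) (auto simp: g_def max_terms_def)
    moreover have "linear ?L" by (rule linearI) (auto simp: inner_add_left)
    moreover have "inj ?L" by (auto simp: inj_def)
    ultimately show ?thesis by (simp add: aff_dim_translation_eq)
  qed
  have face: "?Q \<inter> {z. a \<bullet> z = b} = convex hull (g ` max_terms f (fst a /\<^sub>R snd a))"
    if a: "snd a > 0" and le: "?Q \<subseteq> {z. a \<bullet> z \<le> b}" and ne: "?Q \<inter> {z. a \<bullet> z = b} \<noteq> {}" for a b
  proof -
    have le': "\<And>z. z \<in> g ` supp f \<Longrightarrow> a \<bullet> z \<le> b" using le hull_subset[of "g ` supp f" convex] by blast
    have eq: "?Q \<inter> {z. a \<bullet> z = b} = convex hull (g ` supp f \<inter> {z. a \<bullet> z = b})"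
      by (rule convex_hull_Int_supporting_hyperplane[OF fing le'])
    then have "g ` supp f \<inter> {z. a \<bullet> z = b} \<noteq> {}" using ne by (metis convex_hull_eq_empty)
    then obtain p0 where p0: "p0 \<in> supp f" "a \<bullet> g p0 = b" by blast
    have "g ` supp f \<inter> {z. a \<bullet> z = b} = g ` max_terms f (fst a /\<^sub>R snd a)"
    proof -
      have "a \<bullet> g p = b \<longleftrightarrow> p \<in> max_terms f (fst a /\<^sub>R snd a)" if "p \<in> supp f" for p
      proof -
        have "a \<bullet> g p = b \<longleftrightarrow> (\<forall>q\<in>supp f. a \<bullet> g q \<le> a \<bullet> g p)"
          using le' p0 that by (metis imageI order_antisym)
        also have "\<dots> \<longleftrightarrow> p \<in> max_terms f (fst a /\<^sub>R snd a)"
          unfolding ag[OF a] max_terms_iff[OF tp] using a that by simp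
        finally show ?thesis .
      qed
      then show ?thesis using max_terms_subset[of f] by blast
    qed
    with eq show ?thesis by simp
  qed
  show ?thesis
  proof
    assume "\<sigma> \<in> dual_subdivision f"
    then obtain F where F: "\<sigma> = fst ` F" "F upper_face_of ?Q" "aff_dim F = 2"
      unfolding dual_subdivision_def induced_cells_def g_def by blast
    then obtain a b where a: "snd a > 0" "?Q \<subseteq> {z. a \<bullet> z \<le> b}" "F = ?Q \<inter> {z. a \<bullet> z = b}" "F \<noteq> {}"
      unfolding upper_face_of_def by blast
    have "F = convex hull (g ` max_terms f (fst a /\<^sub>R snd a))" using face[OF a(1,2)] a(3,4) by simp
    then show "\<exists>x. \<sigma> = convex hull (max_terms f x) \<and> \<not> collinear (max_terms f x)"
      using F fstg dimg aff_dim_2_iff by (metis aff_dim_convex_hull)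
  next
    assume "\<exists>x. \<sigma> = convex hull (max_terms f x) \<and> \<not> collinear (max_terms f x)"
    then obtain x where x: "\<sigma> = convex hull (max_terms f x)" "\<not> collinear (max_terms f x)" by blast
    let ?a = "(x, 1::real)"
    have ap: "?a \<bullet> g p = coef f p + p \<bullet> x" for p using ag[of ?a p] by simp
    have le: "?Q \<subseteq> {z. ?a \<bullet> z \<le> trop_eval f x}"
    proof (rule hull_minimal)
      show "g ` supp f \<subseteq> {z. ?a \<bullet> z \<le> trop_eval f x}"
        using finite_supp[OF tp] ap by (auto simp: trop_eval_def)
    qed (rule convex_halfspace_le)
    obtain p where p: "p \<in> max_terms f x" using max_terms_nonempty[OF tp] by blast
    then have "g p \<in> ?Q \<inter> {z. ?a \<bullet> z = trop_eval f x}"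
      using ap[of p] hull_subset[of "g ` supp f" convex] by (auto simp: max_terms_def)
    then have F: "?Q \<inter> {z. ?a \<bullet> z = trop_eval f x} = convex hull (g ` max_terms f x)"
      "?Q \<inter> {z. ?a \<bullet> z = trop_eval f x} \<noteq> {}" using face[OF _ le] by auto
    then have "(convex hull (g ` max_terms f x)) upper_face_of ?Q"
      unfolding upper_face_of_def using le by (metis snd_conv zero_less_one)
    moreover have "aff_dim (convex hull (g ` max_terms f x)) = 2"
      using x(2) dimg aff_dim_2_iff by (simp add: aff_dim_convex_hull)
    ultimately show "\<sigma> \<in> dual_subdivision f"
      unfolding dual_subdivision_def induced_cells_def using x(1) fstg g_def by blast
  qed
qed

section \<open>Unimodular cells and their corners\<close>

definition unimod_triangle :: "(real \<times> real) set \<Rightarrow> bool" where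
  "unimod_triangle A \<longleftrightarrow> (\<exists>a u v. A = {a, a + u, a + v} \<and> \<bar>det2 u v\<bar> = 1)"

text \<open>Like \<open>unimod_triangle\<close>, this is a condition on a finite set of exponents
  and not on its hull, because the local shape of the curve is read off from the maximal terms
  themselves. The passage from hull to set is made in \<open>nodal_cells\<close>.\<close>

definition unimod_parallelogram :: "(real \<times> real) set \<Rightarrow> bool" where
  "unimod_parallelogram A \<longleftrightarrow> (\<exists>a u v. A = {a, a + u, a + v, a + u + v} \<and> \<bar>det2 u v\<bar> = 1)"

lemma det2_nz_distinct:
  assumes "det2 u v \<noteq> 0"
  shows "u \<noteq> 0" "v \<noteq> 0" "u \<noteq> v" "v \<noteq> u" "u + v \<noteq> 0"
  using assms by (auto simp: add_eq_0_iff)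

lemma card_triangle: "det2 u v \<noteq> 0 \<Longrightarrow> card {a, a + u, a + v} = 3"
  using det2_nz_distinct[of u v] by simp

lemma card_parallelogram: "det2 u v \<noteq> 0 \<Longrightarrow> card {a, a + u, a + v, a + u + v} = 4"
  using det2_nz_distinct[of u v] by (simp add: add.assoc)

lemma card_unimod: "unimod_triangle A \<Longrightarrow> card A = 3" "unimod_parallelogram A \<Longrightarrow> card A = 4"
proof -
  show "card A = 3" if "unimod_triangle A"
    using that card_triangle unfolding unimod_triangle_def by force
  show "card A = 4" if "unimod_parallelogram A"
    using that card_parallelogram unfolding unimod_parallelogram_def by force
qed

text \<open>The corner \<open>a\<close> is exposed by a normal of the diagonal \<open>v - u\<close>,
  which takes the same negative value on \<open>u\<close> and \<open>v\<close>. The remaining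
  corners are treated afterwards by moving the base point.\<close>

lemma corner_mem:
  assumes "det2 u v \<noteq> 0"
  shows "convex hull {a, a + u, a + v} = convex hull B \<Longrightarrow> a \<in> B"
    "convex hull {a, a + u, a + v, a + u + v} = convex hull B \<Longrightarrow> a \<in> B"
proof -
  define w where "w = det2 u v *\<^sub>R rot (v - u)"
  have w: "w \<bullet> u = - (det2 u v)\<^sup>2" "w \<bullet> v = - (det2 u v)\<^sup>2"
    unfolding w_def by (simp_all add: inner_rot det2_swap[of v u] power2_eq_square)
  have pos: "(det2 u v)\<^sup>2 > 0" using assms by simp
  show "convex hull {a, a + u, a + v} = convex hull B \<Longrightarrow> a \<in> B"
    by (rule exposed_vertex_mem[where w = w and A = "{a, a + u, a + v}"])
      (use pos in \<open>auto simp: inner_add_right w simp del: zero_less_power2\<close>)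
  show "convex hull {a, a + u, a + v, a + u + v} = convex hull B \<Longrightarrow> a \<in> B"
    by (rule exposed_vertex_mem[where w = w and A = "{a, a + u, a + v, a + u + v}"])
      (use pos in \<open>auto simp: inner_add_right w simp del: zero_less_power2\<close>)
qed

lemma triangle_corners:
  assumes "det2 u v \<noteq> 0" "convex hull {a, a + u, a + v} = convex hull B"
  shows "{a, a + u, a + v} \<subseteq> B"
proof -
  have "a \<in> B" using corner_mem(1)[OF assms] .
  moreover have "a + u \<in> B"
    by (rule corner_mem(1)[of "- u" "v - u"])
      (use assms in \<open>simp_all add: insert_commute\<close>)
  moreover have "a + v \<in> B"
    by (rule corner_mem(1)[of "- v" "u - v"])
      (use assms in \<open>simp_all add: insert_commute det2_swap[of v u]\<close>)
  ultimately show ?thesis by simp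
qed

lemma parallelogram_corners:
  assumes "det2 u v \<noteq> 0" "convex hull {a, a + u, a + v, a + u + v} = convex hull B"
  shows "{a, a + u, a + v, a + u + v} \<subseteq> B"
proof -
  have "a \<in> B" using corner_mem(2)[OF assms] .
  moreover have "a + u \<in> B"
  proof (rule corner_mem(2)[of "- u" v])
    have "{a + u, a + u + - u, a + u + v, a + u + - u + v} = {a, a + u, a + v, a + u + v}" by auto
    then show "convex hull {a + u, a + u + - u, a + u + v, a + u + - u + v} = convex hull B" using assms(2) by simp
  qed (use assms in simp)
  moreover have "a + v \<in> B"
  proof (rule corner_mem(2)[of u "- v"])
    have "{a + v, a + v + u, a + v + - v, a + v + u + - v} = {a, a + u, a + v, a + u + v}" by (auto simp: algebra_simps)
    then show "convex hull {a + v, a + v + u, a + v + - v, a + v + u + - v} = convex hull B" using assms(2) by simp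
  qed (use assms in simp)
  moreover have "a + u + v \<in> B"
  proof (rule corner_mem(2)[of "- u" "- v"])
    have "{a + u + v, a + u + v + - u, a + u + v + - v, a + u + v + - u + - v} = {a, a + u, a + v, a + u + v}"
      by (auto simp: algebra_simps)
    then show "convex hull {a + u + v, a + u + v + - u, a + u + v + - v, a + u + v + - u + - v} = convex hull B"
      using assms(2) by simp
  qed (use assms in simp)
  ultimately show ?thesis by simp
qed

lemma int_pair_simps:
  assumes "p \<in> \<int> \<times> \<int>" "q \<in> \<int> \<times> \<int>"
  shows "det2 p q \<in> \<int>" "p - q \<in> \<int> \<times> \<int>" "p + q \<in> \<int> \<times> \<int>" "rot p \<in> \<int> \<times> \<int>" "p \<bullet> q \<in> \<int>" "- p \<in> \<int> \<times> \<int>"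
  using assms by (auto simp: det2_def rot_def mem_Times_iff inner_pair)

lemma int_unit_interval:
  fixes s :: real
  assumes "s * D \<in> \<int>" "\<bar>D\<bar> = 1" "0 \<le> s" "s \<le> 1"
  shows "s = 0 \<or> s = 1"
proof -
  have "s \<in> \<int>"
  proof (cases "D = 1")
    case False
    then have "s = - (s * D)" using assms(2) by (auto simp: abs_if split: if_splits)
    then show ?thesis using assms(1) by (metis Ints_minus)
  qed (use assms in simp)
  then obtain k where k: "s = of_int k" by (rule Ints_cases)
  then have "k = 0 \<or> k = 1" using assms(3,4) by auto
  then show ?thesis using k by auto
qed

text \<open>By Cramer's rule \<open>s\<close> and \<open>t\<close> are, up to sign, determinants of
  integer vectors, since the denominator is a unit; an integer between 0 and 1 is one of the
  two.\<close>

lemma lattice_points_cell: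
  assumes D: "\<bar>det2 u v\<bar> = 1" and int: "a \<in> \<int> \<times> \<int>" "a + u \<in> \<int> \<times> \<int>" "a + v \<in> \<int> \<times> \<int>" "p \<in> \<int> \<times> \<int>"
    and p: "p = a + s *\<^sub>R u + t *\<^sub>R v" "0 \<le> s" "s \<le> 1" "0 \<le> t" "t \<le> 1"
  shows "(s = 0 \<or> s = 1) \<and> (t = 0 \<or> t = 1)"
proof -
  have uv: "u \<in> \<int> \<times> \<int>" "v \<in> \<int> \<times> \<int>" "p - a \<in> \<int> \<times> \<int>"
    using int_pair_simps(2)[OF int(2) int(1)] int_pair_simps(2)[OF int(3) int(1)] int_pair_simps(2)[OF int(4) int(1)]
    by simp_all
  have "det2 (p - a) v = s * det2 u v" "det2 (p - a) u = t * det2 v u" by (simp_all add: p)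
  then have "s * det2 u v \<in> \<int>" "t * det2 v u \<in> \<int>" using int_pair_simps(1)[OF uv(3)] uv by metis+
  then show ?thesis using int_unit_interval p D by (metis abs_minus_cancel det2_swap)
qed

lemma unimod_three:
  assumes "unimod_triangle A \<or> unimod_parallelogram A" "p \<in> A" "q \<in> A" "r \<in> A" "p \<noteq> q" "p \<noteq> r" "q \<noteq> r"
  shows "det2 (q - p) (r - p) \<noteq> 0"
proof -
  obtain a u v where "A \<subseteq> {a, a + u, a + v, a + u + v}" and D: "\<bar>det2 u v\<bar> = 1"
    using assms(1) unfolding unimod_triangle_def unimod_parallelogram_def by blast
  then have "p - a \<in> {0, u, v, u + v}" "q - a \<in> {0, u, v, u + v}" "r - a \<in> {0, u, v, u + v}"
    using assms(2-4) by auto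
  then obtain P Q R where P: "p = a + P" "q = a + Q" "r = a + R" "P \<in> {0, u, v, u + v}" "Q \<in> {0, u, v, u + v}" "R \<in> {0, u, v, u + v}"
    by (metis add_diff_cancel_left' diff_add_cancel add.commute)
  have *: "det2 u v \<noteq> 0" "det2 v u = - det2 u v" using D det2_swap[of v u] by auto
  have "P \<noteq> Q" "P \<noteq> R" "Q \<noteq> R" using assms(5-7) P by auto
  then have "det2 (Q - P) (R - P) \<noteq> 0" using P(4-6) *
    by (elim insertE emptyE; simp)
  moreover have "q - p = Q - P" "r - p = R - P" by (simp_all add: P)
  ultimately show ?thesis by simp
qed

text \<open>One of the two spanning vectors completes \<open>q - p\<close> to a lattice basis. The
  determinant condition expresses that the segment from \<open>p\<close> to \<open>q\<close> is
  primitive.\<close>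

lemma unimod_primitive:
  assumes "unimod_triangle A \<or> unimod_parallelogram A" "A \<subseteq> \<int> \<times> \<int>" "p \<in> A" "q \<in> A" "p \<noteq> q"
  shows "\<exists>z\<in>\<int> \<times> \<int>. \<bar>det2 (q - p) z\<bar> = 1"
proof -
  obtain a u v where A: "A \<subseteq> {a, a + u, a + v, a + u + v}" "a \<in> A" "a + u \<in> A" "a + v \<in> A" and D: "\<bar>det2 u v\<bar> = 1"
    using assms(1) unfolding unimod_triangle_def unimod_parallelogram_def by blast
  have z: "u \<in> \<int> \<times> \<int>" "v \<in> \<int> \<times> \<int>"
    using int_pair_simps(2)[of "a + u" a] int_pair_simps(2)[of "a + v" a] A(2-4) assms(2) by auto
  have "p - a \<in> {0, u, v, u + v}" "q - a \<in> {0, u, v, u + v}" using assms(3,4) A(1) by auto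
  then obtain P Q where P: "p = a + P" "q = a + Q" "P \<in> {0, u, v, u + v}" "Q \<in> {0, u, v, u + v}"
    by (metis add_diff_cancel_left' diff_add_cancel add.commute)
  have *: "det2 v u = - det2 u v" by (rule det2_swap)
  have "P \<noteq> Q" using assms(5) P by auto
  then have "\<bar>det2 (Q - P) u\<bar> = 1 \<or> \<bar>det2 (Q - P) v\<bar> = 1" using P(3,4) D
    by (elim insertE emptyE; simp add: *)
  moreover have "q - p = Q - P" using P by simp
  ultimately show ?thesis using z by metis
qed

lemma unimod_not_collinear:
  assumes "unimod_triangle A \<or> unimod_parallelogram A"
  shows "\<not> collinear A"
proof -
  obtain a u v where A: "a \<in> A" "a + u \<in> A" "a + v \<in> A" and D: "\<bar>det2 u v\<bar> = 1"
    using assms unfolding unimod_triangle_def unimod_parallelogram_def by blast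
  then have "det2 (a + u - a) (a + v - a) \<noteq> 0" by auto
  then show ?thesis unfolding collinear_det2 using A by blast
qed

lemma nodal_trop: "nodal_tropical_curve f \<Longrightarrow> is_trop_poly f"
  by (simp add: nodal_tropical_curve_def)

lemma supp_int_pair: "is_trop_poly f \<Longrightarrow> supp f \<subseteq> \<int> \<times> \<int>"
  using supp_int[of f] by (auto simp: mem_Times_iff)

lemma max_terms_int: "is_trop_poly f \<Longrightarrow> max_terms f x \<subseteq> \<int> \<times> \<int>"
  using supp_int_pair max_terms_subset by blast

lemma nodal_supp: "nodal_tropical_curve f \<Longrightarrow> \<not> collinear (supp f)"
  unfolding nodal_tropical_curve_def nodal_subdivision_def regular_subdivision_def lattice_subdivision_def
    lattice_polygon_def newton_polygon_def using aff_dim_2_iff by (simp add: aff_dim_convex_hull)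

text \<open>A nodal subdivision prescribes shape and area of the hull. The corners must be among the
  maximal terms because they are exposed, and a cell of this area has no other lattice points. The
  numbers of corners, three against four, keep the two cases apart.\<close>

lemma nodal_cells:
  assumes nod: "nodal_tropical_curve f" and nc: "\<not> collinear (max_terms f x)"
  shows "triangle (dual_face f x) \<and> \<not> parallelogram (dual_face f x) \<and> unimod_triangle (max_terms f x) \<and> measure lebesgue (dual_face f x) = 1 / 2 \<or>
    parallelogram (dual_face f x) \<and> \<not> triangle (dual_face f x) \<and> unimod_parallelogram (max_terms f x) \<and> measure lebesgue (dual_face f x) = 1"
proof -
  let ?M = "max_terms f x"
  have tp: "is_trop_poly f" using nodal_trop[OF nod] .
  have int: "?M \<subseteq> \<int> \<times> \<int>" using max_terms_int[OF tp] .
  have "convex hull ?M \<in> dual_subdivision f" using dual_subdivision_iff[OF tp] nc by blast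
  then have cases: "triangle (dual_face f x) \<and> measure lebesgue (dual_face f x) = 1 / 2 \<or>
      parallelogram (dual_face f x) \<and> measure lebesgue (dual_face f x) = 1"
    using nod unfolding nodal_tropical_curve_def nodal_subdivision_def dual_face_def by blast
  have tri: "unimod_triangle ?M" if T: "triangle (dual_face f x)" "measure lebesgue (dual_face f x) = 1 / 2"
  proof -
    obtain a b c where "\<not> collinear {a, b, c}" and h: "convex hull ?M = convex hull {a, b, c}"
      using T(1) unfolding triangle_def dual_face_def by blast
    define u v where "u = b - a" and "v = c - a"
    have abc: "{a, b, c} = {a, a + u, a + v}" by (simp add: u_def v_def)
    have D: "\<bar>det2 u v\<bar> = 1" using T(2) measure_triangle[of a b c] unfolding dual_face_def h u_def v_def by simp
    have sub: "{a, a + u, a + v} \<subseteq> ?M" using triangle_corners[of u v a ?M] D h abc by auto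
    moreover have "p \<in> {a, a + u, a + v}" if p: "p \<in> ?M" for p
    proof -
      have "p \<in> convex hull {a, a + u, a + v}" using p h abc hull_subset[of ?M convex] by auto
      then obtain r s t where rst: "p = r *\<^sub>R a + s *\<^sub>R (a + u) + t *\<^sub>R (a + v)" "0 \<le> r" "0 \<le> s" "0 \<le> t" "r + s + t = 1"
        unfolding convex_hull_3 by blast
      have "p = (r + s + t) *\<^sub>R a + s *\<^sub>R u + t *\<^sub>R v" using rst(1) by (simp add: algebra_simps)
      then have p': "p = a + s *\<^sub>R u + t *\<^sub>R v" using rst(5) by simp
      then have "(s = 0 \<or> s = 1) \<and> (t = 0 \<or> t = 1)"
        by (intro lattice_points_cell[OF D _ _ _ _ p']) (use sub int p rst in auto)
      moreover have "\<not> (s = 1 \<and> t = 1)" using rst by auto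
      ultimately show ?thesis using p' by auto
    qed
    ultimately have "?M = {a, a + u, a + v}" by blast
    then show ?thesis unfolding unimod_triangle_def using D by blast
  qed
  have par: "unimod_parallelogram ?M" if T: "parallelogram (dual_face f x)" "measure lebesgue (dual_face f x) = 1"
  proof -
    obtain a u v where nc0: "\<not> collinear {0, u, v}" and h: "convex hull ?M = convex hull {a, a + u, a + v, a + u + v}"
      using T(1) unfolding parallelogram_def dual_face_def by blast
    have nz: "det2 u v \<noteq> 0" using nc0 collinear_0_det2 by blast
    have D: "\<bar>det2 u v\<bar> = 1" using T(2) measure_parallelogram[OF nz, of a] unfolding dual_face_def h by simp
    have sub: "{a, a + u, a + v, a + u + v} \<subseteq> ?M" using parallelogram_corners[OF nz h[symmetric]] .
    moreover have "p \<in> {a, a + u, a + v, a + u + v}" if p: "p \<in> ?M" for p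
    proof -
      have "p \<in> convex hull {a, a + u, a + v, a + u + v}" using p h hull_subset[of ?M convex] by auto
      then obtain s t where p': "p = a + s *\<^sub>R u + t *\<^sub>R v" and st: "0 \<le> s" "s \<le> 1" "0 \<le> t" "t \<le> 1"
        using convex_hull_parallelogram by blast
      then have "(s = 0 \<or> s = 1) \<and> (t = 0 \<or> t = 1)"
        by (intro lattice_points_cell[OF D _ _ _ _ p']) (use sub int p in auto)
      then show ?thesis using p' by (auto simp: add.assoc)
    qed
    ultimately have "?M = {a, a + u, a + v, a + u + v}" by blast
    then show ?thesis unfolding unimod_parallelogram_def using D by blast
  qed
  have notpar: "\<not> parallelogram (dual_face f x)" if "unimod_triangle ?M"
  proof
    assume "parallelogram (dual_face f x)"
    then obtain a u v where nc0: "\<not> collinear {0, u, v}" and h: "convex hull {a, a + u, a + v, a + u + v} = convex hull ?M"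
      unfolding parallelogram_def dual_face_def by metis
    have nz: "det2 u v \<noteq> 0" using nc0 collinear_0_det2 by blast
    have "4 \<le> card ?M" using card_mono[OF finite_max_terms[OF tp] parallelogram_corners[OF nz h]] card_parallelogram[OF nz] by metis
    then show False using card_unimod(1)[OF that] by simp
  qed
  have nottri: "\<not> triangle (dual_face f x)" if M: "unimod_parallelogram ?M"
  proof
    assume "triangle (dual_face f x)"
    then obtain a b c where h: "convex hull ?M = convex hull {a, b, c}"
      unfolding triangle_def dual_face_def by metis
    obtain a' u v where M': "?M = {a', a' + u, a' + v, a' + u + v}" "det2 u v \<noteq> 0"
      using M unfolding unimod_parallelogram_def by force
    have "?M \<subseteq> {a, b, c}" using parallelogram_corners[OF M'(2), of a' "{a, b, c}"] h M'(1) by simp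
    then have "card ?M \<le> card {a, b, c}" by (intro card_mono) auto
    also have "\<dots> \<le> 3" by (simp add: card_insert_if)
    finally show False using card_unimod(2)[OF M] by simp
  qed
  show ?thesis using cases tri par notpar nottri by blast
qed

lemma collinear_convex_hull: "collinear (convex hull A) \<longleftrightarrow> collinear A" for A :: "(real \<times> real) set"
  unfolding collinear_aff_dim aff_dim_convex_hull ..

lemma collinear_max_terms_dual_face:
  assumes "is_trop_poly f" "dual_face f x \<in> dual_subdivision f"
  shows "\<not> collinear (max_terms f x)"
  using assms(2) unfolding dual_subdivision_iff[OF assms(1)] dual_face_def by (metis collinear_convex_hull)

section \<open>Vertices, nodes and edge points of a nodal curve\<close>

lemma curve_vertices_iff:
  assumes nod: "nodal_tropical_curve f"
  shows "v \<in> curve_vertices f \<longleftrightarrow> unimod_triangle (max_terms f v)"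
proof
  have tp: "is_trop_poly f" using nodal_trop[OF nod] .
  show "unimod_triangle (max_terms f v)" if "v \<in> curve_vertices f"
    using that nodal_cells[OF nod] collinear_max_terms_dual_face[OF tp] unfolding curve_vertices_def by blast
  show "v \<in> curve_vertices f" if u: "unimod_triangle (max_terms f v)"
  proof -
    have nc: "\<not> collinear (max_terms f v)" using unimod_not_collinear u by blast
    then have "dual_face f v \<in> dual_subdivision f" unfolding dual_subdivision_iff[OF tp] dual_face_def by blast
    moreover have "\<not> unimod_parallelogram (max_terms f v)" using card_unimod u by fastforce
    ultimately show ?thesis
      using nodal_cells[OF nod nc] card_unimod(1)[OF u] unfolding curve_vertices_def tropical_curve_def by auto
  qed
qed

lemma nodes_iff:
  assumes nod: "nodal_tropical_curve f"
  shows "x \<in> nodes f \<longleftrightarrow> unimod_parallelogram (max_terms f x)"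
proof
  have tp: "is_trop_poly f" using nodal_trop[OF nod] .
  show "unimod_parallelogram (max_terms f x)" if "x \<in> nodes f"
    using that nodal_cells[OF nod] collinear_max_terms_dual_face[OF tp] unfolding nodes_def by blast
  show "x \<in> nodes f" if u: "unimod_parallelogram (max_terms f x)"
  proof -
    have nc: "\<not> collinear (max_terms f x)" using unimod_not_collinear u by blast
    then have "dual_face f x \<in> dual_subdivision f" unfolding dual_subdivision_iff[OF tp] dual_face_def by blast
    moreover have "\<not> unimod_triangle (max_terms f x)" using card_unimod u by fastforce
    ultimately show ?thesis
      using nodal_cells[OF nod nc] card_unimod(2)[OF u] unfolding nodes_def tropical_curve_def by auto
  qed
qed

lemma two_distinct:
  assumes "2 \<le> card A"
  shows "\<exists>p\<in>A. \<exists>q\<in>A. p \<noteq> q"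
proof -
  have "finite A" by (rule ccontr) (use assms in simp)
  then show ?thesis using assms card_le_Suc0_iff_eq[of A] by auto
qed

lemma two_le_card: "finite A \<Longrightarrow> p \<in> A \<Longrightarrow> q \<in> A \<Longrightarrow> p \<noteq> q \<Longrightarrow> 2 \<le> card A"
  using card_mono[of A "{p, q}"] by simp

text \<open>Moving across the edge until a further term becomes maximal, one arrives at a cell that has the
  edge as a side.\<close>

lemma max_terms_edge:
  assumes nod: "nodal_tropical_curve f" and card: "2 \<le> card (max_terms f x)" and col: "collinear (max_terms f x)"
  shows "\<exists>p q. max_terms f x = {p, q} \<and> p \<noteq> q \<and> (\<exists>z\<in>\<int> \<times> \<int>. \<bar>det2 (q - p) z\<bar> = 1)"
proof -
  have tp: "is_trop_poly f" using nodal_trop[OF nod] .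
  obtain p q where pq: "p \<in> max_terms f x" "q \<in> max_terms f x" "p \<noteq> q" using two_distinct[OF card] by blast
  define e where "e = q - p"
  have e: "e \<noteq> 0" using pq by (simp add: e_def)
  have "\<exists>r\<in>supp f. det2 e (r - p) \<noteq> 0"
  proof (rule ccontr)
    assume "\<not> ?thesis"
    then have 0: "\<And>r. r \<in> supp f \<Longrightarrow> det2 e (r - p) = 0" by blast
    have "det2 (b - a) (c - a) = 0" if abc: "a \<in> supp f" "b \<in> supp f" "c \<in> supp f" for a b c
    proof -
      obtain i where i: "a - p = i *\<^sub>R e" using det2_0_imp_scaleR[OF 0[OF abc(1)] e] by blast
      obtain j where j: "b - p = j *\<^sub>R e" using det2_0_imp_scaleR[OF 0[OF abc(2)] e] by blast
      obtain k where k: "c - p = k *\<^sub>R e" using det2_0_imp_scaleR[OF 0[OF abc(3)] e] by blast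
      have "b - a = (b - p) - (a - p)" "c - a = (c - p) - (a - p)" by simp_all
      then show ?thesis unfolding i j k by (simp only: det2_simps mult_zero_right diff_self)
    qed
    then show False using nodal_supp[OF nod] unfolding collinear_det2 by blast
  qed
  then obtain r0 where r0: "r0 \<in> supp f" "det2 e (r0 - p) \<noteq> 0" by blast
  \<comment> \<open>The normal of the edge towards the side on which a further exponent
    exists.\<close>
  define \<rho> where "\<rho> = (if det2 e (r0 - p) > 0 then rot e else - rot e)"
  have r0': "\<rho> \<bullet> p < \<rho> \<bullet> r0" using r0(2) inner_rot[of e "r0 - p"] by (auto simp: \<rho>_def inner_diff_right)
  have onl: "\<rho> \<bullet> m = \<rho> \<bullet> p" if "m \<in> max_terms f x" for m
  proof -
    have "det2 e (m - p) = 0" using col that pq unfolding collinear_det2 e_def by blast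
    then show ?thesis using inner_rot[of e "m - p"] by (auto simp: \<rho>_def inner_diff_right)
  qed
  define R where "R = {r \<in> supp f. \<rho> \<bullet> p < \<rho> \<bullet> r}"
  define val where "val s y = coef f s + s \<bullet> y" for s and y :: "real \<times> real"
  \<comment> \<open>The time at which the term \<open>r\<close>, which grows faster than
    \<open>p\<close> along \<open>\<rho>\<close>, catches up with it. At the least such time all
    former maximal terms are still maximal, and a term off their line has joined them.\<close>
  define \<tau> where "\<tau> r = (val p x - val r x) / (\<rho> \<bullet> r - \<rho> \<bullet> p)" for r
  have R: "finite R" "R \<noteq> {}" using finite_supp[OF tp] r0(1) r0' unfolding R_def by (simp, blast)
  define t where "t = Min (\<tau> ` R)"
  have tmin: "t \<le> \<tau> r" if "r \<in> R" for r using R that unfolding t_def by simp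
  have "t \<in> \<tau> ` R" using R unfolding t_def by (intro Min_in) auto
  then obtain r1 where r1: "r1 \<in> R" "t = \<tau> r1" by blast
  have pmax: "val s x \<le> val p x" if "s \<in> supp f" for s
    using pq(1) that unfolding max_terms_iff[OF tp] val_def by blast
  have t0: "0 \<le> t" using r1 pmax[of r1] unfolding \<tau>_def R_def by simp
  define y where "y = x + t *\<^sub>R \<rho>"
  have valy: "val s y = val s x + t * (\<rho> \<bullet> s)" for s unfolding val_def y_def by (simp add: inner_add_right inner_commute)
  have py: "val s y \<le> val p y" if s: "s \<in> supp f" for s
  proof (cases "s \<in> R")
    case True
    then have "t * (\<rho> \<bullet> s - \<rho> \<bullet> p) \<le> val p x - val s x"
      using tmin[OF True] unfolding \<tau>_def R_def by (simp add: pos_le_divide_eq)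
    then show ?thesis unfolding valy by (simp add: algebra_simps)
  next
    case False
    then have "\<rho> \<bullet> s \<le> \<rho> \<bullet> p" using s unfolding R_def by auto
    then have "t * (\<rho> \<bullet> s) \<le> t * (\<rho> \<bullet> p)" using t0 by (rule mult_left_mono)
    then show ?thesis unfolding valy using pmax[OF s] by simp
  qed
  have maxI: "s \<in> max_terms f y" if "s \<in> supp f" "val s y = val p y" for s
    using py that unfolding max_terms_iff[OF tp] val_def by metis
  have "val r1 y = val p y"
  proof -
    have "\<rho> \<bullet> r1 - \<rho> \<bullet> p \<noteq> 0" using r1(1) unfolding R_def by auto
    then have "t * (\<rho> \<bullet> r1 - \<rho> \<bullet> p) = val p x - val r1 x" unfolding r1(2) \<tau>_def by simp
    then show ?thesis unfolding valy by (simp add: algebra_simps)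
  qed
  then have r1y: "r1 \<in> max_terms f y" using maxI r1(1) unfolding R_def by blast
  have sub: "max_terms f x \<subseteq> max_terms f y"
  proof
    fix m assume m: "m \<in> max_terms f x"
    then have "val m x = val p x" using max_terms_eqI[OF m pq(1)] unfolding val_def by simp
    then have "val m y = val p y" using onl[OF m] unfolding valy by simp
    then show "m \<in> max_terms f y" using maxI m max_terms_subset by blast
  qed
  have "det2 e (r1 - p) \<noteq> 0" using r1(1) inner_rot[of e "r1 - p"] unfolding R_def \<rho>_def
    by (auto simp: inner_diff_right split: if_splits)
  then have "\<not> collinear (max_terms f y)" unfolding collinear_det2 e_def using sub pq r1y by blast
  then have uni: "unimod_triangle (max_terms f y) \<or> unimod_parallelogram (max_terms f y)"
    using nodal_cells[OF nod] by blast
  have "max_terms f x = {p, q}"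
  proof (rule ccontr)
    assume "max_terms f x \<noteq> {p, q}"
    then obtain m where m: "m \<in> max_terms f x" "m \<noteq> p" "m \<noteq> q" using pq by blast
    then have "det2 (q - p) (m - p) \<noteq> 0" using unimod_three[OF uni, of p q m] sub pq by blast
    then show False using col m pq unfolding collinear_det2 by blast
  qed
  moreover have "\<exists>z\<in>\<int> \<times> \<int>. \<bar>det2 (q - p) z\<bar> = 1"
    using unimod_primitive[OF uni max_terms_int[OF tp], of p q] sub pq by blast
  ultimately show ?thesis using pq(3) by blast
qed

lemma curve_cases:
  assumes nod: "nodal_tropical_curve f" and x: "x \<in> tropical_curve f"
  obtains "x \<in> curve_vertices f" | "x \<in> nodes f" |
    p q z where "max_terms f x = {p, q}" "p \<noteq> q" "z \<in> \<int> \<times> \<int>" "\<bar>det2 (q - p) z\<bar> = 1"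
proof (cases "collinear (max_terms f x)")
  case True
  then show ?thesis using max_terms_edge[OF nod _ True] x that(3) unfolding tropical_curve_def by blast
next
  case False
  then show ?thesis using nodal_cells[OF nod False] that(1,2) curve_vertices_iff[OF nod] nodes_iff[OF nod] by blast
qed

text \<open>\<open>s\<close> is twice the centre of the dual segment or parallelogram.\<close>

lemma curve_symmetric:
  assumes nod: "nodal_tropical_curve f" and x: "x \<in> tropical_curve f" "x \<notin> curve_vertices f"
  shows "\<exists>s. \<forall>p\<in>max_terms f x. s - p \<in> max_terms f x"
  using nod x(1)
proof (cases rule: curve_cases)
  case 2
  then obtain a u v where "max_terms f x = {a, a + u, a + v, a + u + v}"
    using nodes_iff[OF nod] unfolding unimod_parallelogram_def by blast
  then show ?thesis by (intro exI[of _ "a + (a + u + v)"]) auto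
next
  case (3 p q)
  then show ?thesis by (intro exI[of _ "p + q"]) auto
qed (use x in simp)

text \<open>Three terms with affinely independent exponents tie at no more than one point.\<close>

lemma vertex_unique:
  assumes tp: "is_trop_poly f" and "\<not> collinear (max_terms f x \<inter> max_terms f y)"
  shows "x = y"
proof -
  obtain a b c where abc: "a \<in> max_terms f x \<inter> max_terms f y" "b \<in> max_terms f x \<inter> max_terms f y"
    "c \<in> max_terms f x \<inter> max_terms f y" "det2 (b - a) (c - a) \<noteq> 0"
    using assms(2) unfolding collinear_det2 by blast
  have 0: "(b - a) \<bullet> (y - x) = 0" "(c - a) \<bullet> (y - x) = 0" using max_terms_common abc by blast+
  have nz: "b - a \<noteq> 0" using abc(4) by auto
  obtain k where k: "y - x = k *\<^sub>R rot (b - a)" using inner_0_imp_scaleR_rot[OF 0(1) nz] by blast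
  have "k * det2 (b - a) (c - a) = 0" using 0(2) unfolding k by (simp add: inner_commute[of "c - a"] inner_rot)
  then have "y - x = 0" using abc(4) k by simp
  then show ?thesis by simp
qed

lemma finite_vertices_nodes:
  assumes nod: "nodal_tropical_curve f"
  shows "finite (curve_vertices f)" "finite (nodes f)"
proof -
  have tp: "is_trop_poly f" using nodal_trop[OF nod] .
  have fin: "finite (Pow (supp f))" using finite_supp[OF tp] by simp
  let ?A = "{x. \<not> collinear (max_terms f x)}"
  have "inj_on (max_terms f) ?A" by (rule inj_onI) (metis Int_absorb mem_Collect_eq vertex_unique[OF tp])
  moreover have "max_terms f ` ?A \<subseteq> Pow (supp f)" using max_terms_subset by blast
  ultimately have A: "finite ?A" using fin by (metis finite_imageD finite_subset)
  show "finite (curve_vertices f)" "finite (nodes f)"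
    using unimod_not_collinear curve_vertices_iff[OF nod] nodes_iff[OF nod]
    by (intro finite_subset[OF _ A]; blast)+
qed

text \<open>For a triangle \<open>A\<close>, this is the direction of the strand dual to the side
  opposite to the corner \<open>c\<close>: perpendicular to that side and pointing away from
  \<open>c\<close>. The three strands at a vertex are thus named by corners, and \<open>d\<close> is
  determined only up to a positive factor.\<close>

definition exit_dir :: "(real \<times> real) set \<Rightarrow> real \<times> real \<Rightarrow> real \<times> real \<Rightarrow> bool" where
  "exit_dir A c d \<longleftrightarrow> c \<in> A \<and> (\<exists>k>c \<bullet> d. \<forall>a\<in>A - {c}. a \<bullet> d = k)"

lemma triangle_at:
  assumes "unimod_triangle A" "c \<in> A"
  obtains a b where "A = {a, b, c}" "\<bar>det2 (b - a) (c - a)\<bar> = 1" "a \<noteq> b" "a \<noteq> c" "b \<noteq> c"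
proof -
  obtain x u v where A: "A = {x, x + u, x + v}" and D: "\<bar>det2 u v\<bar> = 1"
    using assms(1) unfolding unimod_triangle_def by blast
  have D': "\<bar>det2 v u\<bar> = 1" using D by (simp add: det2_swap[of v u])
  have "\<exists>a b. A = {a, b, c} \<and> \<bar>det2 (b - a) (c - a)\<bar> = 1"
  proof -
    consider "c = x" | "c = x + u" | "c = x + v" using assms(2) A by blast
    then show ?thesis
    proof cases
      case 1
      have "A = {x + u, x + v, c} \<and> \<bar>det2 (x + v - (x + u)) (c - (x + u))\<bar> = 1"
        using A D 1 by (auto simp: det2_def algebra_simps)
      then show ?thesis by blast
    next
      case 2
      have "A = {x, x + v, c} \<and> \<bar>det2 (x + v - x) (c - x)\<bar> = 1" using A D' 2 by auto
      then show ?thesis by blast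
    next
      case 3
      have "A = {x, x + u, c} \<and> \<bar>det2 (x + u - x) (c - x)\<bar> = 1" using A D 3 by auto
      then show ?thesis by blast
    qed
  qed
  then obtain a b where ab: "A = {a, b, c}" "\<bar>det2 (b - a) (c - a)\<bar> = 1" by blast
  have "card A = 3" using card_unimod assms(1) by blast
  then have "a \<noteq> b" "a \<noteq> c" "b \<noteq> c" using ab(1) by (auto simp: card_insert_if split: if_splits)
  then show ?thesis using that ab by blast
qed

lemma exit_dir_3:
  assumes "a \<noteq> c" "b \<noteq> c"
  shows "exit_dir {a, b, c} c d \<longleftrightarrow> a \<bullet> d = b \<bullet> d \<and> c \<bullet> d < a \<bullet> d"
proof -
  have "{a, b, c} - {c} = {a, b}" using assms by auto
  then have "exit_dir {a, b, c} c d \<longleftrightarrow> (\<exists>k>c \<bullet> d. \<forall>x\<in>{a, b}. x \<bullet> d = k)"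
    unfolding exit_dir_def by simp
  also have "\<dots> \<longleftrightarrow> a \<bullet> d = b \<bullet> d \<and> c \<bullet> d < a \<bullet> d" by force
  finally show ?thesis .
qed

lemma exit_dir_exists:
  assumes "unimod_triangle A" "c \<in> A" "A \<subseteq> \<int> \<times> \<int>"
  shows "\<exists>d\<in>\<int> \<times> \<int>. exit_dir A c d"
proof -
  obtain a b where A: "A = {a, b, c}" "\<bar>det2 (b - a) (c - a)\<bar> = 1" "a \<noteq> b" "a \<noteq> c" "b \<noteq> c"
    using triangle_at[OF assms(1,2)] .
  define d where "d = (if det2 (b - a) (c - a) < 0 then rot (b - a) else - rot (b - a))"
  have "(b - a) \<bullet> d = 0" "(c - a) \<bullet> d < 0"
    using A(2) inner_rot[of "b - a" "b - a"] inner_rot[of "b - a" "c - a"]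
    by (auto simp: d_def inner_commute)
  then have "exit_dir A c d" unfolding A(1) exit_dir_3[OF A(4,5)] by (simp add: inner_diff_left)
  moreover have "b - a \<in> \<int> \<times> \<int>" using int_pair_simps(2)[of b a] A(1) assms(3) by blast
  then have "d \<in> \<int> \<times> \<int>" unfolding d_def by (simp add: int_pair_simps)
  ultimately show ?thesis by blast
qed

lemma exit_dir_unique:
  assumes "unimod_triangle A" "exit_dir A c d" "exit_dir A c d'"
  shows "\<exists>k>0. d' = k *\<^sub>R d"
proof -
  have c: "c \<in> A" using assms(2) unfolding exit_dir_def by blast
  obtain a b where A: "A = {a, b, c}" "\<bar>det2 (b - a) (c - a)\<bar> = 1" "a \<noteq> b" "a \<noteq> c" "b \<noteq> c"
    using triangle_at[OF assms(1) c] .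
  have d: "(b - a) \<bullet> d = 0" "(c - a) \<bullet> d < 0" "(b - a) \<bullet> d' = 0" "(c - a) \<bullet> d' < 0"
    using assms(2,3) unfolding A(1) exit_dir_3[OF A(4,5)] by (simp_all add: inner_diff_left)
  have ba: "b - a \<noteq> 0" using A(3) by simp
  obtain i j where ij: "d = i *\<^sub>R rot (b - a)" "d' = j *\<^sub>R rot (b - a)"
    using inner_0_imp_scaleR_rot[OF d(1) ba] inner_0_imp_scaleR_rot[OF d(3) ba] by blast
  define D where "D = det2 (b - a) (c - a)"
  have "i * D < 0" "j * D < 0" using d(2,4) unfolding ij D_def by (simp_all add: inner_commute[of "c - a"] inner_rot)
  then have "j / i > 0" "i \<noteq> 0" by (auto simp: mult_less_0_iff zero_less_divide_iff)
  moreover have "d' = (j / i) *\<^sub>R d" unfolding ij using \<open>i \<noteq> 0\<close> by simp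
  ultimately show ?thesis by blast
qed

lemma exit_dir_nonzero:
  assumes "unimod_triangle A" "exit_dir A c d"
  shows "d \<noteq> 0"
proof -
  have c: "c \<in> A" using assms(2) unfolding exit_dir_def by blast
  obtain a b where A: "A = {a, b, c}" "a \<noteq> c" "b \<noteq> c" using triangle_at[OF assms(1) c] by metis
  then show ?thesis using assms(2) unfolding A(1) exit_dir_3[OF A(2,3)] by auto
qed

lemma exit_dir_scale:
  assumes "exit_dir A c d" "k > 0"
  shows "exit_dir A c (k *\<^sub>R d)"
proof -
  obtain m where "c \<in> A" "c \<bullet> d < m" "\<forall>a\<in>A - {c}. a \<bullet> d = m" using assms(1) unfolding exit_dir_def by blast
  then have "c \<in> A \<and> c \<bullet> (k *\<^sub>R d) < k * m \<and> (\<forall>a\<in>A - {c}. a \<bullet> (k *\<^sub>R d) = k * m)" using assms(2) by simp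
  then show ?thesis unfolding exit_dir_def by blast
qed

lemma exit_dir_argmax:
  assumes "exit_dir A c d" "A - {c} \<noteq> {}"
  shows "argmax d A = A - {c}"
proof (intro set_eqI iffI)
  obtain m where m: "c \<bullet> d < m" "\<And>a. a \<in> A - {c} \<Longrightarrow> a \<bullet> d = m" using assms(1) unfolding exit_dir_def by blast
  fix p
  show "p \<in> A - {c}" if p: "p \<in> argmax d A"
  proof -
    obtain a where "a \<in> A - {c}" using assms(2) by blast
    then have "m \<le> p \<bullet> d" using p m(2)[of a] unfolding argmax_def by force
    then show ?thesis using m(1) p unfolding argmax_def by auto
  qed
  show "p \<in> argmax d A" if p: "p \<in> A - {c}"
  proof -
    have "q \<bullet> d \<le> p \<bullet> d" if "q \<in> A" for q
      using m(1) m(2)[OF p] m(2)[of q] that by (cases "q = c") simp_all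
    then show ?thesis using p unfolding argmax_def by blast
  qed
qed

lemma exit_dir_inj:
  assumes "exit_dir A c d" "exit_dir A c' d"
  shows "c = c'"
proof (rule ccontr)
  assume ne: "c \<noteq> c'"
  obtain m m' where "c \<bullet> d < m" "c' \<bullet> d = m" "c' \<bullet> d < m'" "c \<bullet> d = m'"
    using assms ne unfolding exit_dir_def by blast
  then show False by simp
qed

text \<open>If all three corners tied along \<open>d\<close>, then \<open>d\<close> would be
  orthogonal to two independent sides and hence zero. So the third corner lies strictly lower than
  the two that tie.\<close>

lemma exit_dir_of_argmax:
  assumes "unimod_triangle A" "d \<noteq> 0" "2 \<le> card (argmax d A)"
  shows "\<exists>c. exit_dir A c d"
proof -
  have fin: "finite A" using card_unimod(1)[OF assms(1)] by (metis card.infinite zero_neq_numeral)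
  obtain p q where pq: "p \<in> argmax d A" "q \<in> argmax d A" "p \<noteq> q" using two_distinct[OF assms(3)] by blast
  then have A: "p \<in> A" "q \<in> A" and eq: "p \<bullet> d = q \<bullet> d" and le: "\<And>r. r \<in> A \<Longrightarrow> r \<bullet> d \<le> p \<bullet> d"
    unfolding argmax_def by (auto intro: antisym)
  have "card (A - {p, q}) = 1" using card_unimod(1)[OF assms(1)] A pq(3) fin by (simp add: card_Diff_subset)
  then obtain c where c: "A - {p, q} = {c}" by (metis card_1_singletonE)
  then have Ac: "A = {p, q, c}" "p \<noteq> c" "q \<noteq> c" using A by auto
  have "c \<bullet> d \<noteq> p \<bullet> d"
  proof
    assume "c \<bullet> d = p \<bullet> d"
    then have 0: "(q - p) \<bullet> d = 0" "(c - p) \<bullet> d = 0" using eq by (simp_all add: inner_diff_left)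
    have "det2 (q - p) (c - p) *\<^sub>R d = 0"
    proof -
      obtain k where k: "d = k *\<^sub>R rot (q - p)" using inner_0_imp_scaleR_rot[OF 0(1)] pq(3) by auto
      have "k * det2 (q - p) (c - p) = 0" using 0(2) unfolding k by (simp add: inner_commute[of "c - p"] inner_rot)
      then show ?thesis using k by auto
    qed
    moreover have "det2 (q - p) (c - p) \<noteq> 0" using unimod_three[of A p q c] assms(1) Ac pq(3) by blast
    ultimately show False using assms(2) by simp
  qed
  then have "c \<bullet> d < p \<bullet> d" using le[of c] Ac(1) by force
  then show ?thesis using exit_dir_3[OF Ac(2,3)] eq Ac(1) by metis
qed

section \<open>Strands, edges and rays\<close>

text \<open>The reflection \<open>p \<mapsto> s - p\<close> maps the face maximal for
  \<open>- d\<close> into the face maximal for \<open>d\<close>.\<close>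

lemma card_argmax_uminus:
  assumes "finite A" "\<forall>p\<in>A. s - p \<in> A"
  shows "card (argmax (- d) A) \<le> card (argmax d A)"
proof (rule card_inj_on_le)
  show "inj_on (\<lambda>p. s - p) (argmax (- d) A)" by (simp add: inj_on_def)
  show "(\<lambda>p. s - p) ` argmax (- d) A \<subseteq> argmax d A"
  proof (rule image_subsetI)
    fix p assume p: "p \<in> argmax (- d) A"
    have "q \<bullet> d \<le> (s - p) \<bullet> d" if "q \<in> A" for q
    proof -
      have "s - q \<in> A" using assms(2) that by blast
      then have "(s - q) \<bullet> (- d) \<le> p \<bullet> (- d)" using p unfolding argmax_def by blast
      then show ?thesis by (simp add: inner_diff_left)
    qed
    then show "s - p \<in> argmax d A" using p assms(2) unfolding argmax_def by blast
  qed
  show "finite (argmax d A)" using assms(1) unfolding argmax_def by simp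
qed

lemma argmax_subset: "argmax d A \<subseteq> A"
  unfolding argmax_def by blast

lemma triangle_minus_point:
  assumes "unimod_triangle A" "c \<in> A"
  shows "card (A - {c}) = 2" "finite A" "A - {c} \<noteq> {}"
proof -
  have 3: "card A = 3" using card_unimod(1)[OF assms(1)] .
  then show "finite A" by (metis card.infinite zero_neq_numeral)
  then show 2: "card (A - {c}) = 2" using 3 assms(2) by simp
  show "A - {c} \<noteq> {}" using 2 by (metis card.empty zero_neq_numeral)
qed

text \<open>A strand cannot end in an edge or in a node, because there the dual cell is centrally symmetric:
  if the side of the cell facing backwards is an edge, then so is the side facing forwards.\<close>

lemma strand_continues:
  assumes nod: "nodal_tropical_curve f" and v: "v \<in> curve_vertices f" and d: "exit_dir (max_terms f v) c d"
    and t: "0 < t" and free: "\<And>s. 0 < s \<Longrightarrow> s \<le> t \<Longrightarrow> v + s *\<^sub>R d \<notin> curve_vertices f"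
  shows "v + t *\<^sub>R d \<in> tropical_curve f"
proof (rule ccontr)
  assume notin: "v + t *\<^sub>R d \<notin> tropical_curve f"
  have tp: "is_trop_poly f" using nodal_trop[OF nod] .
  let ?M = "\<lambda>s. max_terms f (v + s *\<^sub>R d)"
  \<comment> \<open>A continuity argument: let \<open>m\<close> be the infimum of the times off the
    curve. The face facing backwards at \<open>m\<close> has two terms if \<open>m > 0\<close>, and
    by symmetry so has the face facing forwards; at \<open>m = 0\<close> the triangle provides a
    side. Hence the curve continues past \<open>m\<close>, and no bad time lies near
    \<open>m\<close>.\<close>
  define Bad where "Bad = {s. 0 < s \<and> s \<le> t \<and> card (?M s) < 2}"
  have tB: "t \<in> Bad" using notin t unfolding Bad_def tropical_curve_def by simp
  define m where "m = Inf Bad"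
  have bdd: "bdd_below Bad" unfolding Bad_def by (rule bdd_belowI[of _ 0]) simp
  have m0: "0 \<le> m" unfolding m_def using tB by (intro cInf_greatest) (auto simp: Bad_def)
  have mt: "m \<le> t" unfolding m_def by (rule cInf_lower[OF tB bdd])
  have good: "2 \<le> card (?M s)" if "0 < s" "s < m" for s
  proof -
    have "s \<notin> Bad" using that(2) cInf_lower[OF _ bdd, of s] unfolding m_def by fastforce
    then show ?thesis using that mt unfolding Bad_def by auto
  qed
  have right: "eventually (\<lambda>s. ?M (m + s) = argmax d (?M m)) (at_right 0)"
    using max_terms_near[OF tp, of "v + m *\<^sub>R d" d] by (simp add: scaleR_add_left add.assoc)
  have fwd: "2 \<le> card (argmax d (?M m)) \<and> (0 < m \<longrightarrow> 2 \<le> card (?M m))"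
  proof (cases "m = 0")
    case True
    have tri: "unimod_triangle (max_terms f v)" using v curve_vertices_iff[OF nod] by blast
    have c: "c \<in> max_terms f v" using d unfolding exit_dir_def by blast
    show ?thesis using exit_dir_argmax[OF d triangle_minus_point(3)[OF tri c]] triangle_minus_point(1)[OF tri c] True by simp
  next
    case False
    then have m: "0 < m" using m0 by simp
    have "eventually (\<lambda>s. max_terms f ((v + m *\<^sub>R d) + s *\<^sub>R (- d)) = argmax (- d) (?M m)) (at_right 0)"
      by (rule max_terms_near[OF tp])
    moreover have "eventually (\<lambda>s. s \<in> {0<..<m}) (at_right 0)" by (rule eventually_at_right_real[OF m])
    ultimately have "eventually (\<lambda>s. max_terms f ((v + m *\<^sub>R d) + s *\<^sub>R (- d)) = argmax (- d) (?M m) \<and> s \<in> {0<..<m}) (at_right 0)"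
      by (rule eventually_conj)
    then obtain s where s: "max_terms f ((v + m *\<^sub>R d) + s *\<^sub>R (- d)) = argmax (- d) (?M m)" "0 < s" "s < m"
      using eventually_happens[of _ "at_right (0::real)"] by auto
    have "(v + m *\<^sub>R d) + s *\<^sub>R (- d) = v + (m - s) *\<^sub>R d" by (simp add: algebra_simps)
    then have "?M (m - s) = argmax (- d) (?M m)" using s(1) by (simp only:)
    then have 2: "2 \<le> card (argmax (- d) (?M m))" using good[of "m - s"] s(2,3) by simp
    also have "\<dots> \<le> card (?M m)" by (rule card_mono[OF finite_max_terms[OF tp] argmax_subset])
    finally have 3: "2 \<le> card (?M m)" .
    then have "v + m *\<^sub>R d \<in> tropical_curve f" unfolding tropical_curve_def by simp
    moreover have "v + m *\<^sub>R d \<notin> curve_vertices f" using free m mt by blast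
    ultimately obtain s where "\<forall>p\<in>?M m. s - p \<in> ?M m" using curve_symmetric[OF nod] by blast
    then have "card (argmax (- d) (?M m)) \<le> card (argmax d (?M m))"
      by (rule card_argmax_uminus[OF finite_max_terms[OF tp]])
    with 2 3 show ?thesis by simp
  qed
  from right obtain b where b: "0 < b" "\<And>s. 0 < s \<Longrightarrow> s < b \<Longrightarrow> ?M (m + s) = argmax d (?M m)"
    unfolding eventually_at_right_field by blast
  have "m + b \<le> s" if s: "s \<in> Bad" for s
  proof (rule ccontr)
    assume "\<not> m + b \<le> s"
    moreover have "m \<le> s" unfolding m_def by (rule cInf_lower[OF s bdd])
    moreover have "m \<noteq> s" using fwd s unfolding Bad_def by auto
    ultimately have "?M s = argmax d (?M m)" using b(2)[of "s - m"] by simp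
    then show False using fwd s unfolding Bad_def by simp
  qed
  then have "m + b \<le> m" unfolding m_def using tB by (intro cInf_greatest) auto
  then show False using b(1) by simp
qed

section \<open>Edges of the bounded part\<close>

lemma bounded_part_simps [simp]:
  "verts (bounded_part f) = curve_vertices f" "ends (bounded_part f) = mset_set"
  by (simp_all add: bounded_part_def)

lemma edges_bounded_part:
  "e \<in> edges (bounded_part f) \<longleftrightarrow> (\<exists>v w. e = {v, w} \<and> v \<in> curve_vertices f \<and> w \<in> curve_vertices f \<and> v \<noteq> w \<and>
     open_segment v w \<subseteq> tropical_curve f - curve_vertices f)"
  by (simp add: bounded_part_def)

lemma edge_pair:
  "{v, w} \<in> edges (bounded_part f) \<longleftrightarrow> v \<in> curve_vertices f \<and> w \<in> curve_vertices f \<and> v \<noteq> w \<and>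
     open_segment v w \<subseteq> tropical_curve f - curve_vertices f"
  unfolding edges_bounded_part by (metis doubleton_eq_iff open_segment_commute)

lemma edge_at:
  assumes "e \<in> edges (bounded_part f)" "v \<in> e"
  obtains w where "e = {v, w}" "v \<noteq> w"
  using assms unfolding edges_bounded_part by blast

lemma open_segment_iff:
  fixes v :: "real \<times> real"
  assumes "d \<noteq> 0" "t > 0"
  shows "z \<in> open_segment v (v + t *\<^sub>R d) \<longleftrightarrow> (\<exists>s. 0 < s \<and> s < t \<and> z = v + s *\<^sub>R d)"
proof
  assume "z \<in> open_segment v (v + t *\<^sub>R d)"
  then obtain u where u: "0 < u" "u < 1" "z = (1 - u) *\<^sub>R v + u *\<^sub>R (v + t *\<^sub>R d)" by (auto simp: in_segment)
  then have "z = v + (u * t) *\<^sub>R d" by (simp add: algebra_simps)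
  then show "\<exists>s. 0 < s \<and> s < t \<and> z = v + s *\<^sub>R d" using u assms(2) by (intro exI[of _ "u * t"]) simp
next
  assume "\<exists>s. 0 < s \<and> s < t \<and> z = v + s *\<^sub>R d"
  then obtain s where s: "0 < s" "s < t" "z = v + s *\<^sub>R d" by blast
  then have "z = (1 - s / t) *\<^sub>R v + (s / t) *\<^sub>R (v + t *\<^sub>R d)" "0 < s / t" "s / t < 1"
    using assms(2) by (simp_all add: algebra_simps)
  moreover have "v \<noteq> v + t *\<^sub>R d" using assms by simp
  ultimately show "z \<in> open_segment v (v + t *\<^sub>R d)" unfolding in_segment by blast
qed

text \<open>There are only finitely many vertices, so a strand that meets any has a first one, and
  the part before it is an edge.\<close>

lemma strand_cases:
  assumes nod: "nodal_tropical_curve f" and v: "v \<in> curve_vertices f" and d: "exit_dir (max_terms f v) c d"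
  shows "(\<forall>t>0. v + t *\<^sub>R d \<in> tropical_curve f - curve_vertices f) \<or>
    (\<exists>t>0. {v, v + t *\<^sub>R d} \<in> edges (bounded_part f))"
proof (cases "\<exists>t>0. v + t *\<^sub>R d \<in> curve_vertices f")
  case False
  then show ?thesis using strand_continues[OF nod v d] by blast
next
  case True
  have d0: "d \<noteq> 0" using exit_dir_nonzero d v curve_vertices_iff[OF nod] by blast
  define H where "H = {t. 0 < t \<and> v + t *\<^sub>R d \<in> curve_vertices f}"
  have "finite ((\<lambda>t. v + t *\<^sub>R d) ` H)"
    by (rule finite_subset[OF _ finite_vertices_nodes(1)[OF nod]]) (auto simp: H_def)
  moreover have "inj_on (\<lambda>t. v + t *\<^sub>R d) H" using d0 by (auto simp: inj_on_def)
  ultimately have fin: "finite H" by (rule finite_imageD)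
  have ne: "H \<noteq> {}" using True unfolding H_def by blast
  define t where "t = Min H"
  have "t \<in> H" unfolding t_def using fin ne by (rule Min_in)
  then have t: "0 < t" "v + t *\<^sub>R d \<in> curve_vertices f" unfolding H_def by auto
  have free: "v + s *\<^sub>R d \<notin> curve_vertices f" if "0 < s" "s < t" for s
  proof
    assume "v + s *\<^sub>R d \<in> curve_vertices f"
    then have "t \<le> s" unfolding t_def using fin that by (intro Min_le) (auto simp: H_def)
    then show False using that by simp
  qed
  have "open_segment v (v + t *\<^sub>R d) \<subseteq> tropical_curve f - curve_vertices f"
  proof
    fix z assume "z \<in> open_segment v (v + t *\<^sub>R d)"
    then obtain s where s: "0 < s" "s < t" "z = v + s *\<^sub>R d" unfolding open_segment_iff[OF d0 t(1)] by blast
    have "v + s *\<^sub>R d \<in> tropical_curve f"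
      by (rule strand_continues[OF nod v d s(1)]) (use free s in auto)
    then show "z \<in> tropical_curve f - curve_vertices f" using free s by blast
  qed
  then have "{v, v + t *\<^sub>R d} \<in> edges (bounded_part f)" unfolding edge_pair using v t d0 by simp
  then show ?thesis using t(1) by blast
qed

text \<open>Points of the edge close to \<open>v\<close> have two maximal terms, so the face of the
  triangle at \<open>v\<close> that is maximal along \<open>w - v\<close> is a side.\<close>

lemma edge_exit_dir:
  assumes nod: "nodal_tropical_curve f" and e: "{v, w} \<in> edges (bounded_part f)"
  shows "\<exists>c. exit_dir (max_terms f v) c (w - v)"
proof -
  have tp: "is_trop_poly f" using nodal_trop[OF nod] .
  have vw: "v \<in> curve_vertices f" "v \<noteq> w" "open_segment v w \<subseteq> tropical_curve f"
    using e unfolding edge_pair by blast+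
  have "eventually (\<lambda>s. max_terms f (v + s *\<^sub>R (w - v)) = argmax (w - v) (max_terms f v) \<and> s \<in> {0<..<1}) (at_right 0)"
    by (intro eventually_conj max_terms_near[OF tp] eventually_at_right_real) simp
  then obtain s where s: "max_terms f (v + s *\<^sub>R (w - v)) = argmax (w - v) (max_terms f v)" "0 < s" "s < 1"
    using eventually_happens[of _ "at_right (0::real)"] by auto
  have "v + s *\<^sub>R (w - v) \<in> open_segment v (v + 1 *\<^sub>R (w - v))"
    using open_segment_iff[of "w - v" 1 "v + s *\<^sub>R (w - v)" v] vw(2) s(2,3) by auto
  then have "v + s *\<^sub>R (w - v) \<in> tropical_curve f" using vw(3) by auto
  then have "2 \<le> card (max_terms f (v + s *\<^sub>R (w - v)))" unfolding tropical_curve_def by blast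
  then have "2 \<le> card (argmax (w - v) (max_terms f v))" unfolding s(1) .
  then show ?thesis using exit_dir_of_argmax[of "max_terms f v" "w - v"] vw curve_vertices_iff[OF nod] by auto
qed

lemma edge_unique_aux:
  assumes e: "{v, w} \<in> edges (bounded_part f)" "{v, w'} \<in> edges (bounded_part f)"
    and k: "w' - v = k *\<^sub>R (w - v)" "0 < k" "k < 1"
  shows False
proof -
  have "w' = v + k *\<^sub>R (w - v)" using k(1) by (simp add: algebra_simps)
  then have "w' \<in> open_segment v (v + 1 *\<^sub>R (w - v))"
    using open_segment_iff[of "w - v" 1 w' v] e k(2,3) unfolding edge_pair by auto
  then show False using e unfolding edge_pair by auto
qed

lemma edge_unique:
  assumes nod: "nodal_tropical_curve f"
    and e: "{v, w} \<in> edges (bounded_part f)" "{v, w'} \<in> edges (bounded_part f)"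
    and c: "exit_dir (max_terms f v) c (w - v)" "exit_dir (max_terms f v) c (w' - v)"
  shows "w = w'"
proof -
  have tri: "unimod_triangle (max_terms f v)" using e(1) curve_vertices_iff[OF nod] unfolding edge_pair by blast
  obtain k where k: "0 < k" "w' - v = k *\<^sub>R (w - v)" using exit_dir_unique[OF tri c] by blast
  have "\<not> k < 1" using edge_unique_aux[OF e k(2,1)] by blast
  moreover have "\<not> 1 < k"
  proof
    assume "1 < k"
    moreover have "w - v = (1 / k) *\<^sub>R (w' - v)" unfolding k(2) using k(1) by simp
    ultimately show False using edge_unique_aux[OF e(2,1), of "1 / k"] by simp
  qed
  ultimately have "k = 1" by simp
  then show ?thesis using k(2) by simp
qed

lemma finite_mgraph_bounded_part:
  assumes nod: "nodal_tropical_curve f"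
  shows "finite_mgraph (bounded_part f)"
proof -
  have fin: "finite (curve_vertices f)" using finite_vertices_nodes(1)[OF nod] .
  have "edges (bounded_part f) \<subseteq> Pow (curve_vertices f)" unfolding bounded_part_def by auto
  then have "finite (edges (bounded_part f))" using fin by (meson finite_Pow_iff finite_subset)
  moreover have "size (mset_set e) = 2 \<and> set_mset (mset_set e) \<subseteq> curve_vertices f" if "e \<in> edges (bounded_part f)" for e
    using that unfolding edges_bounded_part by auto
  ultimately show ?thesis unfolding finite_mgraph_def using fin by simp
qed

lemma mg_degree_bounded_part:
  assumes nod: "nodal_tropical_curve f"
  shows "mg_degree (bounded_part f) v = card {e \<in> edges (bounded_part f). v \<in> e}"
proof -
  have fin: "finite (edges (bounded_part f))"
    using finite_mgraph_bounded_part[OF nod] unfolding finite_mgraph_def by blast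
  have "count (mset_set e) v = (if v \<in> e then 1 else 0)" if "e \<in> edges (bounded_part f)" for e
    using that unfolding edges_bounded_part by (auto simp: count_mset_set')
  then have "mg_degree (bounded_part f) v = (\<Sum>e\<in>edges (bounded_part f). if v \<in> e then 1 else 0)"
    unfolding mg_degree_def by simp
  also have "\<dots> = card {e \<in> edges (bounded_part f). v \<in> e}"
    using fin by (simp add: sum.If_cases Int_def)
  finally show ?thesis .
qed

lemma mg_degree_bounded_part_le:
  assumes nod: "nodal_tropical_curve f" and v: "v \<in> curve_vertices f"
  shows "mg_degree (bounded_part f) v \<le> 3"
proof -
  let ?E = "{e \<in> edges (bounded_part f). v \<in> e}"
  have "\<exists>c w. e = {v, w} \<and> exit_dir (max_terms f v) c (w - v)" if "e \<in> ?E" for e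
    using that edge_at[of e f v] edge_exit_dir[OF nod, of v] by (metis (lifting) mem_Collect_eq)
  then obtain c w where cw: "\<And>e. e \<in> ?E \<Longrightarrow> e = {v, w e} \<and> exit_dir (max_terms f v) (c e) (w e - v)" by metis
  have "inj_on c ?E"
  proof (rule inj_onI)
    fix e e' assume e: "e \<in> ?E" "e' \<in> ?E" "c e = c e'"
    have "w e = w e'"
      by (rule edge_unique[OF nod, of v _ _ "c e"]) (use cw[OF e(1)] cw[OF e(2)] e in auto)
    then show "e = e'" using cw e by metis
  qed
  moreover have "c ` ?E \<subseteq> max_terms f v" using cw unfolding exit_dir_def by blast
  moreover have "card (max_terms f v) = 3" using card_unimod(1) v curve_vertices_iff[OF nod] by blast
  ultimately show ?thesis
    unfolding mg_degree_bounded_part[OF nod] using card_inj_on_le finite_max_terms[OF nodal_trop[OF nod]] by metis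
qed

text \<open>A ray is recorded by its vertex and the corner opposite to its dual side. Quantifying
  over all directions avoids the choice of a representative.\<close>

definition rays :: "trop_poly \<Rightarrow> ((real \<times> real) \<times> (real \<times> real)) set" where
  "rays f = {(v, c). v \<in> curve_vertices f \<and> c \<in> max_terms f v \<and>
     (\<forall>d. exit_dir (max_terms f v) c d \<longrightarrow> (\<forall>t>0. v + t *\<^sub>R d \<in> tropical_curve f - curve_vertices f))}"

lemma ray_or_edge:
  assumes nod: "nodal_tropical_curve f" and v: "v \<in> curve_vertices f" "c \<in> max_terms f v"
  shows "(v, c) \<in> rays f \<or> (\<exists>w. {v, w} \<in> edges (bounded_part f) \<and> exit_dir (max_terms f v) c (w - v))"
proof (cases "(v, c) \<in> rays f")
  case False
  then obtain d where d: "exit_dir (max_terms f v) c d" "\<not> (\<forall>t>0. v + t *\<^sub>R d \<in> tropical_curve f - curve_vertices f)"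
    using v unfolding rays_def by blast
  then obtain t where t: "t > 0" "{v, v + t *\<^sub>R d} \<in> edges (bounded_part f)" using strand_cases[OF nod v(1) d(1)] by blast
  have "exit_dir (max_terms f v) c (v + t *\<^sub>R d - v)" using exit_dir_scale[OF d(1) t(1)] by simp
  then show ?thesis using t(2) by blast
qed simp

lemma finite_rays:
  assumes nod: "nodal_tropical_curve f"
  shows "finite (rays f)"
proof (rule finite_subset)
  show "rays f \<subseteq> curve_vertices f \<times> supp f" using max_terms_subset unfolding rays_def by blast
  show "finite (curve_vertices f \<times> supp f)"
    using finite_vertices_nodes(1)[OF nod] finite_supp[OF nodal_trop[OF nod]] by blast
qed

text \<open>Every vertex has three corners. Those that do not name a ray inject into the incidences
  of vertices with edges, of which there are twice as many as edges.\<close>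

lemma card_rays:
  assumes nod: "nodal_tropical_curve f"
  shows "3 * card (curve_vertices f) \<le> 2 * card (edges (bounded_part f)) + card (rays f)"
proof -
  let ?X = "Sigma (curve_vertices f) (max_terms f)" and ?E = "edges (bounded_part f)"
  let ?Y = "Sigma (curve_vertices f) (\<lambda>v. {e \<in> ?E. v \<in> e})"
  have finV: "finite (curve_vertices f)" using finite_vertices_nodes(1)[OF nod] .
  have finE: "finite ?E" using finite_mgraph_bounded_part[OF nod] unfolding finite_mgraph_def by blast
  have fin: "finite ?X" using finV finite_max_terms[OF nodal_trop[OF nod]] by blast
  have "card (max_terms f v) = 3" if "v \<in> curve_vertices f" for v
    using card_unimod(1) that curve_vertices_iff[OF nod] by blast
  then have X: "card ?X = 3 * card (curve_vertices f)"
    using finV finite_max_terms[OF nodal_trop[OF nod]] by (simp add: card_SigmaI)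
  have "card ?Y = (\<Sum>v\<in>curve_vertices f. mg_degree (bounded_part f) v)"
    unfolding mg_degree_bounded_part[OF nod] using finV finE by (simp add: card_SigmaI)
  also have "\<dots> = 2 * card ?E" using handshake[OF finite_mgraph_bounded_part[OF nod]] by simp
  finally have Y: "card ?Y = 2 * card ?E" .
  have "\<exists>w. {fst r, w} \<in> ?E \<and> exit_dir (max_terms f (fst r)) (snd r) (w - fst r)" if "r \<in> ?X - rays f" for r
    using ray_or_edge[OF nod, of "fst r" "snd r"] that by auto
  then obtain w where w: "\<And>r. r \<in> ?X - rays f \<Longrightarrow> {fst r, w r} \<in> ?E \<and> exit_dir (max_terms f (fst r)) (snd r) (w r - fst r)"
    by metis
  have "card (?X - rays f) \<le> card ?Y"
  proof (rule card_inj_on_le[of "\<lambda>r. (fst r, {fst r, w r})"])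
    show "inj_on (\<lambda>r. (fst r, {fst r, w r})) (?X - rays f)"
    proof (rule inj_onI)
      fix r r' assume r: "r \<in> ?X - rays f" "r' \<in> ?X - rays f" "(fst r, {fst r, w r}) = (fst r', {fst r', w r'})"
      then have "fst r = fst r'" "w r = w r'" by (auto simp: doubleton_eq_iff)
      then have "snd r = snd r'" using w[OF r(1)] w[OF r(2)] exit_dir_inj by metis
      then show "r = r'" using \<open>fst r = fst r'\<close> by (simp add: prod_eq_iff)
    qed
    show "(\<lambda>r. (fst r, {fst r, w r})) ` (?X - rays f) \<subseteq> ?Y"
    proof (rule image_subsetI)
      fix r assume r: "r \<in> ?X - rays f"
      then have "fst r \<in> curve_vertices f" "{fst r, w r} \<in> ?E" using w[OF r] by auto
      then show "(fst r, {fst r, w r}) \<in> ?Y" by blast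
    qed
    show "finite ?Y" using finV finE by simp
  qed
  moreover have "card ?X \<le> card (?X - rays f) + card (rays f)"
    using card_Diff_subset_Int[of ?X "rays f"] fin finite_rays[OF nod] card_mono[of "rays f" "?X \<inter> rays f"] by auto
  ultimately show ?thesis using X Y by linarith
qed

text \<open>This is the balancing condition: suitably scaled, the three outgoing directions sum to
  zero and two of them are independent. They cannot all have nonpositive product with
  \<open>d\<close> unless \<open>d\<close> vanishes.\<close>

lemma exit_dir_positive:
  assumes "unimod_triangle A" "d \<noteq> 0"
  shows "\<exists>c \<rho>. exit_dir A c \<rho> \<and> 0 < d \<bullet> \<rho>"
proof -
  obtain x u v where A: "A = {x, x + u, x + v}" and D: "\<bar>det2 u v\<bar> = 1"
    using assms(1) unfolding unimod_triangle_def by blast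
  define D' where "D' = det2 u v"
  have DD: "D' * D' = 1" using D unfolding D'_def by (metis abs_mult_self_eq mult_1)
  have nz: "det2 u v \<noteq> 0" using D by auto
  note dis = det2_nz_distinct[OF nz]
  \<comment> \<open>Up to sign, the basis dual to \<open>u\<close>, \<open>v\<close>; the third
    direction is the negative of their sum.\<close>
  define r1 r2 where "r1 = (- D') *\<^sub>R rot u" and "r2 = D' *\<^sub>R rot v"
  have i: "u \<bullet> r1 = 0" "v \<bullet> r1 = - 1" "u \<bullet> r2 = - 1" "v \<bullet> r2 = 0"
    using DD unfolding r1_def r2_def
    by (simp_all add: inner_commute[of u] inner_commute[of v] inner_rot det2_swap[of v u] D'_def[symmetric])
  have e1: "exit_dir {x, x + u, x + v} (x + v) r1"
    by (subst exit_dir_3) (use dis i in \<open>auto simp: inner_add_left\<close>)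
  have "exit_dir {x, x + v, x + u} (x + u) r2"
    by (subst exit_dir_3) (use dis i in \<open>auto simp: inner_add_left\<close>)
  then have e2: "exit_dir {x, x + u, x + v} (x + u) r2" by (simp add: insert_commute)
  have "exit_dir {x + u, x + v, x} x (- r1 - r2)"
    by (subst exit_dir_3) (use dis i in \<open>auto simp: inner_add_left inner_diff_right\<close>)
  then have e3: "exit_dir {x, x + u, x + v} x (- r1 - r2)" by (simp add: insert_commute)
  have "0 < d \<bullet> r1 \<or> 0 < d \<bullet> r2 \<or> 0 < d \<bullet> (- r1 - r2)"
  proof (rule ccontr)
    assume "\<not> ?thesis"
    then have 0: "d \<bullet> r1 = 0" "d \<bullet> r2 = 0" by (auto simp: inner_diff_right)
    have "D' \<noteq> 0" using DD by auto
    then have "rot u \<bullet> d = 0" "rot v \<bullet> d = 0" using 0 unfolding r1_def r2_def by (simp_all add: inner_commute)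
    then have "det2 u d = 0" "det2 v d = 0" by (simp_all add: inner_rot)
    then have "det2 u v *\<^sub>R d = 0" using det2_expand[of u v d] det2_swap[of v d] by simp
    then show False using nz assms(2) by simp
  qed
  then show ?thesis using e1 e2 e3 A by blast
qed

text \<open>At a vertex of \<open>W\<close> where \<open>d\<close> is maximal some strand ascends.
  If it is an edge, its far end lies higher and therefore outside \<open>W\<close>.\<close>

lemma exit_edge_or_ray:
  assumes nod: "nodal_tropical_curve f" and W: "W \<noteq> {}" "W \<subseteq> curve_vertices f" and d: "d \<noteq> 0"
  shows "(\<exists>v\<in>W. \<exists>c \<rho>. (v, c) \<in> rays f \<and> exit_dir (max_terms f v) c \<rho> \<and> d \<bullet> \<rho> \<noteq> 0) \<or>
    (\<exists>v\<in>W. \<exists>w. w \<notin> W \<and> {v, w} \<in> edges (bounded_part f) \<and> d \<bullet> v < d \<bullet> w)"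
proof -
  have fin: "finite W" using finite_subset[OF W(2) finite_vertices_nodes(1)[OF nod]] .
  define M where "M = Max ((\<lambda>v. d \<bullet> v) ` W)"
  have "M \<in> (\<lambda>v. d \<bullet> v) ` W" unfolding M_def using fin W(1) by (intro Max_in) auto
  then obtain v where v: "v \<in> W" "d \<bullet> v = M" by auto
  have max: "d \<bullet> w \<le> d \<bullet> v" if "w \<in> W" for w unfolding v(2) M_def using fin that by (intro Max_ge) auto
  have vC: "v \<in> curve_vertices f" using v W by blast
  obtain c \<rho> where c: "exit_dir (max_terms f v) c \<rho>" "0 < d \<bullet> \<rho>"
    using exit_dir_positive[OF _ d] curve_vertices_iff[OF nod] vC by blast
  have "c \<in> max_terms f v" using c(1) unfolding exit_dir_def by blast
  then consider "(v, c) \<in> rays f" | w where "{v, w} \<in> edges (bounded_part f)" "exit_dir (max_terms f v) c (w - v)"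
    using ray_or_edge[OF nod vC] by blast
  then show ?thesis
  proof cases
    case 1
    have "d \<bullet> \<rho> \<noteq> 0" using c(2) by simp
    then show ?thesis using 1 v(1) c(1) by blast
  next
    case (2 w)
    have tri: "unimod_triangle (max_terms f v)" using vC curve_vertices_iff[OF nod] by blast
    obtain k where k: "0 < k" "w - v = k *\<^sub>R \<rho>" using exit_dir_unique[OF tri c(1) 2(2)] by blast
    have "d \<bullet> (w - v) > 0" unfolding k(2) using k(1) c(2) by simp
    then have "d \<bullet> v < d \<bullet> w" by (simp add: inner_diff_right)
    moreover have "w \<notin> W" using max[of w] calculation by auto
    ultimately show ?thesis using 2(1) v(1) by blast
  qed
qed

text \<open>Without such a ray, \<open>d\<close> and \<open>- d\<close> would both produce an exit
  edge. There is only one, so it would have to ascend and descend along \<open>d\<close> at the same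
  time.\<close>

lemma one_exit_ray:
  assumes nod: "nodal_tropical_curve f" and W: "W \<noteq> {}" "W \<subseteq> curve_vertices f"
    and exits: "card (exit_edges (bounded_part f) W) \<le> 1" and d: "d \<noteq> 0"
  shows "\<exists>v\<in>W. \<exists>c \<rho>. (v, c) \<in> rays f \<and> exit_dir (max_terms f v) c \<rho> \<and> d \<bullet> \<rho> \<noteq> 0"
proof (rule ccontr)
  assume no: "\<not> ?thesis"
  from exit_edge_or_ray[OF nod W d] no obtain v w where
    v: "v \<in> W" "w \<notin> W" "{v, w} \<in> edges (bounded_part f)" "d \<bullet> v < d \<bullet> w" by blast
  have no': "\<not> (\<exists>v\<in>W. \<exists>c \<rho>. (v, c) \<in> rays f \<and> exit_dir (max_terms f v) c \<rho> \<and> (- d) \<bullet> \<rho> \<noteq> 0)" using no by simp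
  have d': "- d \<noteq> 0" using d by simp
  from exit_edge_or_ray[OF nod W d'] no' obtain v' w' where
    v': "v' \<in> W" "w' \<notin> W" "{v', w'} \<in> edges (bounded_part f)" "(- d) \<bullet> v' < (- d) \<bullet> w'" by blast
  have ex: "{v, w} \<in> exit_edges (bounded_part f) W" if "v \<in> W" "w \<notin> W" "{v, w} \<in> edges (bounded_part f)" for v w
    unfolding exit_edges_def using that by (intro CollectI conjI bexI[of _ v] exI[of _ w]) simp_all
  have fin: "finite (exit_edges (bounded_part f) W)"
    using finite_mgraph_bounded_part[OF nod] unfolding finite_mgraph_def exit_edges_def by auto
  have "{v, w} = {v', w'}"
    using ex[OF v(1-3)] ex[OF v'(1-3)] exits card_le_Suc0_iff_eq[OF fin] by auto
  then have "v = v'" "w = w'" using v v' by (auto simp: doubleton_eq_iff)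
  then show False using v(4) v'(4) by simp
qed

section \<open>Widths of the Newton polygon\<close>

text \<open>Far out, exactly \<open>p\<close> and \<open>q\<close> are maximal along the ray: it is
  dual to the primitive segment from \<open>p\<close> to \<open>q\<close> on the side of the Newton
  polygon with outer normal \<open>\<rho>\<close>. One side may contain several such segments, which
  belong to parallel rays.\<close>

definition ray_data :: "trop_poly \<Rightarrow> (real \<times> real) \<times> (real \<times> real) \<Rightarrow> real \<times> real \<Rightarrow> real \<times> real \<Rightarrow> real \<times> real \<Rightarrow> bool" where
  "ray_data f r \<rho> p q \<longleftrightarrow> exit_dir (max_terms f (fst r)) (snd r) \<rho> \<and> p \<noteq> q \<and>
     p \<in> argmax \<rho> (supp f) \<and> q \<in> argmax \<rho> (supp f) \<and> (\<exists>z\<in>\<int> \<times> \<int>. \<bar>det2 (q - p) z\<bar> = 1) \<and>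
     eventually (\<lambda>t. max_terms f (fst r + t *\<^sub>R \<rho>) = {p, q}) at_top"

lemma argmax_inner_eq: "p \<in> argmax d A \<Longrightarrow> q \<in> argmax d A \<Longrightarrow> p \<bullet> d = q \<bullet> d"
  unfolding argmax_def by (auto intro: antisym)

lemma collinear_level_set:
  fixes A :: "(real \<times> real) set"
  assumes "d \<noteq> 0" "\<And>p. p \<in> A \<Longrightarrow> p \<bullet> d = k"
  shows "collinear A"
  unfolding collinear_det2
proof (intro ballI)
  fix a b c assume "a \<in> A" "b \<in> A" "c \<in> A"
  then have "d \<bullet> (b - a) = 0" "d \<bullet> (c - a) = 0" using assms(2) by (simp_all add: inner_diff_right inner_commute)
  then obtain i j where ij: "b - a = i *\<^sub>R rot d" "c - a = j *\<^sub>R rot d"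
    using inner_0_imp_scaleR_rot[OF _ assms(1)] by meson
  show "det2 (b - a) (c - a) = 0" unfolding ij by (simp only: det2_simps mult_zero_right)
qed

text \<open>The eventual maximal terms all have the same product with \<open>\<rho>\<close> and are
  therefore collinear; on a nodal curve this leaves exactly two of them.\<close>

lemma ray_data_exists:
  assumes nod: "nodal_tropical_curve f" and r: "r \<in> rays f"
  shows "\<exists>\<rho> p q. ray_data f r \<rho> p q"
proof -
  have tp: "is_trop_poly f" using nodal_trop[OF nod] .
  obtain v c where vc: "r = (v, c)" "v \<in> curve_vertices f" "c \<in> max_terms f v" using r unfolding rays_def by blast
  have tri: "unimod_triangle (max_terms f v)" using vc curve_vertices_iff[OF nod] by blast
  obtain \<rho> where \<rho>: "exit_dir (max_terms f v) c \<rho>" using exit_dir_exists[OF tri vc(3) max_terms_int[OF tp]] by blast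
  define E where "E = {p \<in> argmax \<rho> (supp f). \<forall>q\<in>argmax \<rho> (supp f). coef f q + q \<bullet> v \<le> coef f p + p \<bullet> v}"
  have ev: "eventually (\<lambda>t. max_terms f (v + t *\<^sub>R \<rho>) = E) at_top"
    unfolding E_def by (rule max_terms_far[OF tp])
  then have "eventually (\<lambda>t. max_terms f (v + t *\<^sub>R \<rho>) = E \<and> 0 < t) at_top"
    by (intro eventually_conj eventually_gt_at_top)
  then obtain t where t: "max_terms f (v + t *\<^sub>R \<rho>) = E" "0 < t"
    using eventually_happens[of _ "at_top :: real filter"] by auto
  have "v + t *\<^sub>R \<rho> \<in> tropical_curve f" using r \<rho> t(2) vc(1) unfolding rays_def by blast
  then have card: "2 \<le> card (max_terms f (v + t *\<^sub>R \<rho>))" unfolding tropical_curve_def by simp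
  have sub: "E \<subseteq> argmax \<rho> (supp f)" unfolding E_def by blast
  obtain p0 where "p0 \<in> E" using two_distinct[OF card] unfolding t(1) by blast
  have "collinear E"
    by (rule collinear_level_set[OF exit_dir_nonzero[OF tri \<rho>], of _ "p0 \<bullet> \<rho>"])
      (use sub \<open>p0 \<in> E\<close> argmax_inner_eq in blast)
  then obtain p q where "E = {p, q}" "p \<noteq> q" "\<exists>z\<in>\<int> \<times> \<int>. \<bar>det2 (q - p) z\<bar> = 1"
    using max_terms_edge[OF nod card] unfolding t(1) by blast
  then have "ray_data f r \<rho> p q" unfolding ray_data_def using \<rho> ev sub vc(1) by simp
  then show ?thesis by blast
qed

lemma ray_data_rot:
  assumes "nodal_tropical_curve f" "r \<in> rays f" "ray_data f r \<rho> p q"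
  shows "\<exists>i. i \<noteq> 0 \<and> \<rho> = i *\<^sub>R rot (q - p)"
proof -
  have "unimod_triangle (max_terms f (fst r))" using assms(2) curve_vertices_iff[OF assms(1)] unfolding rays_def by auto
  then have nz: "\<rho> \<noteq> 0" using exit_dir_nonzero assms(3) unfolding ray_data_def by blast
  have "(q - p) \<bullet> \<rho> = 0" "q - p \<noteq> 0"
    using assms(3) argmax_inner_eq[of p \<rho> "supp f" q] unfolding ray_data_def by (auto simp: inner_diff_left)
  then obtain i where "\<rho> = i *\<^sub>R rot (q - p)" using inner_0_imp_scaleR_rot by blast
  then show ?thesis using nz by auto
qed

text \<open>Both rays lie on the line where \<open>p\<close> and \<open>q\<close> tie. Opposite
  directions would make the Newton polygon flat. With equal directions, the starting vertex of one
  ray would lie on the other ray, which contains no vertices, unless the two starting vertices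
  agree.\<close>

lemma ray_data_inj:
  assumes nod: "nodal_tropical_curve f" and r: "r \<in> rays f" "r' \<in> rays f"
    and data: "ray_data f r \<rho> p q" "ray_data f r' \<rho>' p q"
  shows "r = r'"
proof -
  have tp: "is_trop_poly f" using nodal_trop[OF nod] .
  obtain i i' where i: "i \<noteq> 0" "\<rho> = i *\<^sub>R rot (q - p)" and i': "i' \<noteq> 0" "\<rho>' = i' *\<^sub>R rot (q - p)"
    using ray_data_rot[OF nod r(1) data(1)] ray_data_rot[OF nod r(2) data(2)] by blast
  define k where "k = i' / i"
  have \<rho>': "\<rho>' = k *\<^sub>R \<rho>" "k \<noteq> 0" unfolding k_def i(2) i'(2) using i(1) i'(1) by simp_all
  have nz: "\<rho> \<noteq> 0" using i data(1) unfolding ray_data_def by auto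
  have kpos: "0 < k"
  proof (rule ccontr)
    assume "\<not> 0 < k"
    then have k: "k < 0" using \<rho>'(2) by simp
    have "s \<bullet> \<rho> = p \<bullet> \<rho>" if "s \<in> supp f" for s
    proof (rule antisym)
      show "s \<bullet> \<rho> \<le> p \<bullet> \<rho>" using data(1) that unfolding ray_data_def argmax_def by blast
      have "s \<bullet> \<rho>' \<le> p \<bullet> \<rho>'" using data(2) that unfolding ray_data_def argmax_def by blast
      then show "p \<bullet> \<rho> \<le> s \<bullet> \<rho>" unfolding \<rho>'(1) using k by (simp add: mult_le_cancel_left)
    qed
    then have "collinear (supp f)" by (rule collinear_level_set[OF nz])
    then show False using nodal_supp[OF nod] by blast
  qed
  define v v' where "v = fst r" and "v' = fst r'"
  have "eventually (\<lambda>t. max_terms f (v + t *\<^sub>R \<rho>) = {p, q}) at_top"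
    and "eventually (\<lambda>t. max_terms f (v' + t *\<^sub>R \<rho>') = {p, q}) at_top"
    using data unfolding ray_data_def v_def v'_def by blast+
  then have "eventually (\<lambda>t. max_terms f (v + t *\<^sub>R \<rho>) = {p, q} \<and> max_terms f (v' + t *\<^sub>R \<rho>') = {p, q}) at_top"
    by (rule eventually_conj)
  from eventually_happens[OF this]
  obtain t where t: "max_terms f (v + t *\<^sub>R \<rho>) = {p, q}" "max_terms f (v' + t *\<^sub>R \<rho>') = {p, q}"
    by (auto simp del: insert_iff)
  have "(q - p) \<bullet> ((v' + t *\<^sub>R \<rho>') - (v + t *\<^sub>R \<rho>)) = 0"
    by (rule max_terms_common[of _ f]) (use t in auto)
  moreover have "(q - p) \<bullet> \<rho> = 0" unfolding i(2) by (simp add: inner_commute[of "q - p"] inner_rot)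
  ultimately have "(q - p) \<bullet> (v' - v) = 0" unfolding \<rho>'(1) by (simp add: inner_diff_right inner_add_right)
  moreover have "q - p \<noteq> 0" using data(1) unfolding ray_data_def by auto
  ultimately obtain j where "v' - v = j *\<^sub>R rot (q - p)" using inner_0_imp_scaleR_rot by blast
  then obtain s where "v' - v = s *\<^sub>R \<rho>" unfolding i(2) using i(1) by (metis divide_inverse_commute mult.commute nonzero_eq_divide_eq scaleR_scaleR)
  then have s: "v' = v + s *\<^sub>R \<rho>" by (simp add: algebra_simps)
  have no: "x + t *\<^sub>R d \<notin> curve_vertices f" if "(x, c) \<in> rays f" "exit_dir (max_terms f x) c d" "0 < t" for x c d t
    using that unfolding rays_def by blast
  have V: "v \<in> curve_vertices f" "v' \<in> curve_vertices f" using r unfolding rays_def v_def v'_def by auto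
  have ed: "exit_dir (max_terms f v) (snd r) \<rho>" "exit_dir (max_terms f v') (snd r') \<rho>'"
    using data unfolding ray_data_def v_def v'_def by blast+
  have "\<not> 0 < s" using no[of v "snd r" \<rho> s] r(1) ed(1) V s unfolding v_def by auto
  moreover have "\<not> s < 0"
  proof
    assume "s < 0"
    then have "0 < - s / k" using kpos by (simp add: divide_neg_pos)
    moreover have "v = v' + (- s / k) *\<^sub>R \<rho>'" using s kpos unfolding \<rho>'(1) by simp
    ultimately show False using no[of v' "snd r'" \<rho>' "- s / k"] r(2) ed(2) V unfolding v'_def by auto
  qed
  ultimately have vv: "v = v'" using s by simp
  have "exit_dir (max_terms f v) (snd r) \<rho>'" unfolding \<rho>'(1) by (rule exit_dir_scale[OF ed(1) kpos])
  then have "snd r = snd r'" using ed(2) exit_dir_inj vv by metis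
  then show ?thesis using vv unfolding v_def v'_def by (simp add: prod_eq_iff)
qed

lemma ray_data_swap: "ray_data f r \<rho> p q \<Longrightarrow> ray_data f r \<rho> q p"
  unfolding ray_data_def by (simp add: insert_commute) (metis abs_minus_cancel det2_simps(5) minus_diff_eq)

section \<open>Lattice width\<close>

definition width :: "trop_poly \<Rightarrow> real \<times> real \<Rightarrow> real" where
  "width f w = Max ((\<lambda>p. w \<bullet> p) ` supp f) - Min ((\<lambda>p. w \<bullet> p) ` supp f)"

lemma width_le_iff:
  assumes "is_trop_poly f"
  shows "width f w \<le> b \<longleftrightarrow> (\<forall>p\<in>supp f. \<forall>q\<in>supp f. w \<bullet> p - w \<bullet> q \<le> b)"
proof -
  let ?V = "(\<lambda>p. w \<bullet> p) ` supp f"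
  have V: "finite ?V" "?V \<noteq> {}" using finite_supp[OF assms] supp_nonempty[OF assms] by auto
  obtain p where p: "p \<in> supp f" "w \<bullet> p = Max ?V" using Max_in[OF V] by fastforce
  obtain q where q: "q \<in> supp f" "w \<bullet> q = Min ?V" using Min_in[OF V] by fastforce
  have "w \<bullet> x - w \<bullet> y \<le> width f w" if "x \<in> supp f" "y \<in> supp f" for x y
    unfolding width_def using V that by (intro diff_mono Max_ge Min_le) auto
  then show ?thesis using p q unfolding width_def by (metis order_trans)
qed

lemma width_attained:
  assumes "is_trop_poly f"
  obtains p q where "p \<in> supp f" "q \<in> supp f" "w \<bullet> p - w \<bullet> q = width f w"
proof -
  let ?V = "(\<lambda>p. w \<bullet> p) ` supp f"
  have V: "finite ?V" "?V \<noteq> {}" using finite_supp[OF assms] supp_nonempty[OF assms] by auto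
  obtain p where p: "p \<in> supp f" "w \<bullet> p = Max ?V" using Max_in[OF V] by fastforce
  obtain q where q: "q \<in> supp f" "w \<bullet> q = Min ?V" using Min_in[OF V] by fastforce
  show ?thesis using that[OF p(1) q(1)] p(2) q(2) unfolding width_def by simp
qed

lemma width_pos:
  assumes nod: "nodal_tropical_curve f" and w: "w \<noteq> 0"
  shows "0 < width f w"
proof (rule ccontr)
  have tp: "is_trop_poly f" using nodal_trop[OF nod] .
  assume "\<not> 0 < width f w"
  then have le: "\<And>p q. p \<in> supp f \<Longrightarrow> q \<in> supp f \<Longrightarrow> w \<bullet> p - w \<bullet> q \<le> 0" using width_le_iff[OF tp, of w 0] by auto
  obtain p0 where p0: "p0 \<in> supp f" using supp_nonempty[OF tp] by blast
  have "collinear (supp f)"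
  proof (rule collinear_level_set[OF w, of _ "p0 \<bullet> w"])
    show "p \<bullet> w = p0 \<bullet> w" if "p \<in> supp f" for p
      using le[OF that p0] le[OF p0 that] by (simp add: inner_commute)
  qed
  then show False using nodal_supp[OF nod] by blast
qed

lemma width_Ints:
  assumes tp: "is_trop_poly f" and w: "w \<in> \<int> \<times> \<int>"
  shows "width f w \<in> \<int>"
proof -
  obtain p q where "p \<in> supp f" "q \<in> supp f" "w \<bullet> p - w \<bullet> q = width f w" using width_attained[OF tp] .
  then show ?thesis using int_pair_simps(5)[OF w] supp_int_pair[OF tp] by (metis Ints_diff subsetD)
qed

text \<open>The determinants with \<open>z\<close> and \<open>z'\<close> show that \<open>k\<close>
  is an integer and has an integer inverse.\<close>

lemma primitive_parallel:
  assumes "\<bar>det2 u z\<bar> = 1" "\<bar>det2 u' z'\<bar> = 1" "u \<in> \<int> \<times> \<int>" "u' \<in> \<int> \<times> \<int>" "z \<in> \<int> \<times> \<int>" "z' \<in> \<int> \<times> \<int>"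
    "u' = k *\<^sub>R u" "0 < k"
  shows "u' = u"
proof -
  have *: "k * \<bar>det2 u z\<bar> = \<bar>det2 u' z\<bar>" "\<bar>det2 u' z'\<bar> = k * \<bar>det2 u z'\<bar>" unfolding assms(7) using assms(8) by (simp_all add: abs_mult)
  have "\<bar>det2 u' z\<bar> \<in> \<int>" "\<bar>det2 u z'\<bar> \<in> \<int>" using int_pair_simps(1) assms(3-6) by (metis Ints_abs)+
  then obtain a b where ab: "\<bar>det2 u' z\<bar> = of_int a" "\<bar>det2 u z'\<bar> = of_int b" by (metis Ints_cases)
  have "k = of_int a" "1 = k * of_int b" using * assms(1,2) ab by simp_all
  then have "real_of_int (a * b) = 1" by simp
  then have "a * b = 1" by linarith
  moreover have "a > 0" using \<open>k = of_int a\<close> assms(8) by simp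
  ultimately have "a = 1" using pos_zmult_eq_1_iff by blast
  then show ?thesis using \<open>k = of_int a\<close> assms(7) by simp
qed

lemma eq_0_of_signs:
  fixes t a b :: real
  assumes "0 \<le> t * a" "t * b \<le> 0" "0 < a \<and> 0 < b \<or> a < 0 \<and> b < 0"
  shows "t = 0"
  using assms by (auto simp: zero_le_mult_iff mult_le_0_iff)

text \<open>Far out, a ray runs along a boundary edge of the Newton polygon. Sorting these edges by the side
  of the polygon on which they lie and by their first coordinate in direction \<open>w\<close>, no two coincide.\<close>

lemma ray_slots_inj:
  assumes nod: "nodal_tropical_curve f" and w: "w \<in> \<int> \<times> \<int>" and r: "r \<in> rays f" "r' \<in> rays f"
    and data: "ray_data f r \<rho> l h" "ray_data f r' \<rho>' l' h'"
    and up: "w \<bullet> l < w \<bullet> h" "w \<bullet> l' < w \<bullet> h'"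
    and eq: "w \<bullet> l = w \<bullet> l'" and side: "0 < \<rho> \<bullet> rot w \<longleftrightarrow> 0 < \<rho>' \<bullet> rot w"
  shows "r = r'"
proof -
  have tp: "is_trop_poly f" using nodal_trop[OF nod] .
  have w0: "w \<noteq> 0" using up by auto
  have mem: "l \<in> supp f" "h \<in> supp f" "l' \<in> supp f" "h' \<in> supp f"
    and le: "\<And>s. s \<in> supp f \<Longrightarrow> s \<bullet> \<rho> \<le> l \<bullet> \<rho>" "\<And>s. s \<in> supp f \<Longrightarrow> s \<bullet> \<rho>' \<le> l' \<bullet> \<rho>'"
    using data unfolding ray_data_def argmax_def by blast+
  obtain i i' where i: "i \<noteq> 0" "\<rho> = i *\<^sub>R rot (h - l)" and i': "i' \<noteq> 0" "\<rho>' = i' *\<^sub>R rot (h' - l')"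
    using ray_data_rot[OF nod r(1) data(1)] ray_data_rot[OF nod r(2) data(2)] by blast
  have rr: "rot a \<bullet> rot b = a \<bullet> b" for a b by (simp add: rot_def inner_pair)
  define u u' where "u = h - l" and "u' = h' - l'"
  have wu: "0 < u \<bullet> w" "0 < u' \<bullet> w" using up by (simp_all add: u_def u'_def inner_commute[of _ w] inner_diff_right)
  have s1: "\<rho> \<bullet> rot w = i * (u \<bullet> w)" "\<rho>' \<bullet> rot w = i' * (u' \<bullet> w)"
    unfolding i(2) i'(2) u_def u'_def by (simp_all add: rr)
  then have si: "0 < i \<longleftrightarrow> 0 < i'" using side wu by (simp add: zero_less_mult_iff not_less_iff_gr_or_eq)
  \<comment> \<open>Both lower ends lie on one line perpendicular to \<open>rot w\<close>'s quarter
    turn, that is, on a level line of \<open>w\<close>. Each lies in the supporting half-plane of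
    the other edge; as both edges are on the same side of the polygon, the ends coincide.\<close>
  have "w \<bullet> (l - l') = 0" using eq by (simp add: inner_diff_right)
  then obtain t where t: "l - l' = t *\<^sub>R rot w" using inner_0_imp_scaleR_rot w0 by blast
  have "(l - l') \<bullet> \<rho> \<ge> 0" "(l - l') \<bullet> \<rho>' \<le> 0" using le(1)[OF mem(3)] le(2)[OF mem(1)] by (simp_all add: inner_diff_left)
  then have t1: "0 \<le> t * (i * (u \<bullet> w))" "t * (i' * (u' \<bullet> w)) \<le> 0"
    unfolding t using s1 by (simp_all add: inner_commute)
  have "0 < i * (u \<bullet> w) \<and> 0 < i' * (u' \<bullet> w) \<or> i * (u \<bullet> w) < 0 \<and> i' * (u' \<bullet> w) < 0"
  proof (cases "0 < i")
    case True
    then show ?thesis using si wu by simp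
  next
    case False
    then have "i < 0" "i' < 0" using si i(1) i'(1) by auto
    then show ?thesis using wu by (simp add: mult_less_0_iff)
  qed
  then have "t = 0" by (rule eq_0_of_signs[OF t1])
  then have ll: "l = l'" using t by simp
  \<comment> \<open>From a common lower end, each edge lies in the supporting half-plane of the
    other, which makes them parallel. Being primitive, they are equal.\<close>
  have "(h' - l) \<bullet> \<rho> \<le> 0" "(h - l) \<bullet> \<rho>' \<le> 0" using le(1)[OF mem(4)] le(2)[OF mem(2)] ll by (simp_all add: inner_diff_left)
  then have "i * det2 u u' \<le> 0" "i' * det2 u' u \<le> 0"
    unfolding i(2) i'(2) u_def u'_def ll by (simp_all add: inner_commute[of "h' - l'"] inner_commute[of "h - l'"] inner_rot)
  then have D: "i * det2 u u' \<le> 0" "0 \<le> i' * det2 u u'" by (simp_all add: det2_swap[of u' u])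
  have "0 \<le> det2 u u' * i'" "det2 u u' * i \<le> 0" using D by (simp_all add: mult.commute)
  moreover have "0 < i' \<and> 0 < i \<or> i' < 0 \<and> i < 0" using si i(1) i'(1) by auto
  ultimately have "det2 u u' = 0" by (rule eq_0_of_signs)
  moreover have "u \<noteq> 0" using wu(1) by auto
  ultimately obtain k where k: "u' = k *\<^sub>R u" using det2_0_imp_scaleR by blast
  have "0 < k" using wu unfolding k by (simp add: zero_less_mult_iff)
  obtain z z' where z: "z \<in> \<int> \<times> \<int>" "\<bar>det2 u z\<bar> = 1" "z' \<in> \<int> \<times> \<int>" "\<bar>det2 u' z'\<bar> = 1"
    using data unfolding ray_data_def u_def u'_def by blast
  have "u \<in> \<int> \<times> \<int>" "u' \<in> \<int> \<times> \<int>" unfolding u_def u'_def using int_pair_simps(2)[of h l] int_pair_simps(2)[of h' l'] mem supp_int_pair[OF tp] by blast+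
  then have "u' = u" using primitive_parallel[OF z(2,4) _ _ z(1,3) k \<open>0 < k\<close>] by blast
  then have "h = h'" using ll unfolding u_def u'_def by simp
  then show ?thesis using ray_data_inj[OF nod r data(1)] data(2) ll by blast
qed

text \<open>Each ray counted here occupies a slot, given by the integer level of \<open>w\<close> at
  the lower end of its segment and by one of two sides of the polygon. The number of levels is the
  width.\<close>

lemma card_rays_transversal:
  assumes nod: "nodal_tropical_curve f" and w: "w \<in> \<int> \<times> \<int>"
    and data: "\<And>r. r \<in> rays f \<Longrightarrow> ray_data f r (R r) (P r) (Q r)"
  shows "real (card {r \<in> rays f. w \<bullet> P r \<noteq> w \<bullet> Q r}) \<le> 2 * width f w"
proof -
  have tp: "is_trop_poly f" using nodal_trop[OF nod] .
  let ?R = "{r \<in> rays f. w \<bullet> P r \<noteq> w \<bullet> Q r}"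
  define L where "L r = (if w \<bullet> P r < w \<bullet> Q r then P r else Q r)" for r
  define U where "U r = (if w \<bullet> P r < w \<bullet> Q r then Q r else P r)" for r
  have LU: "ray_data f r (R r) (L r) (U r)" "w \<bullet> L r < w \<bullet> U r" if "r \<in> ?R" for r
    using data[of r] ray_data_swap[of f r "R r" "P r" "Q r"] that unfolding L_def U_def by auto
  have mem: "L r \<in> supp f" "U r \<in> supp f" if "r \<in> ?R" for r
    using LU(1)[OF that] unfolding ray_data_def argmax_def by blast+
  let ?mn = "Min ((\<lambda>p. w \<bullet> p) ` supp f)" and ?mx = "Max ((\<lambda>p. w \<bullet> p) ` supp f)"
  let ?key = "\<lambda>r. (\<lfloor>w \<bullet> L r\<rfloor>, 0 < R r \<bullet> rot w)"
  have int: "w \<bullet> p \<in> \<int>" if "p \<in> supp f" for p using int_pair_simps(5)[OF w] supp_int_pair[OF tp] that by blast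
  have fl: "of_int \<lfloor>w \<bullet> p\<rfloor> = w \<bullet> p" if "p \<in> supp f" for p using int[OF that] by (simp add: of_int_floor)
  have V: "finite ((\<lambda>p. w \<bullet> p) ` supp f)" "(\<lambda>p. w \<bullet> p) ` supp f \<noteq> {}"
    using finite_supp[OF tp] supp_nonempty[OF tp] by auto
  have "inj_on ?key ?R"
  proof (rule inj_onI)
    fix r r' assume r: "r \<in> ?R" "r' \<in> ?R" "?key r = ?key r'"
    then have k: "\<lfloor>w \<bullet> L r\<rfloor> = \<lfloor>w \<bullet> L r'\<rfloor>" "0 < R r \<bullet> rot w \<longleftrightarrow> 0 < R r' \<bullet> rot w" by simp_all
    have "w \<bullet> L r = w \<bullet> L r'" using arg_cong[OF k(1), of real_of_int] unfolding fl[OF mem(1)[OF r(1)]] fl[OF mem(1)[OF r(2)]] .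
    moreover have "r \<in> rays f" "r' \<in> rays f" using r(1,2) by simp_all
    ultimately show "r = r'"
      using ray_slots_inj[OF nod w _ _ LU(1)[OF r(1)] LU(1)[OF r(2)] LU(2)[OF r(1)] LU(2)[OF r(2)]] k(2) by blast
  qed
  \<comment> \<open>The interval is half-open: the top level is never that of a lower end, because
    the upper end of the segment lies strictly above it.\<close>
  moreover have "?key ` ?R \<subseteq> {\<lfloor>?mn\<rfloor>..<\<lfloor>?mx\<rfloor>} \<times> UNIV"
  proof (rule image_subsetI)
    fix r assume r: "r \<in> ?R"
    have "?mn \<le> w \<bullet> L r" using V mem[OF r] by (intro Min_le) auto
    moreover have "w \<bullet> U r \<le> ?mx" using V mem[OF r] by (intro Max_ge) auto
    moreover have "\<lfloor>w \<bullet> L r\<rfloor> < \<lfloor>w \<bullet> U r\<rfloor>" using LU(2)[OF r] fl[OF mem(1)[OF r]] fl[OF mem(2)[OF r]] by linarith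
    ultimately have "\<lfloor>?mn\<rfloor> \<le> \<lfloor>w \<bullet> L r\<rfloor>" "\<lfloor>w \<bullet> L r\<rfloor> < \<lfloor>?mx\<rfloor>"
      using floor_mono[of ?mn "w \<bullet> L r"] floor_mono[of "w \<bullet> U r" ?mx] by linarith+
    then show "?key r \<in> {\<lfloor>?mn\<rfloor>..<\<lfloor>?mx\<rfloor>} \<times> UNIV" by simp
  qed
  moreover have "finite ({\<lfloor>?mn\<rfloor>..<\<lfloor>?mx\<rfloor>} \<times> (UNIV :: bool set))" by simp
  ultimately have "card ?R \<le> card ({\<lfloor>?mn\<rfloor>..<\<lfloor>?mx\<rfloor>} \<times> (UNIV :: bool set))" by (rule card_inj_on_le)
  also have "\<dots> = 2 * nat (\<lfloor>?mx\<rfloor> - \<lfloor>?mn\<rfloor>)" by (simp add: card_cartesian_product)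
  finally have "real (card ?R) \<le> 2 * real (nat (\<lfloor>?mx\<rfloor> - \<lfloor>?mn\<rfloor>))" by linarith
  moreover have "?mn \<le> ?mx" using Max_ge[OF V(1) Min_in[OF V]] .
  moreover have "of_int \<lfloor>x\<rfloor> = x" if "x \<in> (\<lambda>p. w \<bullet> p) ` supp f" for x using that fl by blast
  then have "of_int \<lfloor>?mx\<rfloor> = ?mx" "of_int \<lfloor>?mn\<rfloor> = ?mn" using Max_in[OF V] Min_in[OF V] by blast+
  ultimately show ?thesis unfolding width_def using floor_mono[of ?mn ?mx] by simp
qed

lemma ray_data_choice:
  assumes "nodal_tropical_curve f"
  shows "\<exists>R P Q. \<forall>r\<in>rays f. ray_data f r (R r) (P r) (Q r)"
proof -
  have "\<forall>r\<in>rays f. \<exists>x. ray_data f r (fst x) (fst (snd x)) (snd (snd x))"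
    using ray_data_exists[OF assms] by force
  then obtain x where "\<forall>r\<in>rays f. ray_data f r (fst (x r)) (fst (snd (x r))) (snd (snd (x r)))" by (rule bchoice[THEN exE])
  then show ?thesis
    by (intro exI[of _ "\<lambda>r. fst (x r)"] exI[of _ "\<lambda>r. fst (snd (x r))"] exI[of _ "\<lambda>r. snd (snd (x r))"])
qed

text \<open>A segment that is level for two independent functionals is a point, so every ray is
  counted for \<open>w\<close> or for \<open>w'\<close>.\<close>

lemma card_rays_le:
  assumes nod: "nodal_tropical_curve f" and w: "w \<in> \<int> \<times> \<int>" "w' \<in> \<int> \<times> \<int>" "det2 w w' \<noteq> 0"
  shows "real (card (rays f)) \<le> 2 * width f w + 2 * width f w'"
proof -
  obtain R P Q where data: "\<And>r. r \<in> rays f \<Longrightarrow> ray_data f r (R r) (P r) (Q r)" using ray_data_choice[OF nod] by blast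
  have "rays f \<subseteq> {r \<in> rays f. w \<bullet> P r \<noteq> w \<bullet> Q r} \<union> {r \<in> rays f. w' \<bullet> P r \<noteq> w' \<bullet> Q r}"
  proof
    fix r assume r: "r \<in> rays f"
    have "\<not> (w \<bullet> P r = w \<bullet> Q r \<and> w' \<bullet> P r = w' \<bullet> Q r)"
    proof
      assume "w \<bullet> P r = w \<bullet> Q r \<and> w' \<bullet> P r = w' \<bullet> Q r"
      then have "w \<bullet> (Q r - P r) = 0" "w' \<bullet> (Q r - P r) = 0" by (simp_all add: inner_diff_right)
      moreover have "w \<noteq> 0" using w(3) by auto
      ultimately obtain k where k: "Q r - P r = k *\<^sub>R rot w" using inner_0_imp_scaleR_rot by blast
      have "k * det2 w w' = 0" using \<open>w' \<bullet> (Q r - P r) = 0\<close> unfolding k by (simp add: inner_commute[of w'] inner_rot)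
      then have "Q r - P r = 0" using w(3) k by simp
      then show False using data[OF r] unfolding ray_data_def by simp
    qed
    then show "r \<in> {r \<in> rays f. w \<bullet> P r \<noteq> w \<bullet> Q r} \<union> {r \<in> rays f. w' \<bullet> P r \<noteq> w' \<bullet> Q r}" using r by blast
  qed
  then have "card (rays f) \<le> card ({r \<in> rays f. w \<bullet> P r \<noteq> w \<bullet> Q r} \<union> {r \<in> rays f. w' \<bullet> P r \<noteq> w' \<bullet> Q r})"
    by (intro card_mono) (use finite_rays[OF nod] in auto)
  also have "\<dots> \<le> card {r \<in> rays f. w \<bullet> P r \<noteq> w \<bullet> Q r} + card {r \<in> rays f. w' \<bullet> P r \<noteq> w' \<bullet> Q r}"
    by (rule card_Un_le)
  finally show ?thesis
    using card_rays_transversal[OF nod w(1) data] card_rays_transversal[OF nod w(2) data] by linarith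
qed

text \<open>The pieces are tested with the functional \<open>rot w\<close>. A ray is a quarter turn
  of its dual segment, so a ray not perpendicular to \<open>rot w\<close> has a segment that is not
  level for \<open>w\<close>; disjoint pieces own different rays.\<close>

lemma one_exit_family_width:
  assumes nod: "nodal_tropical_curve f" and fam: "one_exit_family (bounded_part f) m W"
    and w: "w \<in> \<int> \<times> \<int>" "w \<noteq> 0"
  shows "real m \<le> 2 * width f w"
proof -
  obtain R P Q where data: "\<And>r. r \<in> rays f \<Longrightarrow> ray_data f r (R r) (P r) (Q r)" using ray_data_choice[OF nod] by blast
  let ?R = "{r \<in> rays f. w \<bullet> P r \<noteq> w \<bullet> Q r}"
  have "\<exists>r\<in>?R. fst r \<in> W i" if i: "i < m" for i
  proof -
    have W: "W i \<noteq> {}" "W i \<subseteq> curve_vertices f" "card (exit_edges (bounded_part f) (W i)) \<le> 1"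
      using fam i unfolding one_exit_family_def by auto
    obtain v c \<rho> where v: "v \<in> W i" "(v, c) \<in> rays f" "exit_dir (max_terms f v) c \<rho>" "rot w \<bullet> \<rho> \<noteq> 0"
      using one_exit_ray[OF nod W, of "rot w"] w(2) by auto
    let ?r = "(v, c)"
    have tri: "unimod_triangle (max_terms f v)" using v(2) curve_vertices_iff[OF nod] unfolding rays_def by blast
    have "exit_dir (max_terms f v) c (R ?r)" using data[OF v(2)] unfolding ray_data_def by simp
    then obtain k where k: "0 < k" "\<rho> = k *\<^sub>R R ?r" using exit_dir_unique[OF tri _ v(3)] by blast
    obtain j where j: "R ?r = j *\<^sub>R rot (Q ?r - P ?r)" using ray_data_rot[OF nod v(2) data[OF v(2)]] by blast
    have rr: "rot a \<bullet> rot b = a \<bullet> b" for a b by (simp add: rot_def inner_pair)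
    have "w \<bullet> (Q ?r - P ?r) \<noteq> 0" using v(4) unfolding k(2) j by (auto simp: rr)
    then have "w \<bullet> P ?r \<noteq> w \<bullet> Q ?r" by (simp add: inner_diff_right)
    then show ?thesis using v(1,2) by (intro bexI[of _ ?r]) simp_all
  qed
  then have "\<forall>i\<in>{..<m}. \<exists>r. r \<in> ?R \<and> fst r \<in> W i" by blast
  from bchoice[OF this] obtain r where r: "\<And>i. i < m \<Longrightarrow> r i \<in> ?R \<and> fst (r i) \<in> W i" by blast
  have "inj_on r {..<m}"
  proof (rule inj_onI)
    fix i j assume ij: "i \<in> {..<m}" "j \<in> {..<m}" "r i = r j"
    then have "fst (r i) \<in> W i \<inter> W j" using r[of i] r[of j] by simp
    then show "i = j" using fam ij(1,2) unfolding one_exit_family_def by blast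
  qed
  moreover have "r ` {..<m} \<subseteq> ?R" by (rule image_subsetI) (use r in simp)
  moreover have "finite ?R" using finite_rays[OF nod] by simp
  ultimately have "card {..<m} \<le> card ?R" by (rule card_inj_on_le)
  then show ?thesis using card_rays_transversal[OF nod w(1) data] by simp
qed

section \<open>A basis adapted to the polygon, and the area\<close>

lemma width_ge:
  "is_trop_poly f \<Longrightarrow> p \<in> supp f \<Longrightarrow> q \<in> supp f \<Longrightarrow> w \<bullet> p - w \<bullet> q \<le> width f w"
  using width_le_iff[of f w "width f w"] by blast

lemma width_nat:
  assumes nod: "nodal_tropical_curve f" and w: "w \<in> \<int> \<times> \<int>"
  shows "real (nat \<lfloor>width f w\<rfloor>) = width f w"
proof -
  have tp: "is_trop_poly f" using nodal_trop[OF nod] .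
  obtain p where "p \<in> supp f" using supp_nonempty[OF tp] by blast
  then have "0 \<le> width f w" using width_ge[OF tp, of p p w] by simp
  moreover have "of_int \<lfloor>width f w\<rfloor> = width f w" using width_Ints[OF tp w] by (rule of_int_floor)
  ultimately show ?thesis by simp
qed

text \<open>A reduced basis with respect to the width. Widths of lattice vectors are natural
  numbers, so minima exist: \<open>w\<close> is taken minimal among all nonzero vectors, then
  \<open>w'\<close> among all completions of \<open>w\<close> to a basis, which differ by multiples
  of \<open>w\<close>.\<close>

lemma minimal_width_basis:
  assumes nod: "nodal_tropical_curve f"
  obtains w w' where "w \<in> \<int> \<times> \<int>" "w' \<in> \<int> \<times> \<int>" "det2 w w' = 1" "width f w \<le> width f w'"
    "\<And>k::int. width f w' \<le> width f (w' + of_int k *\<^sub>R w)"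
proof -
  have tp: "is_trop_poly f" using nodal_trop[OF nod] .
  let ?m = "\<lambda>w. nat \<lfloor>width f w\<rfloor>"
  have "(1, 0) \<in> \<int> \<times> \<int> \<and> (1::real, 0::real) \<noteq> 0" by (simp add: prod_eq_iff)
  then obtain w where w: "w \<in> \<int> \<times> \<int>" "w \<noteq> 0" and "\<And>y. y \<in> \<int> \<times> \<int> \<and> y \<noteq> 0 \<Longrightarrow> ?m w \<le> ?m y"
    using ex_has_least_nat[of "\<lambda>w. w \<in> \<int> \<times> \<int> \<and> w \<noteq> 0" "(1, 0)" ?m] by blast
  then have least: "width f w \<le> width f y" if "y \<in> \<int> \<times> \<int>" "y \<noteq> 0" for y
    using that width_nat[OF nod w(1)] width_nat[OF nod that(1)] by (metis of_nat_le_iff)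
  obtain a b where ab: "w = (of_int a, of_int b)" using w(1) by (auto elim!: Ints_cases)
  define g where "g = gcd a b"
  have g: "g > 0" using w(2) ab unfolding g_def by (auto simp: prod_eq_iff)
  define w0 :: "real \<times> real" where "w0 = (of_int (a div g), of_int (b div g))"
  have "g dvd a" "g dvd b" unfolding g_def by simp_all
  then have wg: "w = of_int g *\<^sub>R w0" unfolding ab w0_def
    by (simp add: of_int_mult[symmetric] del: of_int_mult)
  have w0: "w0 \<in> \<int> \<times> \<int>" "w0 \<noteq> 0"
  proof -
    show "w0 \<in> \<int> \<times> \<int>" by (simp add: w0_def)
    show "w0 \<noteq> 0" using w(2) wg by fastforce
  qed
  obtain p q where pq: "p \<in> supp f" "q \<in> supp f" "w0 \<bullet> p - w0 \<bullet> q = width f w0" using width_attained[OF tp] .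
  \<comment> \<open>Dividing by the gcd \<open>g\<close> would divide the positive width by
    \<open>g\<close>, so minimality forces \<open>w\<close> to be primitive, and a Bezout relation
    completes it to a basis.\<close>
  have "of_int g * width f w0 = w \<bullet> p - w \<bullet> q" unfolding wg pq(3)[symmetric] by (simp add: right_diff_distrib)
  also have "\<dots> \<le> width f w" by (rule width_ge[OF tp pq(1,2)])
  also have "\<dots> \<le> width f w0" by (rule least[OF w0])
  finally have "of_int g * width f w0 \<le> 1 * width f w0" by simp
  then have "real_of_int g \<le> 1" using width_pos[OF nod w0(2)] by (simp only: mult_le_cancel_right_pos)
  then have "g = 1" using g by simp
  then obtain u v where uv: "u * a + v * b = 1" using bezout_int[of a b] unfolding g_def by auto
  define w1 :: "real \<times> real" where "w1 = (- of_int v, of_int u)"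
  have w1: "w1 \<in> \<int> \<times> \<int>" unfolding w1_def by simp
  have "det2 w w1 = of_int (u * a + v * b)" unfolding ab w1_def det2_def by (simp add: mult.commute)
  then have d1: "det2 w w1 = 1" using uv by simp
  obtain k where k: "\<And>j::int. ?m (w1 + of_int k *\<^sub>R w) \<le> ?m (w1 + of_int j *\<^sub>R w)"
    using ex_has_least_nat[of "\<lambda>_. True" 0 "\<lambda>k::int. ?m (w1 + of_int k *\<^sub>R w)"] by blast
  define w' where "w' = w1 + of_int k *\<^sub>R w"
  have sc: "of_int j *\<^sub>R w \<in> \<int> \<times> \<int>" for j using w(1) by (auto simp: mem_Times_iff)
  have int': "w1 + of_int j *\<^sub>R w \<in> \<int> \<times> \<int>" for j by (rule int_pair_simps(3)[OF w1 sc])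
  have d': "det2 w w' = 1" unfolding w'_def using d1 by simp
  have mn: "width f w' \<le> width f (w' + of_int j *\<^sub>R w)" for j
  proof -
    have e: "w' + of_int j *\<^sub>R w = w1 + of_int (k + j) *\<^sub>R w" unfolding w'_def by (simp add: scaleR_add_left)
    have "real (?m w') \<le> real (?m (w1 + of_int (k + j) *\<^sub>R w))" using k[of "k + j"] unfolding w'_def by simp
    then show ?thesis unfolding e using width_nat[OF nod int'] unfolding w'_def by (simp only:)
  qed
  have nz: "w' \<noteq> 0" using d' by auto
  have wi: "w' \<in> \<int> \<times> \<int>" unfolding w'_def by (rule int')
  show ?thesis by (rule that[OF w(1) wi d' least[OF wi nz] mn])
qed

text \<open>If the Newton polygon contained no segment of length \<open>l\<close> in the direction \<open>rot w\<close>, it would lie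
  in a strip of width \<open>l\<close> crossing that direction; rounding the slope of the strip to an integer
  makes one of the functionals \<open>w' + k w\<close> too narrow.\<close>

lemma chord_exists:
  assumes nod: "nodal_tropical_curve f" and d: "det2 w w' = 1"
    and min: "\<And>k::int. width f w' \<le> width f (w' + of_int k *\<^sub>R w)"
    and l: "0 < l" "l + width f w / 2 < width f w'"
  shows "\<exists>z. z \<in> newton_polygon f \<and> z + l *\<^sub>R rot w \<in> newton_polygon f"
proof (rule ccontr)
  assume no: "\<not> ?thesis"
  have tp: "is_trop_poly f" using nodal_trop[OF nod] .
  let ?P = "newton_polygon f" and ?e = "rot w"
  have cv: "convex ?P" unfolding newton_polygon_def by (rule convex_convex_hull)
  have SP: "supp f \<subseteq> ?P" unfolding newton_polygon_def by (rule hull_subset)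
  have ne: "?P \<noteq> {}" using SP supp_nonempty[OF tp] by blast
  \<comment> \<open>A chord of length \<open>l\<close> in the direction \<open>rot w\<close> is a
    common point of the polygon and its translate. Without one, the two are separated by a line,
    which yields the strip.\<close>
  have dis: "?P \<inter> (+) (l *\<^sub>R ?e) ` ?P = {}" using no by (auto simp: add.commute)
  obtain a b where ab: "a \<noteq> 0" "\<forall>x\<in>?P. a \<bullet> x \<le> b" "\<forall>x\<in>(+) (l *\<^sub>R ?e) ` ?P. b \<le> a \<bullet> x"
    using separating_hyperplane_sets[OF cv convex_translation[OF cv] ne _ dis] ne by blast
  have aw: "a \<bullet> p - a \<bullet> q \<le> l * (a \<bullet> ?e)" if "p \<in> supp f" "q \<in> supp f" for p q
  proof -
    have "a \<bullet> p \<le> b" "b \<le> a \<bullet> (l *\<^sub>R ?e + q)" using ab that SP by blast+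
    then show ?thesis by (simp add: inner_add_right)
  qed
  have "width f a \<le> l * (a \<bullet> ?e)" unfolding width_le_iff[OF tp] using aw by blast
  then have "0 < l * (a \<bullet> ?e)" using width_pos[OF nod ab(1)] by simp
  then have pos: "0 < a \<bullet> ?e" using l(1) by (simp add: zero_less_mult_iff)
  \<comment> \<open>Scaled to agree with \<open>w'\<close> on \<open>rot w\<close>, so that the two
    functionals differ by a multiple of \<open>w\<close>.\<close>
  define a' where "a' = a /\<^sub>R (a \<bullet> ?e)"
  have a'e: "a' \<bullet> ?e = 1" unfolding a'_def using pos by simp
  have a'w: "a' \<bullet> p - a' \<bullet> q \<le> l" if "p \<in> supp f" "q \<in> supp f" for p q
    using aw[OF that] pos unfolding a'_def by (simp add: field_simps)
  have w'e: "w' \<bullet> ?e = 1" using d by (simp add: inner_commute[of w'] inner_rot)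
  have "?e \<bullet> (a' - w') = 0" using a'e w'e by (simp add: inner_diff_right inner_commute)
  moreover have "?e \<noteq> 0" using d by auto
  ultimately obtain c where c: "a' - w' = c *\<^sub>R rot ?e" using inner_0_imp_scaleR_rot by blast
  have "rot ?e = - w" by (simp add: rot_def prod_eq_iff)
  then have a': "a' = w' + (- c) *\<^sub>R w" using c by (simp add: algebra_simps)
  \<comment> \<open>Rounding moves the coefficient of \<open>w\<close> by at most 1/2, which
    increases the width by at most half the width of \<open>w\<close>. This is the reserve in the
    hypothesis on \<open>l\<close>.\<close>
  define k where "k = round (- c)"
  have kc: "\<bar>of_int k - (- c)\<bar> \<le> 1 / 2" unfolding k_def by (rule of_int_round_abs_le)
  have "width f (w' + of_int k *\<^sub>R w) \<le> l + width f w / 2"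
    unfolding width_le_iff[OF tp]
  proof (intro ballI)
    fix p q assume pq: "p \<in> supp f" "q \<in> supp f"
    have 1: "a' \<bullet> p - a' \<bullet> q \<le> l" by (rule a'w[OF pq])
    have 2: "\<bar>w \<bullet> p - w \<bullet> q\<bar> \<le> width f w" using width_ge[OF tp pq, of w] width_ge[OF tp pq(2,1), of w] by simp
    have "(w' + of_int k *\<^sub>R w) \<bullet> p - (w' + of_int k *\<^sub>R w) \<bullet> q =
        (a' \<bullet> p - a' \<bullet> q) + (of_int k - (- c)) * (w \<bullet> p - w \<bullet> q)"
      unfolding a' by (simp add: inner_add_left algebra_simps)
    also have "\<dots> \<le> l + \<bar>(of_int k - (- c)) * (w \<bullet> p - w \<bullet> q)\<bar>" using 1 by (intro add_mono) simp_all
    also have "\<bar>(of_int k - (- c)) * (w \<bullet> p - w \<bullet> q)\<bar> \<le> 1 / 2 * width f w"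
      unfolding abs_mult by (rule mult_mono[OF kc 2]) simp_all
    finally show "(w' + of_int k *\<^sub>R w) \<bullet> p - (w' + of_int k *\<^sub>R w) \<bullet> q \<le> l + width f w / 2" by simp
  qed
  then show False using min[of k] l(2) by simp
qed

text \<open>A chord along \<open>rot w\<close> and an exponent at \<open>w\<close>-distance at least
  half the width from it span a triangle in the polygon. Chord length a quarter of the width of
  \<open>w'\<close> gives 1/2 * 1/4 * 1/2 = 1/16.\<close>

lemma area_ge:
  assumes nod: "nodal_tropical_curve f" and d: "det2 w w' = 1" and ww: "width f w \<le> width f w'"
    and min: "\<And>k::int. width f w' \<le> width f (w' + of_int k *\<^sub>R w)"
  shows "width f w * width f w' / 16 \<le> measure lebesgue (newton_polygon f)"
proof -
  have tp: "is_trop_poly f" using nodal_trop[OF nod] .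
  let ?P = "newton_polygon f"
  have w0: "w \<noteq> 0" "w' \<noteq> 0" using d by auto
  have pos: "0 < width f w" "0 < width f w'" using width_pos[OF nod] w0 by blast+
  \<comment> \<open>Since \<open>w\<close> is no wider than \<open>w'\<close>, 1/4 + 1/2 < 1 meets
    the requirement on the chord length.\<close>
  define l where "l = width f w' / 4"
  have l: "0 < l" "l + width f w / 2 < width f w'" using pos ww unfolding l_def by linarith+
  obtain z where z: "z \<in> ?P" "z + l *\<^sub>R rot w \<in> ?P" using chord_exists[OF nod d min l] by blast
  obtain p q where pq: "p \<in> supp f" "q \<in> supp f" "w \<bullet> p - w \<bullet> q = width f w" using width_attained[OF tp] .
  have "width f w \<le> \<bar>w \<bullet> (p - z)\<bar> + \<bar>w \<bullet> (q - z)\<bar>" using pq(3) by (simp add: inner_diff_right)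
  then have "width f w / 2 \<le> \<bar>w \<bullet> (p - z)\<bar> \<or> width f w / 2 \<le> \<bar>w \<bullet> (q - z)\<bar>" by linarith
  then obtain y where y: "y \<in> supp f" "width f w / 2 \<le> \<bar>w \<bullet> (y - z)\<bar>" using pq(1,2) by blast
  let ?T = "convex hull {z, z + l *\<^sub>R rot w, y}"
  have "y \<in> ?P" using y(1) hull_subset[of "supp f" convex] unfolding newton_polygon_def by blast
  then have sub: "?T \<subseteq> ?P" using z unfolding newton_polygon_def by (intro hull_minimal) auto
  have cP: "compact ?P" unfolding newton_polygon_def by (rule finite_imp_compact_convex_hull[OF finite_supp[OF tp]])
  have cT: "compact ?T" by (intro finite_imp_compact_convex_hull) simp
  have "det2 (rot w) v = - (w \<bullet> v)" for v by (simp add: det2_def rot_def inner_pair)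
  then have "det2 (z + l *\<^sub>R rot w - z) (y - z) = l * - (w \<bullet> (y - z))"
    by (simp only: add_diff_cancel_left' det2_simps(7))
  then have "measure lebesgue ?T = l * \<bar>w \<bullet> (y - z)\<bar> / 2"
    unfolding measure_triangle using l(1) by (simp only: abs_mult abs_minus_cancel abs_of_pos)
  moreover have "l * (width f w / 2) / 2 \<le> l * \<bar>w \<bullet> (y - z)\<bar> / 2"
    using l(1) y(2) by (intro divide_right_mono mult_left_mono) simp_all
  moreover have "measure lebesgue ?T \<le> measure lebesgue ?P"
    by (rule measure_mono_fmeasurable[OF sub]) (use cP cT lmeasurable_compact fmeasurableD in blast)+
  ultimately show ?thesis unfolding l_def by simp
qed

lemma area_le:
  assumes nod: "nodal_tropical_curve f"
  shows "measure lebesgue (newton_polygon f) \<le> card (curve_vertices f) / 2 + card (nodes f)"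
proof -
  have tp: "is_trop_poly f" using nodal_trop[OF nod] .
  let ?I = "curve_vertices f \<union> nodes f"
  have fin: "finite (curve_vertices f)" "finite (nodes f)" using finite_vertices_nodes[OF nod] by blast+
  have sets: "dual_face f x \<in> sets lebesgue" for x
    unfolding dual_face_def
    by (intro fmeasurableD lmeasurable_compact finite_imp_compact_convex_hull finite_max_terms[OF tp])
  have "newton_polygon f = \<Union>(dual_subdivision f)"
    using nod unfolding nodal_tropical_curve_def nodal_subdivision_def regular_subdivision_def lattice_subdivision_def by simp
  also have "\<dots> \<subseteq> (\<Union>x\<in>?I. dual_face f x)"
  proof (rule Union_least)
    fix \<sigma> assume "\<sigma> \<in> dual_subdivision f"
    then obtain x where x: "\<sigma> = dual_face f x" "\<not> collinear (max_terms f x)"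
      unfolding dual_subdivision_iff[OF tp] dual_face_def by blast
    then have "x \<in> ?I" using nodal_cells[OF nod x(2)] curve_vertices_iff[OF nod] nodes_iff[OF nod] by blast
    then show "\<sigma> \<subseteq> (\<Union>x\<in>?I. dual_face f x)" using x(1) by blast
  qed
  finally have sub: "newton_polygon f \<subseteq> (\<Union>x\<in>?I. dual_face f x)" .
  have lm: "dual_face f x \<in> lmeasurable" for x
    unfolding dual_face_def by (intro lmeasurable_compact finite_imp_compact_convex_hull finite_max_terms[OF tp])
  have "measure lebesgue (newton_polygon f) \<le> measure lebesgue (\<Union>x\<in>?I. dual_face f x)"
  proof (rule measure_mono_fmeasurable[OF sub])
    show "newton_polygon f \<in> sets lebesgue"
      unfolding newton_polygon_def by (intro fmeasurableD lmeasurable_compact finite_imp_compact_convex_hull finite_supp[OF tp])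
    show "(\<Union>x\<in>?I. dual_face f x) \<in> lmeasurable" using fin lm by (intro fmeasurable.finite_UN) auto
  qed
  also have "\<dots> \<le> (\<Sum>x\<in>?I. measure lebesgue (dual_face f x))"
    using fin sets by (intro measure_UNION_le) auto
  also have "\<dots> \<le> (\<Sum>x\<in>curve_vertices f. measure lebesgue (dual_face f x)) + (\<Sum>x\<in>nodes f. measure lebesgue (dual_face f x))"
    using sum.union_inter[OF fin, of "\<lambda>x. measure lebesgue (dual_face f x)"]
      sum_nonneg[of "curve_vertices f \<inter> nodes f" "\<lambda>x. measure lebesgue (dual_face f x)"] by simp
  also have "(\<Sum>x\<in>curve_vertices f. measure lebesgue (dual_face f x)) = (\<Sum>x\<in>curve_vertices f. 1 / 2)"
  proof (rule sum.cong)
    fix x assume "x \<in> curve_vertices f"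
    then have u: "unimod_triangle (max_terms f x)" using curve_vertices_iff[OF nod] by blast
    then have "\<not> unimod_parallelogram (max_terms f x)" using card_unimod by fastforce
    then show "measure lebesgue (dual_face f x) = 1 / 2"
      using nodal_cells[OF nod, of x] unimod_not_collinear u by blast
  qed simp
  also have "(\<Sum>x\<in>nodes f. measure lebesgue (dual_face f x)) = (\<Sum>x\<in>nodes f. 1)"
  proof (rule sum.cong)
    fix x assume "x \<in> nodes f"
    then have u: "unimod_parallelogram (max_terms f x)" using nodes_iff[OF nod] by blast
    then have "\<not> unimod_triangle (max_terms f x)" using card_unimod by fastforce
    then show "measure lebesgue (dual_face f x) = 1"
      using nodal_cells[OF nod, of x] unimod_not_collinear u by blast
  qed simp
  finally show ?thesis by simp
qed

lemma card_nodes_ge: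
  assumes nod: "nodal_tropical_curve f" and fam: "one_exit_family (bounded_part f) m W"
  shows "\<exists>w w'. real m \<le> 2 * w \<and> w \<le> w' \<and>
    w * w' / 16 - w - w' - of_int (genus (bounded_part f)) + 1 \<le> real (card (nodes f))"
proof -
  obtain w w' where w: "w \<in> \<int> \<times> \<int>" "w' \<in> \<int> \<times> \<int>" "det2 w w' = 1" "width f w \<le> width f w'"
    and min: "\<And>k::int. width f w' \<le> width f (w' + of_int k *\<^sub>R w)"
    using minimal_width_basis[OF nod] by blast
  have "w \<noteq> 0" using w(3) by auto
  then have m: "real m \<le> 2 * width f w" by (rule one_exit_family_width[OF nod fam w(1)])
  define T E B where "T = real (card (curve_vertices f))" and "E = real (card (edges (bounded_part f)))"
    and "B = real (card (rays f))"
  have "3 * T \<le> 2 * E + B" using card_rays[OF nod] unfolding T_def E_def B_def by linarith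
  moreover have "of_int (genus (bounded_part f)) = E - T + 1" unfolding genus_def T_def E_def by simp
  moreover have "B \<le> 2 * width f w + 2 * width f w'"
    unfolding B_def using card_rays_le[OF nod w(1,2)] w(3) by simp
  moreover have "width f w * width f w' / 16 \<le> T / 2 + card (nodes f)"
    using area_ge[OF nod w(3,4) min] area_le[OF nod] unfolding T_def by simp
  ultimately have "width f w * width f w' / 16 - width f w - width f w' - of_int (genus (bounded_part f)) + 1 \<le> real (card (nodes f))"
    by (simp add: field_simps)
  then show ?thesis using m w(4) by blast
qed

text \<open>The quadratic term m^2 / 64 arises from width m / 2 in both directions. One half of it
  absorbs the linear losses, about 6 m in total, which \<open>m \<ge> 1000\<close> allows. The
  hypothesis on the genus fits the graphs constructed below.\<close>

lemma card_nodes_ge_square: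
  assumes nod: "nodal_tropical_curve f" and fam: "one_exit_family (bounded_part f) m W"
    and g: "genus (bounded_part f) \<le> 5 * int m + 1" and m: "1000 \<le> m"
  shows "(real m)\<^sup>2 / 128 \<le> real (card (nodes f))"
proof -
  obtain w w' where w: "real m \<le> 2 * w" "w \<le> w'"
    and N: "w * w' / 16 - w - w' - of_int (genus (bounded_part f)) + 1 \<le> real (card (nodes f))"
    using card_nodes_ge[OF nod fam] by blast
  have g': "of_int (genus (bounded_part f)) \<le> 5 * real m + 1" using g by linarith
  define x where "x = real m"
  have x: "1000 \<le> x" "x \<le> 2 * w" using m w(1) unfolding x_def by simp_all
  have "(w / 16 - 1) * w \<le> (w / 16 - 1) * w'" using w(2) x by (intro mult_left_mono) auto
  then have 1: "w * w / 16 - w - w \<le> w * w' / 16 - w - w'" by (simp add: algebra_simps)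
  \<comment> \<open>The factorised difference of the values of w^2 / 16 - 2 w at \<open>w\<close>
    and at \<open>x / 2\<close>.\<close>
  have "0 \<le> (w - x / 2) * (w / 16 + x / 32 - 2)" using x by (intro mult_nonneg_nonneg) auto
  moreover have "(w - x / 2) * (w / 16 + x / 32 - 2) = w * w / 16 - x * x / 64 - 2 * w + x"
    by (simp add: field_simps)
  ultimately have 2: "x * x / 64 - x \<le> w * w / 16 - w - w" by linarith
  have "1000 * x \<le> x * x" using x by (intro mult_right_mono) auto
  then have "x * x / 128 \<le> x * x / 64 - x - (5 * x + 1) + 1" using x by simp
  then show ?thesis using 1 2 N g' unfolding x_def power2_eq_square by linarith
qed

section \<open>Curves dual to grid subdivisions\<close>

text \<open>\<open>s i j\<close> tells whether the unit square with lower left corner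
  \<open>(i, j)\<close> is cut by its rising diagonal. Dually, the crossing of the vertical line
  \<open>i\<close> with the horizontal line \<open>j\<close> is resolved into two vertices if it
  holds, and stays a node otherwise.\<close>

locale grid =
  fixes a b :: nat and s :: "nat \<Rightarrow> nat \<Rightarrow> bool"
  assumes a_pos: "0 < a" and b_pos: "0 < b"
begin

text \<open>Large enough that the displacements of a line caused by resolved crossings, at most
  \<open>b\<close> for vertical and at most \<open>a\<close> for horizontal ones, cannot bring two
  parallel lines together.\<close>

definition K :: real where "K = real (a + b + 1)"

definition cx :: "nat \<Rightarrow> nat \<Rightarrow> real" where "cx i j = (\<Sum>l<j. of_bool (s i l))"

definition cy :: "nat \<Rightarrow> nat \<Rightarrow> real" where "cy i j = (\<Sum>k<i. of_bool (s k j))"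

text \<open>The sum counts the cut squares to the lower left of \<open>(i, j)\<close>. Its mixed
  second difference over a square is 1 if the square is cut and 0 otherwise, so the lifted corners
  of exactly the uncut squares are coplanar. The concave quadratic part creases the surface along
  all grid lines.\<close>

definition ht :: "nat \<Rightarrow> nat \<Rightarrow> real" where
  "ht i j = (\<Sum>k<i. cx k j) - K * ((real i)\<^sup>2 + (real j)\<^sup>2)"

text \<open>The abscissa at which the terms \<open>(i, j)\<close> and \<open>(i + 1, j)\<close> tie;
  \<open>X2\<close> is the ordinate for \<open>(i, j)\<close> and \<open>(i, j + 1)\<close>. Going
  up, a vertical line moves one unit to the left at each resolved crossing; going right, a
  horizontal line moves one unit down.\<close>

definition X1 :: "nat \<Rightarrow> nat \<Rightarrow> real" where "X1 i j = K * (2 * real i + 1) - cx i j"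

definition X2 :: "nat \<Rightarrow> nat \<Rightarrow> real" where "X2 i j = K * (2 * real j + 1) - cy i j"

definition pt :: "nat \<Rightarrow> nat \<Rightarrow> real \<times> real" where "pt i j = (real i, real j)"

definition gpoly :: trop_poly where
  "gpoly = \<lparr>supp = {pt i j | i j. i \<le> a \<and> j \<le> b}, coef = (\<lambda>p. ht (nat \<lfloor>fst p\<rfloor>) (nat \<lfloor>snd p\<rfloor>))\<rparr>"

definition val :: "real \<times> real \<Rightarrow> nat \<Rightarrow> nat \<Rightarrow> real" where
  "val x i j = ht i j + real i * fst x + real j * snd x"

abbreviation M :: "real \<times> real \<Rightarrow> (real \<times> real) set" where "M \<equiv> max_terms gpoly"

lemma pt_eq [simp]: "pt i j = pt k l \<longleftrightarrow> i = k \<and> j = l"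
  by (simp add: pt_def)

lemma supp_gpoly: "supp gpoly = {pt i j | i j. i \<le> a \<and> j \<le> b}"
  by (simp add: gpoly_def)

lemma pt_supp [simp]: "pt i j \<in> supp gpoly \<longleftrightarrow> i \<le> a \<and> j \<le> b"
  by (auto simp: supp_gpoly)

lemma val_pt: "coef gpoly (pt i j) + pt i j \<bullet> x = val x i j"
  by (simp add: gpoly_def val_def pt_def inner_pair)

lemma supp_gpoly_image: "supp gpoly = (\<lambda>(i, j). pt i j) ` ({..a} \<times> {..b})"
  by (force simp: supp_gpoly)

lemma is_trop_poly_gpoly: "is_trop_poly gpoly"
proof -
  have "finite (supp gpoly)" unfolding supp_gpoly_image by simp
  moreover have "supp gpoly \<noteq> {}" using pt_supp[of 0 0] by blast
  moreover have "supp gpoly \<subseteq> \<nat> \<times> \<nat>" by (auto simp: supp_gpoly pt_def)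
  ultimately show ?thesis by (simp add: is_trop_poly_def)
qed

lemma pt_M: "pt i j \<in> M x \<longleftrightarrow> i \<le> a \<and> j \<le> b \<and> (\<forall>k\<le>a. \<forall>l\<le>b. val x k l \<le> val x i j)"
proof -
  have "(\<forall>q\<in>supp gpoly. coef gpoly q + q \<bullet> x \<le> coef gpoly (pt i j) + pt i j \<bullet> x) \<longleftrightarrow>
      (\<forall>k\<le>a. \<forall>l\<le>b. val x k l \<le> val x i j)"
    unfolding val_pt[symmetric] supp_gpoly by blast
  then show ?thesis unfolding max_terms_iff[OF is_trop_poly_gpoly] by simp
qed

lemma M_cases:
  assumes "p \<in> M x"
  obtains i j where "p = pt i j" "i \<le> a" "j \<le> b"
  using assms max_terms_subset[of gpoly x] unfolding supp_gpoly by blast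

section \<open>Positions of the lines\<close>

lemma cx_Suc: "cx i (Suc j) = cx i j + of_bool (s i j)"
  by (simp add: cx_def)

lemma cy_Suc: "cy (Suc i) j = cy i j + of_bool (s i j)"
  by (simp add: cy_def)

lemma cx_bounds: "0 \<le> cx i j" "cx i j \<le> real j"
proof -
  show "0 \<le> cx i j" unfolding cx_def by (rule sum_nonneg) simp
  show "cx i j \<le> real j" by (induction j) (simp_all add: cx_def[of i 0] cx_Suc)
qed

lemma cy_bounds: "0 \<le> cy i j" "cy i j \<le> real i"
proof -
  show "0 \<le> cy i j" unfolding cy_def by (rule sum_nonneg) simp
  show "cy i j \<le> real i" by (induction i) (simp_all add: cy_def[of 0 j] cy_Suc)
qed

lemma X1_Suc: "X1 i (Suc j) = X1 i j - of_bool (s i j)"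
  by (simp add: X1_def cx_Suc)

lemma X2_Suc: "X2 (Suc i) j = X2 i j - of_bool (s i j)"
  by (simp add: X2_def cy_Suc)

lemma X1_const: "j \<le> j' \<Longrightarrow> (\<And>l. j \<le> l \<Longrightarrow> l < j' \<Longrightarrow> \<not> s i l) \<Longrightarrow> X1 i j' = X1 i j"
proof (induction j' rule: dec_induct)
  case (step n)
  then show ?case by (simp add: X1_Suc)
qed simp

lemma X2_const: "i \<le> i' \<Longrightarrow> (\<And>k. i \<le> k \<Longrightarrow> k < i' \<Longrightarrow> \<not> s k j) \<Longrightarrow> X2 i' j = X2 i j"
proof (induction i' rule: dec_induct)
  case (step n)
  then show ?case by (simp add: X2_Suc)
qed simp

lemma val_right: "val x (Suc i) j = val x i j + (fst x - X1 i j)"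
  by (simp add: val_def ht_def X1_def algebra_simps power2_eq_square)

lemma sum_cx: "(\<Sum>k<i. cx k (Suc j)) = (\<Sum>k<i. cx k j) + cy i j"
  by (simp add: cx_Suc cy_def sum.distrib)

lemma val_up: "val x i (Suc j) = val x i j + (snd x - X2 i j)"
  by (simp add: val_def ht_def X2_def sum_cx algebra_simps power2_eq_square)

lemma K_pos: "0 < K" "real a < K" "real b < K"
  by (simp_all add: K_def)

text \<open>An interval that contains all abscissas of the vertical line \<open>i\<close>. Bands of
  different lines are disjoint, so a coordinate identifies its line.\<close>

definition band1 :: "nat \<Rightarrow> real \<Rightarrow> bool" where
  "band1 i t \<longleftrightarrow> K * (2 * real i + 1) - real b \<le> t \<and> t \<le> K * (2 * real i + 1)"

definition band2 :: "nat \<Rightarrow> real \<Rightarrow> bool" where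
  "band2 j t \<longleftrightarrow> K * (2 * real j + 1) - real a \<le> t \<and> t \<le> K * (2 * real j + 1)"

lemma band1_X1: "j \<le> b \<Longrightarrow> band1 i (X1 i j)" "j < b \<Longrightarrow> band1 i (X1 i j - 1)"
  using cx_bounds[of i j] by (auto simp: band1_def X1_def)

lemma band2_X2: "i \<le> a \<Longrightarrow> band2 j (X2 i j)" "i < a \<Longrightarrow> band2 j (X2 i j - 1)"
  using cy_bounds[of i j] by (auto simp: band2_def X2_def)

lemma K_mono: "i < i' \<Longrightarrow> K * (2 * real i + 1) + 2 * K \<le> K * (2 * real i' + 1)"
proof -
  assume "i < i'"
  then have "K * (2 * real i + 3) \<le> K * (2 * real i' + 1)" using K_pos by (intro mult_left_mono) auto
  then show ?thesis by (simp add: algebra_simps)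
qed

lemma band1_less: "i < i' \<Longrightarrow> band1 i t \<Longrightarrow> band1 i' t' \<Longrightarrow> t < t'"
  using K_mono[of i i'] K_pos unfolding band1_def by linarith

lemma band2_less: "j < j' \<Longrightarrow> band2 j t \<Longrightarrow> band2 j' t' \<Longrightarrow> t < t'"
  using K_mono[of j j'] K_pos unfolding band2_def by linarith

lemma band1_unique: "band1 i t \<Longrightarrow> band1 i' t \<Longrightarrow> i = i'"
  using band1_less[of i i' t t] band1_less[of i' i t t] by (cases i i' rule: linorder_cases) auto

lemma band2_unique: "band2 j t \<Longrightarrow> band2 j' t \<Longrightarrow> j = j'"
  using band2_less[of j j' t t] band2_less[of j' j t t] by (cases j j' rule: linorder_cases) auto

lemma M_right: "pt i j \<in> M x \<Longrightarrow> i < a \<Longrightarrow> fst x \<le> X1 i j"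
  using val_right[of x i j] unfolding pt_M by (metis Suc_leI add_le_same_cancel1 diff_le_0_iff_le)

lemma M_left: "pt (Suc i) j \<in> M x \<Longrightarrow> X1 i j \<le> fst x"
  using val_right[of x i j] unfolding pt_M by (metis Suc_leD le_add_same_cancel1 diff_ge_0_iff_ge)

lemma M_up: "pt i j \<in> M x \<Longrightarrow> j < b \<Longrightarrow> snd x \<le> X2 i j"
  using val_up[of x i j] unfolding pt_M by (metis Suc_leI add_le_same_cancel1 diff_le_0_iff_le)

lemma M_down: "pt i (Suc j) \<in> M x \<Longrightarrow> X2 i j \<le> snd x"
  using val_up[of x i j] unfolding pt_M by (metis Suc_leD le_add_same_cancel1 diff_ge_0_iff_ge)

lemma M_columns:
  assumes "pt i j \<in> M x" "pt i' j' \<in> M x"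
  shows "i' \<le> Suc i"
proof (rule ccontr)
  assume "\<not> i' \<le> Suc i"
  then obtain k where k: "i' = Suc k" "i < k" by (cases i') auto
  have b: "i' \<le> a" "j \<le> b" "j' \<le> b" using assms unfolding pt_M by blast+
  have "fst x \<le> X1 i j" using M_right[OF assms(1)] k b by simp
  moreover have "X1 k j' \<le> fst x" using M_left assms(2) k by simp
  moreover have "X1 i j < X1 k j'" using band1_less[OF k(2) band1_X1(1) band1_X1(1)] b by blast
  ultimately show False by simp
qed

lemma M_rows:
  assumes "pt i j \<in> M x" "pt i' j' \<in> M x"
  shows "j' \<le> Suc j"
proof (rule ccontr)
  assume "\<not> j' \<le> Suc j"
  then obtain k where k: "j' = Suc k" "j < k" by (cases j') auto
  have b: "j' \<le> b" "i \<le> a" "i' \<le> a" using assms unfolding pt_M by blast+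
  have "snd x \<le> X2 i j" using M_up[OF assms(1)] k b by simp
  moreover have "X2 i' k \<le> snd x" using M_down assms(2) k by simp
  moreover have "X2 i j < X2 i' k" using band2_less[OF k(2) band2_X2(1) band2_X2(1)] b by blast
  ultimately show False by simp
qed

lemma M_band1:
  assumes "pt k l \<in> M x" "band1 i (fst x)" "i < a"
  shows "k = i \<or> k = Suc i"
proof -
  have b: "k \<le> a" "l \<le> b" using assms unfolding pt_M by blast+
  have "\<not> k < i"
  proof
    assume k: "k < i"
    then have "fst x \<le> X1 k l" using M_right[OF assms(1)] assms(3) by simp
    then show False using band1_less[OF k band1_X1(1)[OF b(2)] assms(2)] by simp
  qed
  moreover have "\<not> Suc i < k"
  proof
    assume "Suc i < k"
    then obtain k' where k': "k = Suc k'" "i < k'" by (cases k) auto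
    then have "X1 k' l \<le> fst x" using M_left assms(1) by simp
    then show False using band1_less[OF k'(2) assms(2) band1_X1(1)[OF b(2)]] by simp
  qed
  ultimately show ?thesis by linarith
qed

lemma M_band2:
  assumes "pt k l \<in> M x" "band2 j (snd x)" "j < b"
  shows "l = j \<or> l = Suc j"
proof -
  have b: "k \<le> a" "l \<le> b" using assms unfolding pt_M by blast+
  have "\<not> l < j"
  proof
    assume k: "l < j"
    then have "snd x \<le> X2 k l" using M_up[OF assms(1)] assms(3) by simp
    then show False using band2_less[OF k band2_X2(1)[OF b(1)] assms(2)] by simp
  qed
  moreover have "\<not> Suc j < l"
  proof
    assume "Suc j < l"
    then obtain k' where k': "l = Suc k'" "j < k'" by (cases l) auto
    then have "X2 k k' \<le> snd x" using M_down assms(1) by simp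
    then show False using band2_less[OF k'(2) assms(2) band2_X2(1)[OF b(1)]] by simp
  qed
  ultimately show ?thesis by linarith
qed

section \<open>Maximal terms inside a unit square\<close>

definition square :: "nat \<Rightarrow> nat \<Rightarrow> (real \<times> real) set" where
  "square i j = {pt i j, pt (Suc i) j, pt i (Suc j), pt (Suc i) (Suc j)}"

lemma M_in_square:
  obtains i j where "i < a" "j < b" "M x \<subseteq> square i j"
proof -
  let ?I = "{i. \<exists>j. pt i j \<in> M x}" and ?J = "{j. \<exists>i. pt i j \<in> M x}"
  obtain p where "p \<in> M x" using max_terms_nonempty[OF is_trop_poly_gpoly] by blast
  then obtain i0 j0 where "pt i0 j0 \<in> M x" using M_cases by metis
  then have ne: "i0 \<in> ?I" "j0 \<in> ?J" by blast+
  have bd: "i \<le> a \<and> j \<le> b" if "pt i j \<in> M x" for i j using that unfolding pt_M by blast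
  obtain i1 where i1: "i1 \<in> ?I" "\<And>i. i \<in> ?I \<Longrightarrow> i1 \<le> i"
    using LeastI[of "\<lambda>i. i \<in> ?I", OF ne(1)] Least_le[of "\<lambda>i. i \<in> ?I"] by blast
  obtain j1 where j1: "j1 \<in> ?J" "\<And>j. j \<in> ?J \<Longrightarrow> j1 \<le> j"
    using LeastI[of "\<lambda>i. i \<in> ?J", OF ne(2)] Least_le[of "\<lambda>i. i \<in> ?J"] by blast
  \<comment> \<open>If only the last column or row contains maximal terms, the square has to begin
    one step earlier to stay inside the polygon.\<close>
  define i j where "i = min i1 (a - 1)" and "j = min j1 (b - 1)"
  have "i < a" "j < b" using a_pos b_pos unfolding i_def j_def by auto
  moreover have "M x \<subseteq> square i j"
  proof
    fix p assume p: "p \<in> M x"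
    then obtain k l where kl: "p = pt k l" using M_cases by metis
    then have k: "k \<in> ?I" "l \<in> ?J" using p by blast+
    obtain j' i' where ji: "pt i1 j' \<in> M x" "pt i' j1 \<in> M x" using i1(1) j1(1) by blast
    have "i1 \<le> k" "k \<le> Suc i1" "k \<le> a" using i1(2)[OF k(1)] M_columns[OF ji(1), of k l] p kl bd by auto
    then have "k = i \<or> k = Suc i" unfolding i_def by (auto simp: min_def)
    moreover have "j1 \<le> l" "l \<le> Suc j1" "l \<le> b" using j1(2)[OF k(2)] M_rows[OF ji(2), of k l] p kl bd by auto
    then have "l = j \<or> l = Suc j" unfolding j_def by (auto simp: min_def)
    ultimately show "p \<in> square i j" unfolding kl square_def by auto
  qed
  ultimately show ?thesis using that by blast
qed

lemma M_le: "pt i j \<in> M x \<Longrightarrow> k \<le> a \<Longrightarrow> l \<le> b \<Longrightarrow> val x k l \<le> val x i j"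
  unfolding pt_M by blast

lemma pt_M_subset:
  assumes sub: "M x \<subseteq> A" and ij: "i \<le> a" "j \<le> b" and max: "\<And>k l. pt k l \<in> A \<Longrightarrow> val x k l \<le> val x i j"
  shows "pt i j \<in> M x"
proof -
  obtain p where p: "p \<in> M x" using max_terms_nonempty[OF is_trop_poly_gpoly] by blast
  then obtain k l where kl: "p = pt k l" using M_cases by metis
  have le: "val x k l \<le> val x i j" using max p kl sub by blast
  have "val x k' l' \<le> val x i j" if "k' \<le> a" "l' \<le> b" for k' l'
  proof -
    have "val x k' l' \<le> val x k l" using p kl that M_le by blast
    then show ?thesis using le by simp
  qed
  then show ?thesis unfolding pt_M using ij by blast
qed

lemma val_square:
  "val x (Suc i) j = val x i j + (fst x - X1 i j)"
  "val x i (Suc j) = val x i j + (snd x - X2 i j)"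
  "val x (Suc i) (Suc j) = val x i j + (fst x - X1 i j) + (snd x - X2 i j) + of_bool (s i j)"
  using val_right[of x i j] val_up[of x i j] val_up[of x "Suc i" j] X2_Suc[of i j] by simp_all

lemma pt_square: "pt k l \<in> square i j \<longleftrightarrow> (k = i \<or> k = Suc i) \<and> (l = j \<or> l = Suc j)"
  unfolding square_def by auto

text \<open>Only four terms compete, and their values differ by \<open>\<alpha>\<close>,
  \<open>\<beta>\<close> and \<open>\<alpha> + \<beta> + \<delta>\<close>. The term
  \<open>\<delta>\<close> is what favours the rising diagonal in a cut square.\<close>

lemma M_square:
  assumes sub: "M x \<subseteq> square i j" and ij: "i < a" "j < b"
    and \<alpha>: "fst x = X1 i j + \<alpha>" and \<beta>: "snd x = X2 i j + \<beta>"
  defines "\<delta> \<equiv> of_bool (s i j)"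
  shows "pt i j \<in> M x \<longleftrightarrow> \<alpha> \<le> 0 \<and> \<beta> \<le> 0 \<and> \<alpha> + \<beta> + \<delta> \<le> 0"
    "pt (Suc i) j \<in> M x \<longleftrightarrow> 0 \<le> \<alpha> \<and> \<beta> \<le> \<alpha> \<and> \<beta> + \<delta> \<le> 0"
    "pt i (Suc j) \<in> M x \<longleftrightarrow> 0 \<le> \<beta> \<and> \<alpha> \<le> \<beta> \<and> \<alpha> + \<delta> \<le> 0"
    "pt (Suc i) (Suc j) \<in> M x \<longleftrightarrow> 0 \<le> \<alpha> + \<beta> + \<delta> \<and> 0 \<le> \<beta> + \<delta> \<and> 0 \<le> \<alpha> + \<delta>"
proof -
  have v: "val x (Suc i) j = val x i j + \<alpha>" "val x i (Suc j) = val x i j + \<beta>"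
    "val x (Suc i) (Suc j) = val x i j + \<alpha> + \<beta> + \<delta>"
    using val_square[of x i j] unfolding \<alpha> \<beta> \<delta>_def by simp_all
  have crit: "pt k l \<in> M x \<longleftrightarrow> val x i j \<le> val x k l \<and> val x (Suc i) j \<le> val x k l \<and>
      val x i (Suc j) \<le> val x k l \<and> val x (Suc i) (Suc j) \<le> val x k l"
    if kl: "pt k l \<in> square i j" for k l
  proof
    assume "pt k l \<in> M x"
    then show "val x i j \<le> val x k l \<and> val x (Suc i) j \<le> val x k l \<and>
      val x i (Suc j) \<le> val x k l \<and> val x (Suc i) (Suc j) \<le> val x k l"
      using ij by (auto intro: M_le)
  next
    assume *: "val x i j \<le> val x k l \<and> val x (Suc i) j \<le> val x k l \<and>
      val x i (Suc j) \<le> val x k l \<and> val x (Suc i) (Suc j) \<le> val x k l"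
    have "k \<le> a" "l \<le> b" using kl ij unfolding pt_square by auto
    then show "pt k l \<in> M x" by (rule pt_M_subset[OF sub]) (use * in \<open>auto simp: pt_square\<close>)
  qed
  show "pt i j \<in> M x \<longleftrightarrow> \<alpha> \<le> 0 \<and> \<beta> \<le> 0 \<and> \<alpha> + \<beta> + \<delta> \<le> 0"
    by (subst crit) (auto simp: pt_square v)
  show "pt (Suc i) j \<in> M x \<longleftrightarrow> 0 \<le> \<alpha> \<and> \<beta> \<le> \<alpha> \<and> \<beta> + \<delta> \<le> 0"
    by (subst crit) (auto simp: pt_square v)
  show "pt i (Suc j) \<in> M x \<longleftrightarrow> 0 \<le> \<beta> \<and> \<alpha> \<le> \<beta> \<and> \<alpha> + \<delta> \<le> 0"
    by (subst crit) (auto simp: pt_square v)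
  show "pt (Suc i) (Suc j) \<in> M x \<longleftrightarrow> 0 \<le> \<alpha> + \<beta> + \<delta> \<and> 0 \<le> \<beta> + \<delta> \<and> 0 \<le> \<alpha> + \<delta>"
    by (subst crit) (auto simp: pt_square v)
qed

lemma M_band_square:
  assumes "band1 i (fst x)" "i < a" "band2 j (snd x)" "j < b"
  shows "M x \<subseteq> square i j"
proof
  fix p assume p: "p \<in> M x"
  then obtain k l where "p = pt k l" using M_cases by metis
  then show "p \<in> square i j" using p M_band1[OF _ assms(1,2)] M_band2[OF _ assms(3,4)] by (simp add: pt_square)
qed

text \<open>A resolved crossing consists of two vertices joined by a diagonal edge:
  \<open>L\<close>, dual to the triangle below the diagonal, with strands going down and right, and
  \<open>U\<close>, dual to the triangle above it, with strands going up and left. \<open>N\<close>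
  is the crossing point of an unresolved pair.\<close>

definition L :: "nat \<Rightarrow> nat \<Rightarrow> real \<times> real" where "L i j = (X1 i j, X2 i j - 1)"

definition U :: "nat \<Rightarrow> nat \<Rightarrow> real \<times> real" where "U i j = (X1 i j - 1, X2 i j)"

definition N :: "nat \<Rightarrow> nat \<Rightarrow> real \<times> real" where "N i j = (X1 i j, X2 i j)"

lemma subset_square_eq:
  assumes "A \<subseteq> square i j"
  shows "A = {p. p = pt i j \<and> pt i j \<in> A \<or> p = pt (Suc i) j \<and> pt (Suc i) j \<in> A \<or>
    p = pt i (Suc j) \<and> pt i (Suc j) \<in> A \<or> p = pt (Suc i) (Suc j) \<and> pt (Suc i) (Suc j) \<in> A}"
  using assms unfolding square_def by blast

lemma M_L:
  assumes "i < a" "j < b" "s i j"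
  shows "M (L i j) = {pt i j, pt (Suc i) j, pt (Suc i) (Suc j)}"
proof -
  have sub: "M (L i j) \<subseteq> square i j"
    by (rule M_band_square) (use assms band1_X1 band2_X2 in \<open>auto simp: L_def\<close>)
  note m = M_square[OF sub assms(1,2), of 0 "- 1"]
  show ?thesis by (subst subset_square_eq[OF sub]) (use m assms(3) in \<open>auto simp: L_def\<close>)
qed

lemma M_U:
  assumes "i < a" "j < b" "s i j"
  shows "M (U i j) = {pt i j, pt i (Suc j), pt (Suc i) (Suc j)}"
proof -
  have sub: "M (U i j) \<subseteq> square i j"
    by (rule M_band_square) (use assms band1_X1 band2_X2 in \<open>auto simp: U_def\<close>)
  note m = M_square[OF sub assms(1,2), of "- 1" 0]
  show ?thesis by (subst subset_square_eq[OF sub]) (use m assms(3) in \<open>auto simp: U_def\<close>)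
qed

lemma M_N:
  assumes "i < a" "j < b" "\<not> s i j"
  shows "M (N i j) = square i j"
proof -
  have sub: "M (N i j) \<subseteq> square i j"
    by (rule M_band_square) (use assms band1_X1 band2_X2 in \<open>auto simp: N_def\<close>)
  note m = M_square[OF sub assms(1,2), of 0 0]
  have "square i j \<subseteq> M (N i j)" unfolding square_def using m assms(3) by (auto simp: N_def)
  with sub show ?thesis by blast
qed

lemma M_noncollinear:
  assumes "\<not> collinear (M x)"
  obtains i j where "i < a" "j < b" "s i j" "M x = {pt i j, pt (Suc i) j, pt (Suc i) (Suc j)}"
  | i j where "i < a" "j < b" "s i j" "M x = {pt i j, pt i (Suc j), pt (Suc i) (Suc j)}"
  | i j where "i < a" "j < b" "\<not> s i j" "M x = square i j"
proof -
  obtain i j where ij: "i < a" "j < b" and sub: "M x \<subseteq> square i j" using M_in_square .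
  define \<alpha> \<beta> where "\<alpha> = fst x - X1 i j" and "\<beta> = snd x - X2 i j"
  have x: "fst x = X1 i j + \<alpha>" "snd x = X2 i j + \<beta>" by (simp_all add: \<alpha>_def \<beta>_def)
  note m = M_square[OF sub ij x]
  have col: "\<not> M x \<subseteq> {p, q}" for p q
    using assms collinear_subset[OF collinear_2[of p q]] by blast
  have c: "\<not> M x \<subseteq> {pt i j, pt (Suc i) j}" "\<not> M x \<subseteq> {pt i j, pt i (Suc j)}"
    "\<not> M x \<subseteq> {pt i j, pt (Suc i) (Suc j)}" "\<not> M x \<subseteq> {pt (Suc i) j, pt i (Suc j)}"
    "\<not> M x \<subseteq> {pt (Suc i) j, pt (Suc i) (Suc j)}" "\<not> M x \<subseteq> {pt i (Suc j), pt (Suc i) (Suc j)}"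
    using col by blast+
  have three: "(pt i (Suc j) \<in> M x \<or> pt (Suc i) (Suc j) \<in> M x) \<and> (pt (Suc i) j \<in> M x \<or> pt (Suc i) (Suc j) \<in> M x) \<and>
      (pt (Suc i) j \<in> M x \<or> pt i (Suc j) \<in> M x) \<and> (pt i j \<in> M x \<or> pt (Suc i) (Suc j) \<in> M x) \<and>
      (pt i j \<in> M x \<or> pt i (Suc j) \<in> M x) \<and> (pt i j \<in> M x \<or> pt (Suc i) j \<in> M x)"
    using c sub unfolding square_def by blast
  show ?thesis
  proof (cases "s i j")
    case False
    then have "pt i j \<in> M x \<and> pt (Suc i) j \<in> M x \<and> pt i (Suc j) \<in> M x \<and> pt (Suc i) (Suc j) \<in> M x"
      using three unfolding m by auto
    then have "M x = square i j" using sub unfolding square_def by blast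
    then show ?thesis using that(3)[OF ij False] by blast
  next
    case True
    then have "pt i j \<in> M x \<and> pt (Suc i) (Suc j) \<in> M x \<and>
        (pt (Suc i) j \<in> M x \<and> pt i (Suc j) \<notin> M x \<or> pt (Suc i) j \<notin> M x \<and> pt i (Suc j) \<in> M x)"
      using three unfolding m by auto
    then have "M x = {pt i j, pt (Suc i) j, pt (Suc i) (Suc j)} \<or> M x = {pt i j, pt i (Suc j), pt (Suc i) (Suc j)}"
      using sub unfolding square_def by blast
    then show ?thesis using that(1,2)[OF ij True] by blast
  qed
qed

end

text \<open>The functional \<open>y - x\<close> cuts the common face out of the cell at
  \<open>x\<close>: its bound there is \<open>trop_eval f y - trop_eval f x\<close>, and a term
  attains it exactly if it is maximal at \<open>y\<close> as well. Exchanging \<open>x\<close> and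
  \<open>y\<close> gives the opposite bound on the other cell.\<close>

lemma dual_faces_meet:
  assumes tp: "is_trop_poly f"
  shows "(dual_face f x \<inter> dual_face f y) face_of dual_face f x"
proof -
  have half: "(y - x) \<bullet> p \<le> trop_eval f y - trop_eval f x" "(y - x) \<bullet> p = trop_eval f y - trop_eval f x \<longleftrightarrow> p \<in> max_terms f y"
    if p: "p \<in> max_terms f x" for x y p
  proof -
    have px: "coef f p + p \<bullet> x = trop_eval f x" "p \<in> supp f" using p unfolding max_terms_def by blast+
    have e: "(y - x) \<bullet> p = p \<bullet> y - p \<bullet> x"
      by (simp only: inner_diff_left inner_commute[of y p] inner_commute[of x p])
    have "coef f p + p \<bullet> y \<le> trop_eval f y" using px(2) finite_supp[OF tp] unfolding trop_eval_def by simp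
    then show "(y - x) \<bullet> p \<le> trop_eval f y - trop_eval f x"
      using px(1) e by linarith
    have "(y - x) \<bullet> p = trop_eval f y - trop_eval f x \<longleftrightarrow> coef f p + p \<bullet> y = trop_eval f y"
      using px(1) e by linarith
    then show "(y - x) \<bullet> p = trop_eval f y - trop_eval f x \<longleftrightarrow> p \<in> max_terms f y"
      using px(2) unfolding max_terms_def by blast
  qed
  have hull: "convex hull max_terms f x \<subseteq> {z. (y - x) \<bullet> z \<le> trop_eval f y - trop_eval f x}" for x y
  proof (rule hull_minimal)
    show "max_terms f x \<subseteq> {z. (y - x) \<bullet> z \<le> trop_eval f y - trop_eval f x}" using half(1) by blast
  qed (rule convex_halfspace_le)
  let ?H = "{z. (y - x) \<bullet> z = trop_eval f y - trop_eval f x}"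
  have "convex hull max_terms f x \<inter> ?H = convex hull (max_terms f x \<inter> ?H)"
    by (rule convex_hull_Int_supporting_hyperplane[OF finite_max_terms[OF tp] half(1)])
  also have "max_terms f x \<inter> ?H = max_terms f x \<inter> max_terms f y" using half(2) by blast
  finally have 1: "convex hull max_terms f x \<inter> ?H = convex hull (max_terms f x \<inter> max_terms f y)" .
  have "dual_face f x \<inter> dual_face f y \<subseteq> dual_face f x \<inter> ?H"
  proof
    fix z assume z: "z \<in> dual_face f x \<inter> dual_face f y"
    then have "(y - x) \<bullet> z \<le> trop_eval f y - trop_eval f x" "(x - y) \<bullet> z \<le> trop_eval f x - trop_eval f y"
      using hull unfolding dual_face_def by blast+
    then show "z \<in> dual_face f x \<inter> ?H" using z by (simp add: inner_diff_left)
  qed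
  moreover have "dual_face f x \<inter> ?H \<subseteq> dual_face f x \<inter> dual_face f y"
    unfolding dual_face_def 1 by (intro Int_greatest hull_mono) simp_all
  ultimately have "dual_face f x \<inter> dual_face f y = dual_face f x \<inter> ?H" by (rule subset_antisym)
  then show ?thesis
    unfolding dual_face_def using hull[of x y] by (auto intro!: face_of_Int_supporting_hyperplane_le)
qed

lemma lattice_polygon_hull:
  assumes "finite A" "A \<subseteq> \<int> \<times> \<int>" "\<not> collinear A"
  shows "lattice_polygon (convex hull A)"
  unfolding lattice_polygon_def
  using assms polytope_convex_hull extreme_point_of_convex_hull aff_dim_2_iff[of A]
  by (auto simp: aff_dim_convex_hull)

lemma unimod_triangle_hull:
  assumes "unimod_triangle A"
  shows "triangle (convex hull A) \<and> measure lebesgue (convex hull A) = 1 / 2"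
proof -
  obtain x u v where A: "A = {x, x + u, x + v}" "\<bar>det2 u v\<bar> = 1" using assms unfolding unimod_triangle_def by blast
  have "\<not> collinear {x, x + u, x + v}" using unimod_not_collinear assms A by blast
  then show ?thesis unfolding triangle_def A(1) measure_triangle using A(2) by (intro conjI) (blast, simp)
qed

lemma unimod_parallelogram_hull:
  assumes "unimod_parallelogram A"
  shows "parallelogram (convex hull A) \<and> measure lebesgue (convex hull A) = 1"
proof -
  obtain x u v where A: "A = {x, x + u, x + v, x + u + v}" "\<bar>det2 u v\<bar> = 1"
    using assms unfolding unimod_parallelogram_def by blast
  have nz: "det2 u v \<noteq> 0" using A(2) by auto
  then have "\<not> collinear {0, u, v}" using collinear_0_det2 by blast
  then show ?thesis unfolding parallelogram_def A(1) measure_parallelogram[OF nz] using A(2) by blast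
qed

lemma unit_interval_split:
  fixes t :: real
  assumes "0 \<le> t" "t \<le> real n" "0 < n"
  obtains i \<sigma> where "i < n" "t = real i + \<sigma>" "0 \<le> \<sigma>" "\<sigma> \<le> 1"
proof (cases "t = real n")
  case True
  then show ?thesis using that[of "n - 1" 1] assms(3) by (simp add: of_nat_diff)
next
  case False
  define i where "i = nat \<lfloor>t\<rfloor>"
  have "real i = of_int \<lfloor>t\<rfloor>" using assms(1) unfolding i_def by simp
  then have "real i \<le> t" "t < real i + 1" by linarith+
  moreover then have "i < n" using False assms(2) by linarith
  ultimately show ?thesis using that[of i "t - real i"] by simp
qed

section \<open>The grid polynomial defines a nodal curve\<close>

context grid
begin

lemma pt_diff: "pt (Suc i) j - pt i j = (1, 0)" "pt i (Suc j) - pt i j = (0, 1)"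
  "pt (Suc i) (Suc j) - pt i j = (1, 1)"
  by (simp_all add: pt_def)

lemma unimod_lower: "unimod_triangle {pt i j, pt (Suc i) j, pt (Suc i) (Suc j)}"
  unfolding unimod_triangle_def
  by (intro exI[of _ "pt i j"] exI[of _ "(1, 0)"] exI[of _ "(1, 1)"]) (simp add: det2_def pt_def add.commute)

lemma unimod_upper: "unimod_triangle {pt i j, pt i (Suc j), pt (Suc i) (Suc j)}"
  unfolding unimod_triangle_def
  by (intro exI[of _ "pt i j"] exI[of _ "(0, 1)"] exI[of _ "(1, 1)"]) (simp add: det2_def pt_def add.commute)

lemma unimod_square: "unimod_parallelogram (square i j)"
  unfolding unimod_parallelogram_def square_def
  by (intro exI[of _ "pt i j"] exI[of _ "(1, 0)"] exI[of _ "(0, 1)"]) (simp add: det2_def pt_def add.commute)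

lemma hull_lower:
  assumes "0 \<le> \<tau>" "\<tau> \<le> \<sigma>" "\<sigma> \<le> 1"
  shows "pt i j + (\<sigma>, \<tau>) \<in> convex hull {pt i j, pt (Suc i) j, pt (Suc i) (Suc j)}"
proof -
  have "pt i j + (\<sigma>, \<tau>) = (1 - \<sigma>) *\<^sub>R pt i j + (\<sigma> - \<tau>) *\<^sub>R pt (Suc i) j + \<tau> *\<^sub>R pt (Suc i) (Suc j)"
    by (simp add: pt_def algebra_simps)
  moreover have "0 \<le> 1 - \<sigma>" "0 \<le> \<sigma> - \<tau>" "(1 - \<sigma>) + (\<sigma> - \<tau>) + \<tau> = 1" using assms by simp_all
  ultimately show ?thesis unfolding convex_hull_3 using assms(1) by blast
qed

lemma hull_upper:
  assumes "0 \<le> \<sigma>" "\<sigma> \<le> \<tau>" "\<tau> \<le> 1"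
  shows "pt i j + (\<sigma>, \<tau>) \<in> convex hull {pt i j, pt i (Suc j), pt (Suc i) (Suc j)}"
proof -
  have "pt i j + (\<sigma>, \<tau>) = (1 - \<tau>) *\<^sub>R pt i j + (\<tau> - \<sigma>) *\<^sub>R pt i (Suc j) + \<sigma> *\<^sub>R pt (Suc i) (Suc j)"
    by (simp add: pt_def algebra_simps)
  moreover have "0 \<le> 1 - \<tau>" "0 \<le> \<tau> - \<sigma>" "(1 - \<tau>) + (\<tau> - \<sigma>) + \<sigma> = 1" using assms by simp_all
  ultimately show ?thesis unfolding convex_hull_3 using assms(1) by blast
qed

lemma cell_in_dual: "\<not> collinear (M x) \<Longrightarrow> convex hull M x \<in> dual_subdivision gpoly"
  unfolding dual_subdivision_iff[OF is_trop_poly_gpoly] by blast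

lemma newton_polygon_box: "newton_polygon gpoly \<subseteq> cbox (0, 0) (real a, real b)"
  unfolding newton_polygon_def
proof (rule hull_minimal)
  show "supp gpoly \<subseteq> cbox (0, 0) (real a, real b)" by (auto simp: supp_gpoly pt_def cbox_Pair_eq)
qed (rule convex_box)

text \<open>Each half of a unit square lies in a cell: the triangle itself if the square is cut, the
  whole square otherwise.\<close>

lemma box_covered:
  assumes "p \<in> cbox (0, 0) (real a, real b)"
  shows "\<exists>x. \<not> collinear (M x) \<and> p \<in> convex hull M x"
proof -
  have p: "0 \<le> fst p" "fst p \<le> real a" "0 \<le> snd p" "snd p \<le> real b"
    using assms by (cases p; simp add: cbox_Pair_eq)+
  obtain i \<sigma> where i: "i < a" "fst p = real i + \<sigma>" "0 \<le> \<sigma>" "\<sigma> \<le> 1"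
    using unit_interval_split[OF p(1,2) a_pos] .
  obtain j \<tau> where j: "j < b" "snd p = real j + \<tau>" "0 \<le> \<tau>" "\<tau> \<le> 1"
    using unit_interval_split[OF p(3,4) b_pos] .
  have pp: "p = pt i j + (\<sigma>, \<tau>)" using i(2) j(2) by (simp add: pt_def prod_eq_iff)
  have low: "p \<in> convex hull {pt i j, pt (Suc i) j, pt (Suc i) (Suc j)}" if "\<tau> \<le> \<sigma>"
    unfolding pp using hull_lower that i j by blast
  have up: "p \<in> convex hull {pt i j, pt i (Suc j), pt (Suc i) (Suc j)}" if "\<sigma> \<le> \<tau>"
    unfolding pp using hull_upper that i j by blast
  show ?thesis
  proof (cases "s i j")
    case True
    show ?thesis
    proof (cases "\<tau> \<le> \<sigma>")
      case t: True
      then show ?thesis using low M_L[OF i(1) j(1) True] unimod_lower[of i j] unimod_not_collinear by metis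
    next
      case False
      then have "\<sigma> \<le> \<tau>" by simp
      then show ?thesis using up M_U[OF i(1) j(1) True] unimod_upper[of i j] unimod_not_collinear by metis
    qed
  next
    case False
    have "convex hull {pt i j, pt (Suc i) j, pt (Suc i) (Suc j)} \<subseteq> convex hull (square i j)"
      "convex hull {pt i j, pt i (Suc j), pt (Suc i) (Suc j)} \<subseteq> convex hull (square i j)"
      unfolding square_def by (rule hull_mono, blast)+
    then have "p \<in> convex hull (square i j)" using low up by (meson linear subsetD)
    then show ?thesis using M_N[OF i(1) j(1) False] unimod_square[of i j] unimod_not_collinear by metis
  qed
qed

lemma cell_types:
  assumes "\<not> collinear (M x)"
  shows "unimod_triangle (M x) \<or> unimod_parallelogram (M x)"
  using assms by (cases rule: M_noncollinear) (simp_all only: unimod_lower unimod_upper unimod_square simp_thms)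

lemma supp_noncollinear: "\<not> collinear (supp gpoly)"
proof
  assume "collinear (supp gpoly)"
  moreover have "pt 0 0 \<in> supp gpoly" "pt (Suc 0) 0 \<in> supp gpoly" "pt 0 (Suc 0) \<in> supp gpoly"
    using a_pos b_pos by simp_all
  ultimately have "det2 (pt (Suc 0) 0 - pt 0 0) (pt 0 (Suc 0) - pt 0 0) = 0" unfolding collinear_det2 by blast
  then show False unfolding pt_diff by (simp add: det2_def)
qed

lemma newton_polygon_lattice_points: "newton_polygon gpoly \<inter> \<int> \<times> \<int> = supp gpoly"
proof
  show "supp gpoly \<subseteq> newton_polygon gpoly \<inter> \<int> \<times> \<int>"
    using hull_subset[of "supp gpoly" convex] supp_int_pair[OF is_trop_poly_gpoly] unfolding newton_polygon_def by blast
  show "newton_polygon gpoly \<inter> \<int> \<times> \<int> \<subseteq> supp gpoly"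
  proof
    fix p assume p: "p \<in> newton_polygon gpoly \<inter> \<int> \<times> \<int>"
    then have "p \<in> cbox (0, 0) (real a, real b)" using newton_polygon_box by blast
    then have bd: "0 \<le> fst p" "fst p \<le> real a" "0 \<le> snd p" "snd p \<le> real b"
      by (cases p; simp add: cbox_Pair_eq)+
    obtain x y where xy: "fst p = of_int x" "snd p = of_int y" using p by (auto elim!: Ints_cases)
    have "p = pt (nat x) (nat y)" "nat x \<le> a" "nat y \<le> b" using bd xy by (auto simp: pt_def prod_eq_iff)
    then show "p \<in> supp gpoly" by simp
  qed
qed

lemma nodal_gpoly: "nodal_tropical_curve gpoly"
proof -
  let ?P = "newton_polygon gpoly" and ?D = "dual_subdivision gpoly"
  note iff = dual_subdivision_iff[OF is_trop_poly_gpoly]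
  note tp = is_trop_poly_gpoly
  have "lattice_polygon ?P" unfolding newton_polygon_def
    by (rule lattice_polygon_hull[OF finite_supp[OF tp] supp_int_pair[OF tp] supp_noncollinear])
  moreover have "finite ?D"
  proof (rule finite_subset)
    show "?D \<subseteq> (\<lambda>A. convex hull A) ` Pow (supp gpoly)" unfolding subset_iff iff using max_terms_subset by blast
    show "finite ((\<lambda>A. convex hull A) ` Pow (supp gpoly))" using finite_supp[OF tp] by simp
  qed
  moreover have "\<forall>\<sigma>\<in>?D. lattice_polygon \<sigma>"
  proof
    fix \<sigma> assume "\<sigma> \<in> ?D"
    then show "lattice_polygon \<sigma>"
      unfolding iff using lattice_polygon_hull[OF finite_max_terms[OF tp] max_terms_int[OF tp]] by blast
  qed
  moreover have "\<Union>?D = ?P"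
  proof
    show "\<Union>?D \<subseteq> ?P"
    proof (rule Union_least)
      fix \<sigma> assume "\<sigma> \<in> ?D"
      then show "\<sigma> \<subseteq> ?P" unfolding iff newton_polygon_def using hull_mono[OF max_terms_subset] by blast
    qed
    show "?P \<subseteq> \<Union>?D"
    proof
      fix p assume "p \<in> ?P"
      then have "p \<in> cbox (0, 0) (real a, real b)" using newton_polygon_box by blast
      then obtain x where "\<not> collinear (M x)" "p \<in> convex hull M x" using box_covered by blast
      then show "p \<in> \<Union>?D" using cell_in_dual by blast
    qed
  qed
  moreover have "\<forall>\<sigma>\<in>?D. \<forall>\<tau>\<in>?D. (\<sigma> \<inter> \<tau>) face_of \<sigma> \<and> (\<sigma> \<inter> \<tau>) face_of \<tau>"
  proof (intro ballI)
    fix \<sigma> \<tau> assume "\<sigma> \<in> ?D" "\<tau> \<in> ?D"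
    then obtain x y where xy: "\<sigma> = dual_face gpoly x" "\<tau> = dual_face gpoly y" unfolding iff dual_face_def by blast
    show "(\<sigma> \<inter> \<tau>) face_of \<sigma> \<and> (\<sigma> \<inter> \<tau>) face_of \<tau>"
      using dual_faces_meet[OF tp, of x y] dual_faces_meet[OF tp, of y x] unfolding xy by (simp add: Int_commute)
  qed
  ultimately have "lattice_subdivision ?P ?D" unfolding lattice_subdivision_def by blast
  \<comment> \<open>The support contains every lattice point of the polygon, so the coefficients
    themselves are an admissible height function.\<close>
  moreover have "?D = induced_cells (?P \<inter> \<int> \<times> \<int>) (coef gpoly)"
    unfolding newton_polygon_lattice_points dual_subdivision_def ..
  moreover have "\<forall>\<sigma>\<in>?D. triangle \<sigma> \<and> measure lebesgue \<sigma> = 1/2 \<or> parallelogram \<sigma> \<and> measure lebesgue \<sigma> = 1"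
  proof
    fix \<sigma> assume "\<sigma> \<in> ?D"
    then obtain x where "\<sigma> = convex hull M x" "\<not> collinear (M x)" unfolding iff by blast
    then show "triangle \<sigma> \<and> measure lebesgue \<sigma> = 1/2 \<or> parallelogram \<sigma> \<and> measure lebesgue \<sigma> = 1"
      using cell_types unimod_triangle_hull unimod_parallelogram_hull by blast
  qed
  ultimately show ?thesis
    unfolding nodal_tropical_curve_def nodal_subdivision_def regular_subdivision_def using tp by blast
qed

lemma curve_vertices_gpoly:
  "v \<in> curve_vertices gpoly \<longleftrightarrow> (\<exists>i j. i < a \<and> j < b \<and> s i j \<and> (v = L i j \<or> v = U i j))"
proof
  assume "v \<in> curve_vertices gpoly"
  then have u: "unimod_triangle (M v)" unfolding curve_vertices_iff[OF nodal_gpoly] .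
  then have nc: "\<not> collinear (M v)" using unimod_not_collinear by blast
  then show "\<exists>i j. i < a \<and> j < b \<and> s i j \<and> (v = L i j \<or> v = U i j)"
  proof (cases rule: M_noncollinear)
    case (1 i j)
    then have "M v = M (L i j)" using M_L by simp
    then have "v = L i j" using vertex_unique[OF is_trop_poly_gpoly] nc by (metis Int_absorb)
    then show ?thesis using 1 by blast
  next
    case (2 i j)
    then have "M v = M (U i j)" using M_U by simp
    then have "v = U i j" using vertex_unique[OF is_trop_poly_gpoly] nc by (metis Int_absorb)
    then show ?thesis using 2 by blast
  next
    case (3 i j)
    then show ?thesis using u card_unimod(1)[OF u] card_unimod(2)[OF unimod_square[of i j]] by simp
  qed
next
  assume "\<exists>i j. i < a \<and> j < b \<and> s i j \<and> (v = L i j \<or> v = U i j)"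
  then show "v \<in> curve_vertices gpoly"
    unfolding curve_vertices_iff[OF nodal_gpoly] using M_L M_U unimod_lower unimod_upper by metis
qed

lemma card_nodes_gpoly: "card (nodes gpoly) \<le> a * b"
proof -
  have "nodes gpoly \<subseteq> (\<lambda>(i, j). N i j) ` ({..<a} \<times> {..<b})"
  proof
    fix v assume "v \<in> nodes gpoly"
    then have u: "unimod_parallelogram (M v)" unfolding nodes_iff[OF nodal_gpoly] .
    then have nc: "\<not> collinear (M v)" using unimod_not_collinear by blast
    then show "v \<in> (\<lambda>(i, j). N i j) ` ({..<a} \<times> {..<b})"
    proof (cases rule: M_noncollinear)
      case (1 i j)
      then show ?thesis using card_unimod(2)[OF u] card_unimod(1)[OF unimod_lower[of i j]] by simp
    next
      case (2 i j)
      then show ?thesis using card_unimod(2)[OF u] card_unimod(1)[OF unimod_upper[of i j]] by simp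
    next
      case (3 i j)
      then have "M v = M (N i j)" using M_N by simp
      then have "v = N i j" using vertex_unique[OF is_trop_poly_gpoly] nc by (metis Int_absorb)
      then show ?thesis using 3 by force
    qed
  qed
  then have "card (nodes gpoly) \<le> card ((\<lambda>(i, j). N i j) ` ({..<a} \<times> {..<b}))" by (intro card_mono) auto
  also have "\<dots> \<le> card ({..<a} \<times> {..<b})" by (rule card_image_le) simp
  finally show ?thesis by (simp add: card_cartesian_product)
qed

section \<open>Edges of the grid curve\<close>

lemma vertex_band:
  assumes "i < a" "j < b"
  shows "band1 i (fst (L i j))" "band1 i (fst (U i j))" "band2 j (snd (L i j))" "band2 j (snd (U i j))"
  using assms band1_X1 band2_X2 by (simp_all add: L_def U_def)

lemma M_contains_square:
  assumes "v \<in> curve_vertices gpoly"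
  obtains i j where "i < a" "j < b" "s i j" "pt i j \<in> M v" "pt (Suc i) (Suc j) \<in> M v" "v = L i j \<or> v = U i j"
proof -
  obtain i j where ij: "i < a" "j < b" "s i j" "v = L i j \<or> v = U i j"
    using assms unfolding curve_vertices_gpoly by blast
  have "pt i j \<in> M v" "pt (Suc i) (Suc j) \<in> M v" using ij(4) M_L[OF ij(1-3)] M_U[OF ij(1-3)] by auto
  then show ?thesis using that ij by blast
qed

lemma tropical_curveI: "p \<in> M x \<Longrightarrow> q \<in> M x \<Longrightarrow> p \<noteq> q \<Longrightarrow> x \<in> tropical_curve gpoly"
  unfolding tropical_curve_def using two_le_card[OF finite_max_terms[OF is_trop_poly_gpoly]] by blast

lemma strand_edge:
  assumes "d \<noteq> 0" "0 < t" "v \<in> curve_vertices gpoly" "v + t *\<^sub>R d \<in> curve_vertices gpoly"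
    "\<And>r. 0 < r \<Longrightarrow> r < t \<Longrightarrow> v + r *\<^sub>R d \<in> tropical_curve gpoly - curve_vertices gpoly"
  shows "{v, v + t *\<^sub>R d} \<in> edges (bounded_part gpoly)"
proof -
  have "open_segment v (v + t *\<^sub>R d) \<subseteq> tropical_curve gpoly - curve_vertices gpoly"
    unfolding subset_iff open_segment_iff[OF assms(1,2)] using assms(5) by blast
  then show ?thesis unfolding edge_pair using assms by simp
qed

lemma edge_diagonal:
  assumes ij: "i < a" "j < b" "s i j"
  shows "{L i j, U i j} \<in> edges (bounded_part gpoly)"
proof -
  have U: "U i j = L i j + 1 *\<^sub>R (- 1, 1)" by (simp add: L_def U_def)
  have V: "L i j \<in> curve_vertices gpoly" "U i j \<in> curve_vertices gpoly" using ij curve_vertices_gpoly by blast+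
  have "L i j + r *\<^sub>R (- 1, 1) \<in> tropical_curve gpoly - curve_vertices gpoly" if r: "0 < r" "r < 1" for r
  proof -
    define z where "z = L i j + r *\<^sub>R (- 1, 1 :: real)"
    have z: "fst z = X1 i j + - r" "snd z = X2 i j + (r - 1)" by (simp_all add: z_def L_def)
    have "band1 i (fst z)" "band2 j (snd z)"
      using r band1_X1(1)[of j i] band1_X1(2)[OF ij(2), of i] band2_X2(1)[of i j] band2_X2(2)[OF ij(1), of j] ij
      unfolding z band1_def band2_def by linarith+
    then have sub: "M z \<subseteq> square i j" by (rule M_band_square[OF _ ij(1) _ ij(2)])
    note m = M_square[OF sub ij(1,2) z]
    have in2: "pt i j \<in> M z" "pt (Suc i) (Suc j) \<in> M z" using m(1,4) r ij(3) by simp_all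
    then have "z \<in> tropical_curve gpoly" by (rule tropical_curveI) simp
    moreover have "M z \<subseteq> {pt i j, pt (Suc i) (Suc j)}" using sub m(2,3) r unfolding square_def by auto
    then have "card (M z) \<le> 2" using card_mono[of "{pt i j, pt (Suc i) (Suc j)}" "M z"] by simp
    then have "z \<notin> curve_vertices gpoly"
      unfolding curve_vertices_iff[OF nodal_gpoly] using card_unimod(1) by fastforce
    ultimately show ?thesis unfolding z_def by blast
  qed
  then show ?thesis unfolding U using V by (intro strand_edge) (simp_all add: U zero_prod_def)
qed

text \<open>The vertical line \<open>i\<close> leaves a resolved crossing upwards from
  \<open>U\<close> and keeps its abscissa through unresolved crossings until it enters the next
  resolved one at \<open>L\<close>. Along the way the columns \<open>i\<close> and
  \<open>i + 1\<close> tie, and only rows above \<open>j\<close> and up to \<open>j'\<close>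
  compete.\<close>

lemma edge_up:
  assumes ij: "i < a" "j < j'" "j' < b" "s i j" "s i j'" and no: "\<And>l. j < l \<Longrightarrow> l < j' \<Longrightarrow> \<not> s i l"
  shows "{U i j, L i j'} \<in> edges (bounded_part gpoly)"
proof -
  have X: "X1 i l = X1 i j - 1" if "j < l" "l \<le> j'" for l
  proof -
    have "X1 i l = X1 i (Suc j)" by (rule X1_const) (use that no in auto)
    then show ?thesis using ij(4) by (simp add: X1_Suc)
  qed
  have X2c: "X2 (Suc i) j = X2 i j - 1" "X2 (Suc i) j' = X2 i j' - 1" using ij by (simp_all add: X2_Suc)
  define t where "t = X2 i j' - 1 - X2 i j"
  have lt: "X2 i j < X2 i j' - 1"
    by (rule band2_less[OF ij(2) band2_X2(1) band2_X2(2)]) (use ij in simp_all)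
  have L: "L i j' = U i j + t *\<^sub>R (0, 1)" using X[of j'] ij by (simp add: L_def U_def t_def)
  have "j < b" using ij by simp
  then have V: "U i j \<in> curve_vertices gpoly" "L i j' \<in> curve_vertices gpoly"
    unfolding curve_vertices_gpoly using ij by blast+
  have "U i j + r *\<^sub>R (0, 1) \<in> tropical_curve gpoly - curve_vertices gpoly" if r: "0 < r" "r < t" for r
  proof -
    define z where "z = U i j + r *\<^sub>R (0, 1 :: real)"
    have z: "fst z = X1 i j - 1" "X2 i j < snd z" "snd z < X2 i j' - 1" using r by (simp_all add: z_def U_def t_def)
    have bz: "band1 i (fst z)" unfolding z(1) using band1_X1(2) ij by simp
    have kl: "(k = i \<or> k = Suc i) \<and> j < l \<and> l \<le> j'" if kl: "pt k l \<in> M z" for k l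
    proof -
      have k: "k = i \<or> k = Suc i" by (rule M_band1[OF kl bz ij(1)])
      have bd: "k \<le> a" "l \<le> b" using kl unfolding pt_M by blast+
      have "j < l"
      proof (rule ccontr)
        assume "\<not> j < l"
        then have le: "l \<le> j" by simp
        then have up: "snd z \<le> X2 k l" using M_up[OF kl] ij by simp
        show False
        proof (cases "l = j")
          case True
          then show False using up z(2) k X2c(1) by auto
        next
          case False
          then have "X2 k l < X2 i j" using le bd ij by (intro band2_less[of l j] band2_X2(1)) auto
          then show False using up z(2) by simp
        qed
      qed
      moreover have "l \<le> j'"
      proof (rule ccontr)
        assume "\<not> l \<le> j'"
        then obtain l' where l': "l = Suc l'" "j' \<le> l'" by (cases l) auto
        then have down: "X2 k l' \<le> snd z" using M_down kl by simp
        show False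
        proof (cases "l' = j'")
          case True
          then show False using down z(3) k X2c(2) by auto
        next
          case False
          then have "X2 i j' < X2 k l'" using l' bd ij by (intro band2_less[of j' l'] band2_X2(1)) auto
          then show False using down z(3) by simp
        qed
      qed
      ultimately show ?thesis using k by blast
    qed
    obtain p where "p \<in> M z" using max_terms_nonempty[OF is_trop_poly_gpoly] by blast
    then obtain k l where pkl: "pt k l \<in> M z" using M_cases by metis
    then have c: "k = i \<or> k = Suc i" "j < l" "l \<le> j'" "l \<le> b" using kl[OF pkl] unfolding pt_M by blast+
    have eq: "val z (Suc i) l = val z i l" using val_right[of z i l] X[OF c(2,3)] z(1) by simp
    then have "pt i l \<in> M z" "pt (Suc i) l \<in> M z"
      using pkl c(1,4) ij(1) unfolding pt_M by auto
    then have "z \<in> tropical_curve gpoly" by (rule tropical_curveI) simp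
    moreover have "z \<notin> curve_vertices gpoly"
    proof
      assume "z \<in> curve_vertices gpoly"
      then obtain k l where kl': "s k l" "pt k l \<in> M z" "pt (Suc k) (Suc l) \<in> M z" using M_contains_square by metis
      then have "k = i" "j < l" "l < j'" using kl[OF kl'(2)] kl[OF kl'(3)] by auto
      then show False using no kl'(1) by blast
    qed
    ultimately show ?thesis unfolding z_def by blast
  qed
  then show ?thesis unfolding L using V lt by (intro strand_edge) (simp_all add: L t_def zero_prod_def)
qed

text \<open>The counterpart for rows: a horizontal line leaves a resolved crossing to the right from
  \<open>L\<close> and enters the next one at \<open>U\<close>.\<close>

lemma edge_right:
  assumes ij: "j < b" "i < i'" "i' < a" "s i j" "s i' j" and no: "\<And>k. i < k \<Longrightarrow> k < i' \<Longrightarrow> \<not> s k j"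
  shows "{L i j, U i' j} \<in> edges (bounded_part gpoly)"
proof -
  have X: "X2 k j = X2 i j - 1" if "i < k" "k \<le> i'" for k
  proof -
    have "X2 k j = X2 (Suc i) j" by (rule X2_const) (use that no in auto)
    then show ?thesis using ij(4) by (simp add: X2_Suc)
  qed
  have X1c: "X1 i (Suc j) = X1 i j - 1" "X1 i' (Suc j) = X1 i' j - 1" using ij by (simp_all add: X1_Suc)
  define t where "t = X1 i' j - 1 - X1 i j"
  have lt: "X1 i j < X1 i' j - 1"
    by (rule band1_less[OF ij(2) band1_X1(1) band1_X1(2)]) (use ij in simp_all)
  have L: "U i' j = L i j + t *\<^sub>R (1, 0)" using X[of i'] ij by (simp add: L_def U_def t_def)
  have "i < a" using ij by simp
  then have V: "L i j \<in> curve_vertices gpoly" "U i' j \<in> curve_vertices gpoly"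
    unfolding curve_vertices_gpoly using ij by blast+
  have "L i j + r *\<^sub>R (1, 0) \<in> tropical_curve gpoly - curve_vertices gpoly" if r: "0 < r" "r < t" for r
  proof -
    define z where "z = L i j + r *\<^sub>R (1 :: real, 0 :: real)"
    have z: "snd z = X2 i j - 1" "X1 i j < fst z" "fst z < X1 i' j - 1" using r by (simp_all add: z_def L_def t_def)
    have bz: "band2 j (snd z)" unfolding z(1) using band2_X2(2) ij by simp
    have kl: "(l = j \<or> l = Suc j) \<and> i < k \<and> k \<le> i'" if kl: "pt k l \<in> M z" for k l
    proof -
      have k: "l = j \<or> l = Suc j" by (rule M_band2[OF kl bz ij(1)])
      have bd: "k \<le> a" "l \<le> b" using kl unfolding pt_M by blast+
      have "i < k"
      proof (rule ccontr)
        assume "\<not> i < k"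
        then have le: "k \<le> i" by simp
        then have up: "fst z \<le> X1 k l" using M_right[OF kl] ij by simp
        show False
        proof (cases "k = i")
          case True
          then show False using up z(2) k X1c(1) by auto
        next
          case False
          then have "X1 k l < X1 i j" using le bd ij by (intro band1_less[of k i] band1_X1(1)) auto
          then show False using up z(2) by simp
        qed
      qed
      moreover have "k \<le> i'"
      proof (rule ccontr)
        assume "\<not> k \<le> i'"
        then obtain k' where k': "k = Suc k'" "i' \<le> k'" by (cases k) auto
        then have down: "X1 k' l \<le> fst z" using M_left kl by simp
        show False
        proof (cases "k' = i'")
          case True
          then show False using down z(3) k X1c(2) by auto
        next
          case False
          then have "X1 i' j < X1 k' l" using k' bd ij by (intro band1_less[of i' k'] band1_X1(1)) auto
          then show False using down z(3) by simp
        qed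
      qed
      ultimately show ?thesis using k by blast
    qed
    obtain p where "p \<in> M z" using max_terms_nonempty[OF is_trop_poly_gpoly] by blast
    then obtain k l where pkl: "pt k l \<in> M z" using M_cases by metis
    then have c: "l = j \<or> l = Suc j" "i < k" "k \<le> i'" "k \<le> a" using kl[OF pkl] unfolding pt_M by blast+
    have eq: "val z k (Suc j) = val z k j" using val_up[of z k j] X[OF c(2,3)] z(1) by simp
    then have "pt k j \<in> M z" "pt k (Suc j) \<in> M z"
      using pkl c(1,4) ij(1) unfolding pt_M by auto
    then have "z \<in> tropical_curve gpoly" by (rule tropical_curveI) simp
    moreover have "z \<notin> curve_vertices gpoly"
    proof
      assume "z \<in> curve_vertices gpoly"
      then obtain k l where kl': "s k l" "pt k l \<in> M z" "pt (Suc k) (Suc l) \<in> M z" using M_contains_square by metis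
      then have "l = j" "i < k" "k < i'" using kl[OF kl'(2)] kl[OF kl'(3)] by auto
      then show False using no kl'(1) by blast
    qed
    ultimately show ?thesis unfolding z_def by blast
  qed
  then show ?thesis unfolding L using V lt by (intro strand_edge) (simp_all add: L t_def zero_prod_def)
qed

text \<open>One case for each corner of the triangle dual to \<open>L i j\<close>. In the diagonal
  direction the edge is already known, and edges with a common strand agree.\<close>

lemma edge_L:
  assumes ij: "i < a" "j < b" "s i j" and e: "{L i j, w} \<in> edges (bounded_part gpoly)"
  shows "fst w = fst (L i j) \<and> snd w < snd (L i j) \<or> snd w = snd (L i j) \<and> fst (L i j) < fst w \<or> w = U i j"
proof -
  obtain c where c: "exit_dir (M (L i j)) c (w - L i j)" using edge_exit_dir[OF nodal_gpoly e] by blast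
  define d where "d = w - L i j"
  have inn: "pt k l \<bullet> d = real k * fst d + real l * snd d" for k l by (simp add: pt_def inner_pair)
  have "c \<in> {pt i j, pt (Suc i) j, pt (Suc i) (Suc j)}" using c M_L[OF ij] unfolding exit_dir_def by simp
  then consider "c = pt i j" | "c = pt (Suc i) j" | "c = pt (Suc i) (Suc j)" by blast
  then show ?thesis
  proof cases
    case 1
    have "M (L i j) = {pt (Suc i) j, pt (Suc i) (Suc j), pt i j}" unfolding M_L[OF ij] by blast
    then have "exit_dir {pt (Suc i) j, pt (Suc i) (Suc j), pt i j} (pt i j) d" using c 1 d_def by simp
    then have "snd d = 0" "0 < fst d" by (subst (asm) exit_dir_3; simp add: inn algebra_simps)+
    then show ?thesis unfolding d_def by simp
  next
    case 2
    have "M (L i j) = {pt i j, pt (Suc i) (Suc j), pt (Suc i) j}" unfolding M_L[OF ij] by blast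
    moreover have "exit_dir {pt i j, pt (Suc i) (Suc j), pt (Suc i) j} (pt (Suc i) j) (U i j - L i j)"
      by (subst exit_dir_3) (simp_all add: pt_def inner_pair L_def U_def)
    ultimately have "exit_dir (M (L i j)) c (U i j - L i j)" using 2 by simp
    then have "w = U i j" using edge_unique[OF nodal_gpoly e edge_diagonal[OF ij] c] by blast
    then show ?thesis by blast
  next
    case 3
    have "M (L i j) = {pt i j, pt (Suc i) j, pt (Suc i) (Suc j)}" by (rule M_L[OF ij])
    then have "exit_dir {pt i j, pt (Suc i) j, pt (Suc i) (Suc j)} (pt (Suc i) (Suc j)) d" using c 3 d_def by simp
    then have "fst d = 0 \<and> snd d < 0" by (subst (asm) exit_dir_3; simp add: inn algebra_simps)
    then show ?thesis unfolding d_def by simp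
  qed
qed

lemma edge_U:
  assumes ij: "i < a" "j < b" "s i j" and e: "{U i j, w} \<in> edges (bounded_part gpoly)"
  shows "fst w = fst (U i j) \<and> snd (U i j) < snd w \<or> snd w = snd (U i j) \<and> fst w < fst (U i j) \<or> w = L i j"
proof -
  obtain c where c: "exit_dir (M (U i j)) c (w - U i j)" using edge_exit_dir[OF nodal_gpoly e] by blast
  define d where "d = w - U i j"
  have inn: "pt k l \<bullet> d = real k * fst d + real l * snd d" for k l by (simp add: pt_def inner_pair)
  have "c \<in> {pt i j, pt i (Suc j), pt (Suc i) (Suc j)}" using c M_U[OF ij] unfolding exit_dir_def by simp
  then consider "c = pt i j" | "c = pt i (Suc j)" | "c = pt (Suc i) (Suc j)" by blast
  then show ?thesis
  proof cases
    case 1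
    have "M (U i j) = {pt i (Suc j), pt (Suc i) (Suc j), pt i j}" unfolding M_U[OF ij] by blast
    then have "exit_dir {pt i (Suc j), pt (Suc i) (Suc j), pt i j} (pt i j) d" using c 1 d_def by simp
    then have "fst d = 0" "0 < snd d" by (subst (asm) exit_dir_3; simp add: inn algebra_simps)+
    then show ?thesis unfolding d_def by simp
  next
    case 2
    have "M (U i j) = {pt i j, pt (Suc i) (Suc j), pt i (Suc j)}" unfolding M_U[OF ij] by blast
    moreover have "exit_dir {pt i j, pt (Suc i) (Suc j), pt i (Suc j)} (pt i (Suc j)) (L i j - U i j)"
      by (subst exit_dir_3) (simp_all add: pt_def inner_pair L_def U_def)
    ultimately have "exit_dir (M (U i j)) c (L i j - U i j)" using 2 by simp
    moreover have "{U i j, L i j} \<in> edges (bounded_part gpoly)" using edge_diagonal[OF ij] by (simp add: insert_commute)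
    ultimately have "w = L i j" using edge_unique[OF nodal_gpoly e _ c] by blast
    then show ?thesis by blast
  next
    case 3
    have "M (U i j) = {pt i j, pt i (Suc j), pt (Suc i) (Suc j)}" by (rule M_U[OF ij])
    then have "exit_dir {pt i j, pt i (Suc j), pt (Suc i) (Suc j)} (pt (Suc i) (Suc j)) d" using c 3 d_def by simp
    then have "snd d = 0 \<and> fst d < 0" by (subst (asm) exit_dir_3; simp add: inn algebra_simps)
    then show ?thesis unfolding d_def by simp
  qed
qed

end

section \<open>Free lines are excluded; the vertices are indexed\<close>

context grid
begin

text \<open>All horizontal strands have positive ordinate because \<open>K\<close> exceeds
  \<open>a\<close>, so below them only the bottom row competes.\<close>

lemma M_bottom: "pt k l \<in> M x \<Longrightarrow> snd x \<le> 0 \<Longrightarrow> l = 0"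
proof (cases l)
  case (Suc l')
  assume p: "pt k l \<in> M x" "snd x \<le> 0"
  then have "k \<le> a" "X2 k l' \<le> snd x" using M_down Suc unfolding pt_M by blast+
  moreover have "K * 1 \<le> K * (2 * real l' + 1)" using K_pos by (intro mult_left_mono) auto
  ultimately have False using p(2) cy_bounds(2)[of k l'] K_pos by (simp add: X2_def)
  then show ?thesis ..
qed simp

lemma M_leftmost: "pt k l \<in> M x \<Longrightarrow> fst x \<le> 0 \<Longrightarrow> k = 0"
proof (cases k)
  case (Suc k')
  assume p: "pt k l \<in> M x" "fst x \<le> 0"
  then have "l \<le> b" "X1 k' l \<le> fst x" using M_left Suc unfolding pt_M by blast+
  moreover have "K * 1 \<le> K * (2 * real k' + 1)" using K_pos by (intro mult_left_mono) auto
  ultimately have False using p(2) cx_bounds(2)[of k' l] K_pos by (simp add: X1_def)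
  then show ?thesis ..
qed simp

text \<open>In an oblique direction a single corner of the rectangle is maximal, so far out the line
  would leave the curve.\<close>

lemma line_axis_parallel:
  assumes d: "d \<noteq> 0" and line: "\<And>t. x + t *\<^sub>R d \<in> tropical_curve gpoly"
  shows "fst d = 0 \<or> snd d = 0"
proof (rule ccontr)
  assume "\<not> ?thesis"
  then have nz: "fst d \<noteq> 0" "snd d \<noteq> 0" by blast+
  from eventually_happens[OF max_terms_far[OF is_trop_poly_gpoly, of x d]]
  obtain t where "M (x + t *\<^sub>R d) \<subseteq> argmax d (supp gpoly)" by auto
  moreover obtain p q where "p \<in> M (x + t *\<^sub>R d)" "q \<in> M (x + t *\<^sub>R d)" "p \<noteq> q"
    using two_distinct line[of t] unfolding tropical_curve_def by blast
  ultimately have pq: "p \<in> argmax d (supp gpoly)" "q \<in> argmax d (supp gpoly)" "p \<noteq> q" by blast+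
  define i0 j0 where "i0 = (if 0 < fst d then a else 0)" and "j0 = (if 0 < snd d then b else 0)"
  have "r = pt i0 j0" if r: "r \<in> argmax d (supp gpoly)" for r
  proof -
    obtain i j where ij: "r = pt i j" "i \<le> a" "j \<le> b" using r unfolding argmax_def supp_gpoly by blast
    have "pt i0 j0 \<in> supp gpoly" unfolding i0_def j0_def by simp
    then have "pt i0 j0 \<bullet> d \<le> pt i j \<bullet> d" using r ij(1) unfolding argmax_def by blast
    then have "(real i0 - real i) * fst d + (real j0 - real j) * snd d \<le> 0"
      by (simp add: pt_def inner_pair algebra_simps)
    moreover have "0 \<le> (real i0 - real i) * fst d" "0 \<le> (real j0 - real j) * snd d"
      using ij(2,3) by (auto simp: i0_def j0_def mult_le_0_iff not_less)
    ultimately have "(real i0 - real i) * fst d = 0" "(real j0 - real j) * snd d = 0" by linarith+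
    then show ?thesis using nz ij(1) by simp
  qed
  then show False using pq by blast
qed

text \<open>Traced to a point outside the arrangement, a line in the curve starts on one of the grid
  lines. It follows that grid line up to the first resolved crossing and meets a vertex there:
  \<open>L\<close> on a vertical line, \<open>U\<close> on a horizontal one.\<close>

lemma no_free_line:
  assumes cols: "\<And>i. i < a \<Longrightarrow> \<exists>j<b. s i j" and rows: "\<And>j. j < b \<Longrightarrow> \<exists>i<a. s i j"
  shows "\<not> (\<exists>x d. d \<noteq> 0 \<and> range (\<lambda>t. x + t *\<^sub>R d) \<subseteq> tropical_curve gpoly - curve_vertices gpoly)"
proof
  assume "\<exists>x d. d \<noteq> 0 \<and> range (\<lambda>t. x + t *\<^sub>R d) \<subseteq> tropical_curve gpoly - curve_vertices gpoly"
  then obtain x d where d: "d \<noteq> 0" and "range (\<lambda>t. x + t *\<^sub>R d) \<subseteq> tropical_curve gpoly - curve_vertices gpoly" by blast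
  then have line: "x + t *\<^sub>R d \<in> tropical_curve gpoly" "x + t *\<^sub>R d \<notin> curve_vertices gpoly" for t by blast+
  show False
  proof (cases "fst d = 0")
    case True
    then have sd: "snd d \<noteq> 0" using d by (simp add: prod_eq_iff)
    have on: "(fst x, y) = x + ((y - snd x) / snd d) *\<^sub>R d" for y using True sd by (simp add: prod_eq_iff)
    define z where "z = (fst x, - 1 :: real)"
    have "z \<in> tropical_curve gpoly" unfolding z_def on by (rule line)
    then obtain p q where pq: "p \<in> M z" "q \<in> M z" "p \<noteq> q" using two_distinct unfolding tropical_curve_def by blast
    obtain k l where kl: "p = pt k l" using M_cases[OF pq(1)] by metis
    obtain k' l' where kl': "q = pt k' l'" using M_cases[OF pq(2)] by metis
    have "l = 0" "l' = 0" using M_bottom pq kl kl' by (auto simp: z_def)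
    then have m: "pt k 0 \<in> M z" "pt k' 0 \<in> M z" "k \<noteq> k'" using pq kl kl' by auto
    have "\<exists>i. pt i 0 \<in> M z \<and> pt (Suc i) 0 \<in> M z"
    proof (cases "k < k'")
      case True
      then have "k' = Suc k" using M_columns[OF m(1,2)] by simp
      then show ?thesis using m by blast
    next
      case False
      then have "k = Suc k'" using M_columns[OF m(2,1)] m(3) by simp
      then show ?thesis using m by blast
    qed
    then obtain i where i: "pt i 0 \<in> M z" "pt (Suc i) 0 \<in> M z" by blast
    then have ia: "i < a" unfolding pt_M by simp
    have fx: "fst x = X1 i 0" using M_right[OF i(1) ia] M_left[OF i(2)] by (simp add: z_def)
    define j where "j = (LEAST j. s i j)"
    have sj: "s i j" "j < b" "\<And>l. l < j \<Longrightarrow> \<not> s i l"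
    proof -
      obtain j' where j': "j' < b" "s i j'" using cols[OF ia] by blast
      show "s i j" unfolding j_def using j'(2) by (rule LeastI)
      show "j < b" unfolding j_def using j' Least_le[of "s i" j'] by simp
      show "\<And>l. l < j \<Longrightarrow> \<not> s i l" unfolding j_def by (rule not_less_Least)
    qed
    have "X1 i j = X1 i 0" by (rule X1_const) (use sj(3) in auto)
    then have "L i j = (fst x, X2 i j - 1)" unfolding L_def fx by simp
    moreover have "L i j \<in> curve_vertices gpoly" unfolding curve_vertices_gpoly using ia sj by blast
    ultimately show False using line(2) unfolding on by simp
  next
    case False
    then have sd: "snd d = 0" using line_axis_parallel[OF d line(1)] by blast
    have on: "(y, snd x) = x + ((y - fst x) / fst d) *\<^sub>R d" for y using False sd by (simp add: prod_eq_iff)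
    define z where "z = (- 1 :: real, snd x)"
    have "z \<in> tropical_curve gpoly" unfolding z_def on by (rule line)
    then obtain p q where pq: "p \<in> M z" "q \<in> M z" "p \<noteq> q" using two_distinct unfolding tropical_curve_def by blast
    obtain k l where kl: "p = pt k l" using M_cases[OF pq(1)] by metis
    obtain k' l' where kl': "q = pt k' l'" using M_cases[OF pq(2)] by metis
    have "k = 0" "k' = 0" using M_leftmost pq kl kl' by (auto simp: z_def)
    then have m: "pt 0 l \<in> M z" "pt 0 l' \<in> M z" "l \<noteq> l'" using pq kl kl' by auto
    have "\<exists>j. pt 0 j \<in> M z \<and> pt 0 (Suc j) \<in> M z"
    proof (cases "l < l'")
      case True
      then have "l' = Suc l" using M_rows[OF m(1,2)] by simp
      then show ?thesis using m by blast
    next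
      case False
      then have "l = Suc l'" using M_rows[OF m(2,1)] m(3) by simp
      then show ?thesis using m by blast
    qed
    then obtain j where j: "pt 0 j \<in> M z" "pt 0 (Suc j) \<in> M z" by blast
    then have jb: "j < b" unfolding pt_M by simp
    have fx: "snd x = X2 0 j" using M_up[OF j(1) jb] M_down[OF j(2)] by (simp add: z_def)
    define i where "i = (LEAST i. s i j)"
    have si: "s i j" "i < a" "\<And>l. l < i \<Longrightarrow> \<not> s l j"
    proof -
      obtain i' where i': "i' < a" "s i' j" using rows[OF jb] by blast
      show "s i j" unfolding i_def using i'(2) by (rule LeastI)
      show "i < a" unfolding i_def using i' Least_le[of "\<lambda>i. s i j" i'] by simp
      show "\<And>l. l < i \<Longrightarrow> \<not> s l j" unfolding i_def by (rule not_less_Least)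
    qed
    have "X2 i j = X2 0 j" by (rule X2_const) (use si(3) in auto)
    then have "U i j = (X1 i j - 1, snd x)" unfolding U_def fx by simp
    moreover have "U i j \<in> curve_vertices gpoly" unfolding curve_vertices_gpoly using jb si by blast
    ultimately show False using line(2) unfolding on by simp
  qed
qed

lemma vertex_index_unique:
  assumes "v = L i j \<or> v = U i j" "v = L i' j' \<or> v = U i' j'" "i < a" "j < b" "i' < a" "j' < b"
  shows "i = i'" "j = j'"
proof -
  have "band1 i (fst v)" "band2 j (snd v)" using assms(1) vertex_band[OF assms(3,4)] by auto
  moreover have "band1 i' (fst v)" "band2 j' (snd v)" using assms(2) vertex_band[OF assms(5,6)] by auto
  ultimately show "i = i'" "j = j'" using band1_unique band2_unique by blast+
qed

definition V :: "bool \<times> nat \<times> nat \<Rightarrow> real \<times> real" where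
  "V = (\<lambda>(u, i, j). if u then U i j else L i j)"

lemma V_simps [simp]: "V (True, i, j) = U i j" "V (False, i, j) = L i j"
  by (simp_all add: V_def)

lemma inj_on_V: "inj_on V (UNIV \<times> {..<a} \<times> {..<b})"
proof (rule inj_onI)
  fix x y assume xy: "x \<in> UNIV \<times> {..<a} \<times> {..<b}" "y \<in> UNIV \<times> {..<a} \<times> {..<b}" "V x = V y"
  obtain u i j where x: "x = (u, i, j)" by (cases x)
  obtain u' i' j' where y: "y = (u', i', j')" by (cases y)
  have "V x = L i j \<or> V x = U i j" "V x = L i' j' \<or> V x = U i' j'" using xy(3) unfolding x y by (cases u; cases u'; simp)+
  then have ij: "i = i'" "j = j'" using vertex_index_unique[of "V x" i j i' j'] xy(1,2) unfolding x y by auto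
  have "u = u'" using xy(3) unfolding x y ij by (cases u; cases u') (auto simp: L_def U_def)
  then show "x = y" using x y ij by simp
qed

end

lemma adj_bounded_part: "{v, w} \<in> edges (bounded_part f) \<Longrightarrow> (v, w) \<in> adj (bounded_part f)"
  unfolding adj_def edge_pair[symmetric] by (auto simp: edge_pair intro!: bexI[of _ "{v, w}"])

text \<open>Row \<open>0\<close> is a spine. Block \<open>k\<close> consists of two columns and two rows whose four crossings
  are resolved, which creates a cycle; its first column is tied to the spine.\<close>

definition blocks :: "nat \<Rightarrow> nat \<Rightarrow> bool" where
  "blocks i j \<longleftrightarrow> j = 0 \<and> even i \<or> 1 \<le> j \<and> (j - 1) div 2 = i div 2"

locale block_grid = grid a b blocks for a b +
  fixes m :: nat
  assumes dims: "a = 2 * m" "b = 2 * m + 1" and m: "2 \<le> m"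
begin

lemma less_dims [simp]: "i < a \<longleftrightarrow> i < 2 * m" "j < b \<longleftrightarrow> j < 2 * m + 1"
  by (simp_all only: dims)

lemma curve_vertices_B:
  "v \<in> curve_vertices gpoly \<longleftrightarrow> (\<exists>i j. i < 2 * m \<and> j < 2 * m + 1 \<and> blocks i j \<and> (v = L i j \<or> v = U i j))"
  unfolding curve_vertices_gpoly less_dims ..

lemma blocks_block: "i = 2 * k \<or> i = 2 * k + 1 \<Longrightarrow> j = 2 * k + 1 \<or> j = 2 * k + 2 \<Longrightarrow> blocks i j"
  unfolding blocks_def by auto

lemma blocks_cases:
  assumes "blocks i j"
  obtains k where "i = 2 * k" "j = 0" | k where "i = 2 * k \<or> i = 2 * k + 1" "j = 2 * k + 1 \<or> j = 2 * k + 2"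
proof (cases "j = 0")
  case True
  then show ?thesis using that(1) assms unfolding blocks_def by auto
next
  case False
  then have "(j - 1) div 2 = i div 2" "1 \<le> j" using assms unfolding blocks_def by auto
  then have "j = 2 * (i div 2) + 1 \<or> j = 2 * (i div 2) + 2" "i = 2 * (i div 2) \<or> i = 2 * (i div 2) + 1" by presburger+
  then show ?thesis using that(2) by blast
qed

abbreviation B :: "(real \<times> real, (real \<times> real) set) mgraph" where "B \<equiv> bounded_part gpoly"

lemma block_edges:
  assumes k: "k < m"
  shows "i = 2 * k \<or> i = 2 * k + 1 \<Longrightarrow> j = 2 * k + 1 \<or> j = 2 * k + 2 \<Longrightarrow> {L i j, U i j} \<in> edges B"
    "{L (2 * k) 0, U (2 * k) 0} \<in> edges B"
    "i = 2 * k \<or> i = 2 * k + 1 \<Longrightarrow> {U i (2 * k + 1), L i (2 * k + 2)} \<in> edges B"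
    "j = 2 * k + 1 \<or> j = 2 * k + 2 \<Longrightarrow> {L (2 * k) j, U (2 * k + 1) j} \<in> edges B"
    "{U (2 * k) 0, L (2 * k) (2 * k + 1)} \<in> edges B"
    "k + 1 < m \<Longrightarrow> {L (2 * k) 0, U (2 * (k + 1)) 0} \<in> edges B"
proof -
  show "{L i j, U i j} \<in> edges B" if "i = 2 * k \<or> i = 2 * k + 1" "j = 2 * k + 1 \<or> j = 2 * k + 2"
    by (rule edge_diagonal) (use that k blocks_block in auto)
  show "{L (2 * k) 0, U (2 * k) 0} \<in> edges B"
    by (rule edge_diagonal) (use k in \<open>auto simp: blocks_def\<close>)
  show "{U i (2 * k + 1), L i (2 * k + 2)} \<in> edges B" if "i = 2 * k \<or> i = 2 * k + 1"
    by (rule edge_up) (use that k blocks_block in auto)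
  show "{L (2 * k) j, U (2 * k + 1) j} \<in> edges B" if "j = 2 * k + 1 \<or> j = 2 * k + 2"
    by (rule edge_right) (use that k blocks_block in auto)
  show "{U (2 * k) 0, L (2 * k) (2 * k + 1)} \<in> edges B"
    by (rule edge_up) (use k blocks_block in \<open>auto simp: blocks_def\<close>)
  show "{L (2 * k) 0, U (2 * (k + 1)) 0} \<in> edges B" if "k + 1 < m"
  proof (rule edge_right)
    show "\<not> blocks i 0" if "2 * k < i" "i < 2 * (k + 1)" for i
    proof -
      have "i = 2 * k + 1" using that by simp
      then show ?thesis by (simp add: blocks_def)
    qed
  qed (use that in \<open>auto simp: blocks_def\<close>)
qed

section \<open>Connectedness of the block curve\<close>

lemma conn_edge: "{v, w} \<in> edges B \<Longrightarrow> (x, v) \<in> (adj B)\<^sup>* \<Longrightarrow> (x, w) \<in> (adj B)\<^sup>*"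
  using adj_bounded_part by (meson rtrancl.rtrancl_into_rtrancl)

lemma conn_spine: "k < m \<Longrightarrow> (L 0 0, L (2 * k) 0) \<in> (adj B)\<^sup>*"
proof (induction k)
  case (Suc k)
  then have "(L 0 0, U (2 * (k + 1)) 0) \<in> (adj B)\<^sup>*" using conn_edge[OF block_edges(6)[of k]] by simp
  moreover have "{U (2 * (k + 1)) 0, L (2 * (k + 1)) 0} \<in> edges B"
    using block_edges(2)[of "k + 1"] Suc.prems by (simp add: insert_commute)
  ultimately show ?case using conn_edge by (metis Suc_eq_plus1)
qed simp

lemma conn_vertex:
  assumes "v \<in> curve_vertices gpoly"
  shows "(L 0 0, v) \<in> (adj B)\<^sup>*"
proof -
  obtain i j where ij: "i < 2 * m" "j < 2 * m + 1" "blocks i j" "v = L i j \<or> v = U i j"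
    using assms unfolding curve_vertices_B by blast
  from ij(3) show ?thesis
  proof (cases rule: blocks_cases)
    case (1 k)
    then have k: "k < m" using ij by simp
    show ?thesis using ij(4) conn_spine[OF k] conn_edge[OF block_edges(2)[OF k] conn_spine[OF k]] 1 by blast
  next
    case (2 k)
    then have k: "k < m" using ij by auto
    note E = block_edges[OF k]
    have "(L 0 0, U (2 * k) 0) \<in> (adj B)\<^sup>*" by (rule conn_edge[OF E(2) conn_spine[OF k]])
    then have A: "(L 0 0, L (2 * k) (2 * k + 1)) \<in> (adj B)\<^sup>*" by (rule conn_edge[OF E(5)])
    then have A': "(L 0 0, U (2 * k) (2 * k + 1)) \<in> (adj B)\<^sup>*" by (rule conn_edge[OF E(1), rotated 2]) simp_all
    then have C: "(L 0 0, L (2 * k) (2 * k + 2)) \<in> (adj B)\<^sup>*" by (rule conn_edge[OF E(3), rotated 1]) simp_all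
    then have C': "(L 0 0, U (2 * k) (2 * k + 2)) \<in> (adj B)\<^sup>*" by (rule conn_edge[OF E(1), rotated 2]) simp_all
    have U': "(L 0 0, U (2 * k + 1) (2 * k + 1)) \<in> (adj B)\<^sup>*" by (rule conn_edge[OF E(4) A]) simp
    have U'': "(L 0 0, U (2 * k + 1) (2 * k + 2)) \<in> (adj B)\<^sup>*" by (rule conn_edge[OF E(4) C]) simp
    have L': "(L 0 0, L (2 * k + 1) (2 * k + 1)) \<in> (adj B)\<^sup>*"
      using conn_edge[OF _ U'] E(1)[of "2 * k + 1" "2 * k + 1"] by (simp add: insert_commute)
    have L'': "(L 0 0, L (2 * k + 1) (2 * k + 2)) \<in> (adj B)\<^sup>*"
      using conn_edge[OF _ U''] E(1)[of "2 * k + 1" "2 * k + 2"] by (simp add: insert_commute)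
    show ?thesis using 2 ij(4) A A' C C' U' U'' L' L'' by auto
  qed
qed

lemma connected_B: "mg_connected B"
  unfolding mg_connected_adj
proof (intro conjI ballI)
  have "0 < 2 * m \<and> 0 < 2 * m + 1 \<and> blocks 0 0" using m by (simp add: blocks_def)
  then have "L 0 0 \<in> curve_vertices gpoly" unfolding curve_vertices_B by blast
  then show "verts B \<noteq> {}" by auto
  fix u v assume "u \<in> verts B" "v \<in> verts B"
  then have "(L 0 0, u) \<in> (adj B)\<^sup>*" "(L 0 0, v) \<in> (adj B)\<^sup>*" using conn_vertex by simp_all
  then show "(u, v) \<in> (adj B)\<^sup>*" using adj_rtrancl_sym by (meson rtrancl_trans)
qed

lemma abstract_connected: "abstract_curve_connected gpoly"
  unfolding abstract_curve_connected_def
proof (intro conjI connected_B no_free_line)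
  show "\<exists>j<b. blocks i j" if ia: "i < a" for i
  proof -
    have "2 * (i div 2) + 1 < b" using ia by simp
    moreover have "blocks i (2 * (i div 2) + 1)" by (simp add: blocks_def)
    ultimately show ?thesis by blast
  qed
  show "\<exists>i<a. blocks i j" if jb: "j < b" for j
  proof (cases "j = 0")
    case True
    then have "0 < a \<and> blocks 0 j" using m by (simp add: blocks_def)
    then show ?thesis by blast
  next
    case False
    have "j < 2 * m + 1" using jb by simp
    then have "2 * ((j - 1) div 2) < a" using False by (simp; linarith)
    moreover have "blocks (2 * ((j - 1) div 2)) j" using False by (simp add: blocks_def)
    ultimately show ?thesis by blast
  qed
qed

text \<open>The eight vertices of a block, as an image under the injective indexing
  \<open>V\<close>, so that its inner edges can be counted among the indices.\<close>

definition W :: "nat \<Rightarrow> (real \<times> real) set" where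
  "W k = V ` (UNIV \<times> {2 * k, 2 * k + 1} \<times> {2 * k + 1, 2 * k + 2})"

lemma W_iff: "v \<in> W k \<longleftrightarrow> (\<exists>i j. (i = 2 * k \<or> i = 2 * k + 1) \<and> (j = 2 * k + 1 \<or> j = 2 * k + 2) \<and> (v = L i j \<or> v = U i j))"
proof
  assume "v \<in> W k"
  then obtain u i j where uij: "v = V (u, i, j)" "i = 2 * k \<or> i = 2 * k + 1" "j = 2 * k + 1 \<or> j = 2 * k + 2"
    unfolding W_def by blast
  have "v = L i j \<or> v = U i j" unfolding uij(1) by (cases u) simp_all
  then show "\<exists>i j. (i = 2 * k \<or> i = 2 * k + 1) \<and> (j = 2 * k + 1 \<or> j = 2 * k + 2) \<and> (v = L i j \<or> v = U i j)"
    using uij(2,3) by blast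
next
  assume "\<exists>i j. (i = 2 * k \<or> i = 2 * k + 1) \<and> (j = 2 * k + 1 \<or> j = 2 * k + 2) \<and> (v = L i j \<or> v = U i j)"
  then obtain i j where ij: "i = 2 * k \<or> i = 2 * k + 1" "j = 2 * k + 1 \<or> j = 2 * k + 2" "v = L i j \<or> v = U i j" by blast
  then have "v = V (False, i, j) \<or> v = V (True, i, j)" by simp
  then show "v \<in> W k" unfolding W_def using ij(1,2) by blast
qed

lemma W_vertices: "k < m \<Longrightarrow> W k \<subseteq> curve_vertices gpoly"
proof
  fix v assume k: "k < m" and "v \<in> W k"
  then obtain i j where ij: "i = 2 * k \<or> i = 2 * k + 1" "j = 2 * k + 1 \<or> j = 2 * k + 2" "v = L i j \<or> v = U i j"
    unfolding W_iff by blast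
  moreover have "i < 2 * m" "j < 2 * m + 1" using ij k by auto
  ultimately show "v \<in> curve_vertices gpoly" unfolding curve_vertices_B using blocks_block by blast
qed

text \<open>The column tied to the spine has been shifted once on reaching the block, and twice
  after the first crossing of the block. These offsets decide which vertices can be joined
  vertically.\<close>

lemma X1_block: "X1 (2 * k) (2 * k + 1) = X1 (2 * k) 0 - 1" "X1 (2 * k) (2 * k + 2) = X1 (2 * k) 0 - 2"
proof -
  have "X1 (2 * k) (2 * k + 1) = X1 (2 * k) (Suc 0)"
    by (rule X1_const) (auto simp: blocks_def)
  then show 1: "X1 (2 * k) (2 * k + 1) = X1 (2 * k) 0 - 1" by (simp add: X1_Suc blocks_def)
  show "X1 (2 * k) (2 * k + 2) = X1 (2 * k) 0 - 2"
    using 1 X1_Suc[of "2 * k" "2 * k + 1"] by (simp add: blocks_def)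
qed

text \<open>The rows of a block are resolved only inside the block, so horizontal edges stay in it.
  A vertical edge can leave it only in the column \<open>2 * k\<close>, towards row 0.\<close>

lemma exit_edge_B:
  assumes k: "k < m" and x: "x \<in> W k" and y: "y \<notin> W k" and e: "{x, y} \<in> edges B"
  shows "{x, y} = {L (2 * k) (2 * k + 1), U (2 * k) 0}"
proof -
  obtain i j where i: "i = 2 * k \<or> i = 2 * k + 1" and j: "j = 2 * k + 1 \<or> j = 2 * k + 2" and xv: "x = L i j \<or> x = U i j"
    using x unfolding W_iff by blast
  have ij: "i < a" "j < b" using i j k by auto
  have s: "blocks i j" using i j by (rule blocks_block)
  have "y \<in> curve_vertices gpoly" using e unfolding edge_pair by blast
  then obtain p q where pq: "p < a" "q < b" "blocks p q" "y = L p q \<or> y = U p q"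
    unfolding curve_vertices_gpoly by blast
  have part: "y \<noteq> L i j" "y \<noteq> U i j" using y i j unfolding W_iff by blast+
  have dir: "fst y = fst x \<or> snd y = snd x"
    using xv edge_L[OF ij s, of y] edge_U[OF ij s, of y] e part by auto
  have bx: "band1 i (fst x)" "band2 j (snd x)" and bY: "band1 p (fst y)" "band2 q (snd y)"
    using xv pq(4) vertex_band[OF ij] vertex_band[OF pq(1,2)] by auto
  have vert: "fst y = fst x"
  proof (rule ccontr)
    assume "fst y \<noteq> fst x"
    then have "q = j" using dir band2_unique bx(2) bY(2) by metis
    then have "(p = 2 * k \<or> p = 2 * k + 1)" using pq(3) j unfolding blocks_def by auto
    then show False using y pq(4) j \<open>q = j\<close> unfolding W_iff by blast
  qed
  then have p: "p = i" using band1_unique bx(1) bY(1) by metis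
  have q: "q = 0 \<and> i = 2 * k"
    using pq(3) unfolding p
  proof (cases rule: blocks_cases)
    case (1 k')
    then show ?thesis using i by auto
  next
    case (2 k')
    then have "k' = k" using i by auto
    then show ?thesis using 2 y pq(4) p unfolding W_iff by blast
  qed
  \<comment> \<open>With X the initial abscissa of the column, the spine vertices lie at X and X -
    1, while the block vertices lie at X - 1, X - 2 or X - 3. Only the pair at X - 1
    matches.\<close>
  have "fst y = X1 (2 * k) 0 \<or> fst y = X1 (2 * k) 0 - 1" "y = L (2 * k) 0 \<longrightarrow> fst y = X1 (2 * k) 0"
    using pq(4) q p by (auto simp: L_def U_def)
  moreover have "j = 2 * k + 1 \<and> x = L i j \<or> fst x \<le> X1 (2 * k) 0 - 2"
    using xv j q X1_block[of k] by (auto simp: L_def U_def)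
  ultimately have "j = 2 * k + 1 \<and> x = L i j" using vert by (elim disjE) simp_all
  moreover have "y = U (2 * k) 0"
  proof (rule ccontr)
    assume "y \<noteq> U (2 * k) 0"
    then have "fst y = X1 (2 * k) 0" using pq(4) q p by (auto simp: L_def)
    then show False using vert calculation q X1_block(1)[of k] by (simp add: L_def)
  qed
  ultimately show ?thesis using q by simp
qed

lemma exits_W:
  assumes k: "k < m"
  shows "card (exit_edges B (W k)) \<le> 1"
proof -
  have "exit_edges B (W k) \<subseteq> {{L (2 * k) (2 * k + 1), U (2 * k) 0}}"
  proof
    fix e assume "e \<in> exit_edges B (W k)"
    then obtain x y where e: "e \<in> edges B" and x: "x \<in> W k" "x \<in># mset_set e" and y: "y \<notin> W k" "y \<in># mset_set e"
      unfolding exit_edges_def by auto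
    have fin: "finite e" using e unfolding edges_bounded_part by auto
    have "x \<in> e" "y \<in> e" "x \<noteq> y" using x y fin by auto
    then have "e = {x, y}" using edge_at[OF e \<open>x \<in> e\<close>] by (metis empty_iff insert_iff)
    then show "e \<in> {{L (2 * k) (2 * k + 1), U (2 * k) 0}}" using exit_edge_B[OF k x(1) y(1)] e by simp
  qed
  from card_mono[OF _ this] show ?thesis by simp
qed

text \<open>There are eight vertices and eight inner edges: four diagonals, two vertical and two
  horizontal ones. Distinctness is checked on indices and transferred by injectivity of
  \<open>V\<close>.\<close>

lemma card_inner_W:
  assumes k: "k < m"
  shows "card (W k) \<le> card (inner_edges B (W k))"
proof -
  define i j where "i = 2 * k" and "j = 2 * k + 1"
  let ?A = "(UNIV :: bool set) \<times> {i, i + 1} \<times> {j, j + 1}"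
  let ?E = "{{(False, i, j), (True, i, j)}, {(False, i + 1, j), (True, i + 1, j)},
      {(False, i, j + 1), (True, i, j + 1)}, {(False, i + 1, j + 1), (True, i + 1, j + 1)},
      {(True, i, j), (False, i, j + 1)}, {(True, i + 1, j), (False, i + 1, j + 1)},
      {(False, i, j), (True, i + 1, j)}, {(False, i, j + 1), (True, i + 1, j + 1)}}"
  have A: "W k = V ` ?A" unfolding W_def i_def j_def by (simp only: add.assoc one_add_one)
  have "card (W k) \<le> card ?A" unfolding A by (rule card_image_le) simp
  also have "card ?A = 8" by (simp add: card_cartesian_product)
  finally have le: "card (W k) \<le> 8" .
  have Ek: "?E \<subseteq> Pow ?A" by auto
  have "?A \<subseteq> UNIV \<times> {..<a} \<times> {..<b}" using k unfolding i_def j_def by auto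
  then have "inj_on V ?A" by (rule inj_on_subset[OF inj_on_V])
  then have "inj_on ((`) V) ?E" by (rule inj_on_subset[OF inj_on_image_Pow Ek])
  then have c: "card ((`) V ` ?E) = card ?E" by (rule card_image)
  have "card ?E = 8" by (simp add: doubleton_eq_iff)
  have "(`) V ` ?E \<subseteq> inner_edges B (W k)"
  proof
    fix e assume "e \<in> (`) V ` ?E"
    then obtain e' where e': "e' \<in> ?E" "e = V ` e'" by blast
    have sub: "e \<subseteq> W k" using e' Ek unfolding A by blast
    have "e \<in> edges B"
      using e'(1) block_edges(1)[OF k, of i j] block_edges(1)[OF k, of "i + 1" j] block_edges(1)[OF k, of i "j + 1"]
        block_edges(1)[OF k, of "i + 1" "j + 1"] block_edges(3)[OF k, of i] block_edges(3)[OF k, of "i + 1"]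
        block_edges(4)[OF k, of j] block_edges(4)[OF k, of "j + 1"]
      unfolding e'(2) i_def j_def by (elim insertE emptyE) simp_all
    moreover have "finite e" using e' by auto
    ultimately show "e \<in> inner_edges B (W k)" unfolding inner_edges_def using sub by simp
  qed
  then have "card ((`) V ` ?E) \<le> card (inner_edges B (W k))"
    using finite_mgraph_bounded_part[OF nodal_gpoly] unfolding finite_mgraph_def inner_edges_def
    by (intro card_mono) auto
  then show ?thesis using le c \<open>card ?E = 8\<close> by simp
qed

lemma cyclic_family_W: "cyclic_family B m W"
  unfolding cyclic_family_def one_exit_family_def
proof (intro conjI allI impI)
  fix k assume k: "k < m"
  show "W k \<noteq> {}" unfolding W_def by blast
  show "W k \<subseteq> verts B" using W_vertices[OF k] by simp
  show "card (exit_edges B (W k)) \<le> 1" by (rule exits_W[OF k])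
  show "card (W k) \<le> card (inner_edges B (W k))" by (rule card_inner_W[OF k])
next
  fix k k' assume kk: "k < m" "k' < m" "k \<noteq> k'"
  show "W k \<inter> W k' = {}"
  proof (rule ccontr)
    assume "W k \<inter> W k' \<noteq> {}"
    then obtain v where v: "v \<in> W k" "v \<in> W k'" by blast
    obtain i j where ij: "i = 2 * k \<or> i = 2 * k + 1" "j = 2 * k + 1 \<or> j = 2 * k + 2" "v = L i j \<or> v = U i j"
      using v(1) unfolding W_iff by blast
    obtain i' j' where ij': "i' = 2 * k' \<or> i' = 2 * k' + 1" "j' = 2 * k' + 1 \<or> j' = 2 * k' + 2" "v = L i' j' \<or> v = U i' j'"
      using v(2) unfolding W_iff by blast
    have "i = i'" by (rule vertex_index_unique(1)[OF ij(3) ij'(3)]) (use ij ij' kk in auto)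
    then show False using ij(1) ij'(1) kk(3) by auto
  qed
qed

lemma reducible_B: "reducible m B"
  unfolding reducible_def
  using finite_mgraph_bounded_part[OF nodal_gpoly] connected_B mg_degree_bounded_part_le[OF nodal_gpoly] cyclic_family_W
  by auto

lemma card_vertices_B: "card (curve_vertices gpoly) \<le> 10 * m"
proof -
  let ?R1 = "(\<lambda>k. (2 * k, 0 :: nat)) ` {..<m}"
    and ?R2 = "(\<lambda>(k, x, y). (2 * k + x, 2 * k + 1 + y)) ` ({..<m} \<times> {0, 1 :: nat} \<times> {0, 1 :: nat})"
  have "curve_vertices gpoly \<subseteq> V ` (UNIV \<times> (?R1 \<union> ?R2))"
  proof
    fix v assume "v \<in> curve_vertices gpoly"
    then obtain i j where ij: "i < 2 * m" "j < 2 * m + 1" "blocks i j" "v = L i j \<or> v = U i j"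
      unfolding curve_vertices_B by blast
    have "(i, j) \<in> ?R1 \<union> ?R2" using ij(3)
    proof (cases rule: blocks_cases)
      case (1 k)
      then show ?thesis using ij by auto
    next
      case (2 k)
      have "(i, j) = (\<lambda>(k, x, y). (2 * k + x, 2 * k + 1 + y)) (k, i - 2 * k, j - (2 * k + 1))"
        "(k, i - 2 * k, j - (2 * k + 1)) \<in> {..<m} \<times> {0, 1} \<times> {0, 1}" using 2 ij by auto
      then show ?thesis by blast
    qed
    moreover have "v = V (False, i, j) \<or> v = V (True, i, j)" using ij(4) by simp
    ultimately show "v \<in> V ` (UNIV \<times> (?R1 \<union> ?R2))" by blast
  qed
  then have "card (curve_vertices gpoly) \<le> card (V ` (UNIV \<times> (?R1 \<union> ?R2)))" by (intro card_mono) auto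
  also have "\<dots> \<le> card ((UNIV :: bool set) \<times> (?R1 \<union> ?R2))" by (rule card_image_le) auto
  also have "\<dots> = 2 * card (?R1 \<union> ?R2)" by (simp add: card_cartesian_product)
  also have "card (?R1 \<union> ?R2) \<le> card ?R1 + card ?R2" by (rule card_Un_le)
  also have "card ?R1 \<le> card {..<m}" by (rule card_image_le) simp
  also have "card ?R2 \<le> card ({..<m} \<times> {0, 1 :: nat} \<times> {0, 1 :: nat})" by (rule card_image_le) simp
  finally show ?thesis by (simp add: card_cartesian_product)
qed

text \<open>Degrees at most 3 bound the edges by 3/2 of the vertices, so the genus is at most half
  the number of vertices plus 1; each of the \<open>5 * m\<close> resolved crossings has two
  vertices.\<close>

lemma genus_B: "genus B \<le> 5 * int m + 1"
proof -
  have "2 * card (edges B) = (\<Sum>v\<in>verts B. mg_degree B v)"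
    using handshake[OF finite_mgraph_bounded_part[OF nodal_gpoly]] by simp
  also have "\<dots> \<le> (\<Sum>v\<in>verts B. 3)" by (rule sum_mono) (use mg_degree_bounded_part_le[OF nodal_gpoly] in simp)
  finally have "2 * card (edges B) \<le> 3 * card (curve_vertices gpoly)" by simp
  then show ?thesis using card_vertices_B unfolding genus_def by simp
qed

lemma TCN_bounds:
  assumes "1000 \<le> m"
  shows "\<exists>G :: (nat, nat) mgraph. finite_mgraph G \<and> mg_connected G \<and> trivalent G \<and>
    int m + 2 \<le> 2 * genus G \<and> genus G \<le> 5 * int m + 1 \<and>
    (real m)\<^sup>2 / 128 \<le> real (TCN G) \<and> TCN G \<le> 2 * m * (2 * m + 1)"
proof -
  obtain S where S: "reduces_to B S" "reducible m S" "genus S = genus B" "trivalent S"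
    using reducible_reduces[OF reducible_B] m by auto
  have finS: "finite_mgraph S" "mg_connected S" using S(2) unfolding reducible_def by blast+
  obtain X where X: "one_exit_family S m X" using S(2) unfolding reducible_def cyclic_family_def by blast
  obtain G :: "(nat, nat) mgraph" where iso: "mg_iso S G" using nat_mgraph_copy[OF finS(1)] by blast
  note G = mg_iso_transport[OF finS(1) iso]
  have gG: "genus G \<le> 5 * int m + 1" using G(2) S(3) genus_B by simp
  have tri: "trivalent G" using G(3) S(4) by blast
  obtain Y where Y: "one_exit_family G m Y" using G(5)[OF X] by blast
  have low: "int m + 2 \<le> 2 * genus G"
    using genus_trivalent[OF G(1) tri] card_one_exit_family[OF G(1) Y] by simp
  let ?T = "{card (nodes f) | f. nodal_tropical_curve f \<and> has_skeleton f G}"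
  have "has_skeleton gpoly G" unfolding has_skeleton_def using abstract_connected S(1) iso by blast
  then have inT: "card (nodes gpoly) \<in> ?T" using nodal_gpoly by blast
  have "TCN G \<le> card (nodes gpoly)" unfolding TCN_def using inT by (intro cInf_lower) auto
  also have "\<dots> \<le> 2 * m * (2 * m + 1)" using card_nodes_gpoly by (simp only: dims)
  finally have up: "TCN G \<le> 2 * m * (2 * m + 1)" .
  \<comment> \<open>The infimum is attained. The lower bound is applied to an optimal curve
    \<open>f\<close>, after moving the pieces from \<open>G\<close> back to its bounded
    part.\<close>
  have "TCN G \<in> ?T" unfolding TCN_def using inT by (intro Inf_nat_def1) blast
  then obtain f where f: "TCN G = card (nodes f)" "nodal_tropical_curve f" "has_skeleton f G" by blast
  obtain S' where S': "reduces_to (bounded_part f) S'" "mg_iso S' G" using f(3) unfolding has_skeleton_def by blast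
  note fin' = reduces_to_lift[OF finite_mgraph_bounded_part[OF f(2)] S'(1)]
  note iso_back = mg_iso_transport[OF G(1) mg_iso_sym[OF fin'(1) S'(2)]]
  obtain Z where "one_exit_family S' m Z" using iso_back(5)[OF Y] by blast
  then obtain Z' where Z': "one_exit_family (bounded_part f) m Z'" using fin'(3) by blast
  have "genus (bounded_part f) = genus G" using fin'(2) iso_back(2) by simp
  then have "(real m)\<^sup>2 / 128 \<le> real (TCN G)"
    using card_nodes_ge_square[OF f(2) Z' _ assms] gG f(1) by simp
  then show ?thesis using G(1) G(4)[OF finS(2)] tri low gG up by blast
qed

end

section \<open>Choice of the sequence and of the constants\<close>

lemma graph_with_large_TCN:
  assumes "1000 \<le> m"
  shows "\<exists>G :: (nat, nat) mgraph. finite_mgraph G \<and> mg_connected G \<and> trivalent G \<and>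
    int m + 2 \<le> 2 * genus G \<and> genus G \<le> 5 * int m + 1 \<and>
    (real m)\<^sup>2 / 128 \<le> real (TCN G) \<and> TCN G \<le> 2 * m * (2 * m + 1)"
proof -
  have "block_grid (2 * m) (2 * m + 1) m" by unfold_locales (use assms in auto)
  then show ?thesis using assms by (rule block_grid.TCN_bounds)
qed

theorem proposition5:
  shows "\<exists>(c::real) (C::real) (G :: nat \<Rightarrow> (nat, nat) mgraph).
    0 < c \<and> c \<le> C \<and>
    (\<forall>n\<ge>1. finite_mgraph (G n) \<and> mg_connected (G n) \<and> trivalent (G n)) \<and>
    filterlim (\<lambda>n. genus (G n)) at_top sequentially \<and>
    (\<forall>n\<ge>1. c * (real_of_int (genus (G n)))\<^sup>2 \<le> real (TCN (G n)) \<and>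
           real (TCN (G n)) \<le> C * (real_of_int (genus (G n)))\<^sup>2)"
proof -
  \<comment> \<open>The shift by 1000 makes the quadratic lower bound available for every
    index.\<close>
  have "\<forall>n. \<exists>G :: (nat, nat) mgraph. finite_mgraph G \<and> mg_connected G \<and> trivalent G \<and>
    int (n + 1000) + 2 \<le> 2 * genus G \<and> genus G \<le> 5 * int (n + 1000) + 1 \<and>
    (real (n + 1000))\<^sup>2 / 128 \<le> real (TCN G) \<and> TCN G \<le> 2 * (n + 1000) * (2 * (n + 1000) + 1)"
    by (intro allI graph_with_large_TCN) simp
  from choice[OF this] obtain G :: "nat \<Rightarrow> (nat, nat) mgraph" where
    G: "\<And>n. finite_mgraph (G n) \<and> mg_connected (G n) \<and> trivalent (G n)" and
    g: "\<And>n. int (n + 1000) + 2 \<le> 2 * genus (G n)" "\<And>n. genus (G n) \<le> 5 * int (n + 1000) + 1" and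
    T: "\<And>n. (real (n + 1000))\<^sup>2 / 128 \<le> real (TCN (G n))"
      "\<And>n. TCN (G n) \<le> 2 * (n + 1000) * (2 * (n + 1000) + 1)" by blast
  have lim: "filterlim (\<lambda>n. genus (G n)) at_top sequentially"
    unfolding filterlim_at_top
  proof
    fix Z :: int
    show "eventually (\<lambda>n. Z \<le> genus (G n)) sequentially"
      using eventually_ge_at_top[of "nat (2 * Z)"]
    proof eventually_elim
      case (elim n)
      then have "2 * Z \<le> int n" by linarith
      then show ?case using g(1)[of n] by linarith
    qed
  qed
  \<comment> \<open>From \<open>\<gamma> \<le> 6 * x\<close> one gets 4608 = 36 * 128; from
    \<open>x \<le> 2 * \<gamma>\<close> and the upper bound \<open>6 * x\<^sup>2\<close> one gets 24
    = 6 * 4.\<close>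
  have bounds: "1 / 4608 * (real_of_int (genus (G n)))\<^sup>2 \<le> real (TCN (G n)) \<and>
      real (TCN (G n)) \<le> 24 * (real_of_int (genus (G n)))\<^sup>2" for n
  proof -
    define x \<gamma> where "x = real (n + 1000)" and "\<gamma> = real_of_int (genus (G n))"
    have x: "1000 \<le> x" "x \<le> 2 * \<gamma>" "\<gamma> \<le> 6 * x" using g(1)[of n] g(2)[of n] unfolding x_def \<gamma>_def by linarith+
    have "\<gamma>\<^sup>2 \<le> (6 * x)\<^sup>2" using x by (intro power_mono) auto
    then have 1: "1 / 4608 * \<gamma>\<^sup>2 \<le> x\<^sup>2 / 128" by (simp add: power_mult_distrib)
    have "real (TCN (G n)) \<le> real (2 * (n + 1000) * (2 * (n + 1000) + 1))" using T(2)[of n] by (simp only: of_nat_le_iff)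
    also have "\<dots> = 4 * x\<^sup>2 + 2 * x" unfolding x_def by (simp add: power2_eq_square algebra_simps)
    also have "\<dots> \<le> 6 * x\<^sup>2" using x(1) by (simp add: power2_eq_square)
    also have "\<dots> \<le> 6 * (2 * \<gamma>)\<^sup>2" using x by (intro mult_left_mono power_mono) auto
    finally have 2: "real (TCN (G n)) \<le> 24 * \<gamma>\<^sup>2" by (simp add: power_mult_distrib)
    show ?thesis using 1 2 T(1)[of n] unfolding x_def \<gamma>_def by linarith
  qed
  show ?thesis
    by (rule exI[of _ "1 / 4608"], rule exI[of _ 24], rule exI[of _ G]) (use G lim bounds in auto)
qed

end
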